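(* Let $d\ge3$, $\kappa\in(0,1]$, $\gamma\in(0,(d-2)/6)$, let $T_0\in L^2(\mathbb{T}^d)$ have zero mean, let $T$ be the solution of $$\partial_tT+\mathbf{u}^\alpha\cdot\nabla T=\kappa\Delta T\quad\text{in }[0,1]\times\mathbb{T}^d,\qquad T|_{t=0}=T_0,$$ and let $\bar T$ be the solution of $\partial_t\bar T=(\kappa\Delta+\mathcal{L})\bar T$ in $[0,1]\times\mathbb{T}^d$ with $\bar T|_{t=0}=T_0$. Let $\theta,\varkappa,\varsigma>0$ and $C\in(0,\infty)$ (not depending on $T_0,\kappa,\theta,\varkappa,\varsigma,\alpha,\epsilon,\mu$) be such that, for every $\alpha$ sufficiently large, $$\mathbb{E}\left[\|T-\bar T\|_{C^\theta([0,1],H^{-1}(\mathbb{T}^d))}\right]\le C\|T_0\|_{L^2(\mathbb{T}^d)}\left(\epsilon+\frac{\mu^{2+\gamma}}{\alpha^\varkappa}\right)^{\varsigma},$$ and let $\alpha$ be sufficiently large in this sense. Let $c=C^{1/2}\left(\epsilon+\frac{\mu^{2+\gamma}}{\alpha^\varkappa}\right)^{\varsigma/2}>0$ and let $\lambda>0$ be the principal eigenvalue of the operator $-A=-(\kappa\Delta+\mathcal{L})$. Then the following inequality holds with probability at least $1-c$ for every $t\in[0,1]$: $$\|T_t\|_{L^2(\mathbb{T}^d)}\le\frac{\|T_0\|_{L^2(\mathbb{T}^d)}}{\left(1+\frac{\kappa}{2\lambda c^2}\log\left(\frac{c^2e^{2\lambda t}+1}{c^2+1}\right)\right)^{1/2}}.$$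 In particular, for every $t\in[0,1]$, $$\mathbb{E}\left[\|T_t\|_{L^2(\mathbb{T}^d)}\right]\le c\,\|T_0\|_{L^2(\mathbb{T}^d)}+\frac{\|T_0\|_{L^2(\mathbb{T}^d)}}{\left(1+\frac{\kappa}{2\lambda c^2}\log\left(\frac{c^2e^{2\lambda t}+1}{c^2+1}\right)\right)^{1/2}}.$$
   Context: **Function spaces.** $\mathbb{T}^d=\mathbb{R}^d/2\pi\mathbb{Z}^d$, $\mathbb{Z}^d_0=\mathbb{Z}^d\setminus\{0\}$, $e_k(x)=(2\pi)^{-d/2}e^{ik\cdot x}$. Unless otherwise stated distributions are real-valued with zero mean; $\mathcal{S}'(\mathbb{T}^d)$ is the space of these, identified with their Fourier coefficients $\{\hat f_k\}_{k\in\mathbb{Z}^d_0}$ with respect to $e_k$. For $s\in\mathbb{R}$, $H^s(\mathbb{T}^d)$ is the homogeneous Sobolev space of $f\in\mathcal{S}'(\mathbb{T}^d)$ with $\|f\|_{H^s(\mathbb{T}^d)}^2=\sum_{k\in\mathbb{Z}^d_0}|k|^{2s}|\hat f_k|^2<\infty$; $L^2(\mathbb{T}^d)=H^0(\mathbb{T}^d)$; $\langle\cdot,\cdot\rangle$ is the $L^2$ scalar product, also used as duality between $H^s$ and $H^{-s}$. Vector-valued spaces are defined componentwise. $\mathcal{D}(\mathbb{T}^d)$ is the space of real-valued zero-mean smooth test functions. **Noise.** $J$ is a finite index set. $(\Omega^\pm,\{\mathcal{F}^\pm_t\}_{t\ge0},\mathbb{P}^\pm)$ are two filtered probability spaces satisfying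 the usual conditions, supporting families of i.i.d. Brownian motions $\{W^{\pm,j}\}_{j\in J}$; on $\Omega=\Omega^-\times\Omega^+$, $\mathbb{P}=\mathbb{P}^-\otimes\mathbb{P}^+$ set $W^j_t=W^{+,j}_t$ for $t\ge0$, $W^j_t=W^{-,j}_{-t}$ for $t<0$, and let $\{\mathcal{F}_t\}_{t\in[0,1]}$ be the augmentation of $\{\mathcal{F}^-_\infty\otimes\mathcal{F}^+_t\}_{t\in[0,1]}$. For $\alpha>1$, $\eta^{\alpha,j}(t)=\int_{-\infty}^t\alpha e^{-\alpha(t-s)}dW^j_s$, $t\in[0,1]$ (i.i.d. stationary Ornstein–Uhlenbeck processes solving $d\eta^{\alpha,j}=-\alpha\eta^{\alpha,j}dt+\alpha dW^j_t$). The velocity field is $\mathbf{u}^\alpha(t,x)=\sum_{j\in J}\mathbf{u}_j(x)\eta^{\alpha,j}(t)$, where $\mathbf{u}_j:\mathbb{T}^d\to\mathbb{R}^d$ are smooth with $\mathrm{div}\,\mathbf{u}_j=0$. **Operator and parameters.** $\mathcal{L}$ acts on smooth $f$ by $(\mathcal{L}f)(x)=\frac12\sum_{j\in J}\mathbf{u}_j(x)\cdot\nabla(\mathbf{u}_j\cdot\nabla f)(x)$, and $A=\kappa\Delta+\mathcal{L}$ (acting on zero-mean distributions). Further $$\epsilon^2=\sup\Big\{\sum_{j\in J}\langle\mathbf{u}_j,\mathbf{v}\rangle^2:\mathbf{v}\in L^2(\mathbb{T}^d,\mathbb{R}^d),\ \|\mathbf{v}\|_{L^2(\mathbb{T}^d,\mathbb{R}^d)}=1\Big\},$$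 $$\mu=\max\Big\{|J|\sum_{j\in J}\|\mathbf{u}_j\|_{H^{d/2-\gamma}(\mathbb{T}^d)},\ |J|\sum_{j\in J}\|\mathbf{u}_j\|_{L^\infty(\mathbb{T}^d)},\ \|\mathcal{L}\|^{1/2}_{H^2(\mathbb{T}^d),L^2(\mathbb{T}^d)}\Big\},$$ where $\|\mathcal{L}\|_{H^2,L^2}$ is the operator norm of $\mathcal{L}:H^2(\mathbb{T}^d)\to L^2(\mathbb{T}^d)$. Standing assumption: $\mu\in(1,\infty)$. "$\alpha$ sufficiently large" means: $\alpha>1$ and $\mu\,\alpha^{-p_1}\log^{p_2}(1+\alpha)<1$ for certain $p_1,p_2>0$ depending only on $\gamma,\theta,\varkappa$. **Solutions.** $T_0$ is deterministic. For $\kappa>0$, $T:\Omega\times[0,1]\to L^2(\mathbb{T}^d)$ is the unique $\{\mathcal{F}_t\}$-adapted process such that almost surely $T\in L^\infty([0,1],L^2(\mathbb{T}^d))\cap L^2([0,1],H^1(\mathbb{T}^d))$, $T|_{t=0}=T_0$, and for all $s<t$, $\phi\in\mathcal{D}(\mathbb{T}^d)$: $\langle\phi,T_t\rangle=\langle\phi,T_s\rangle+\int_s^t\langle\mathbf{u}^\alpha(r)\cdot\nabla\phi,T_r\rangle dr+\kappa\int_s^t\langle\Delta\phi,T_r\rangle dr$. $\bar T_t=e^{At}T_0$, where $e^{A\cdot}$ is the analytic semigroup generated by $A$. *)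

theory Defs
  imports "HOL-Probability.Probability"
begin

section \<open>Functions and distributions on the torus\<close>

text \<open>
  The torus is \<open>\<real>\<^sup>d / 2\<pi>\<int>\<^sup>d\<close> with \<open>d = CARD('n)\<close>; functions on it are \<open>2\<pi>\<close>-periodic functions
  on \<^typ>\<open>real ^ 'n\<close>.
\<close>

definition kvec :: "int ^ 'n \<Rightarrow> real ^ 'n" where
  "kvec k = (\<chi> i. of_int (k $ i))"

definition periodic :: "(real ^ 'n \<Rightarrow> 'b) \<Rightarrow> bool" where
  "periodic f \<longleftrightarrow> (\<forall>x k. f (x + (2 * pi) *\<^sub>R kvec k) = f x)"

definition cube :: "(real ^ 'n) set" where
  "cube = cbox 0 (\<chi> i. 2 * pi)"

definition partial :: "'n \<Rightarrow> (real ^ 'n \<Rightarrow> 'b::real_normed_vector) \<Rightarrow> real ^ 'n \<Rightarrow> 'b" where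
  "partial i f x = frechet_derivative f (at x) (axis i 1)"

primrec Ck :: "nat \<Rightarrow> (real ^ 'n \<Rightarrow> 'b::real_normed_vector) \<Rightarrow> bool" where
  "Ck 0 f \<longleftrightarrow> continuous_on UNIV f"
| "Ck (Suc m) f \<longleftrightarrow> (\<forall>x. f differentiable (at x)) \<and> (\<forall>i. Ck m (partial i f))"

definition smooth :: "(real ^ 'n \<Rightarrow> 'b::real_normed_vector) \<Rightarrow> bool" where
  "smooth f \<longleftrightarrow> (\<forall>m. Ck m f)"

definition divergence :: "(real ^ 'n \<Rightarrow> real ^ 'n) \<Rightarrow> real ^ 'n \<Rightarrow> real" where
  "divergence v x = (\<Sum>i\<in>UNIV. partial i v x $ i)"

definition laplacian :: "(real ^ 'n \<Rightarrow> 'b::real_normed_vector) \<Rightarrow> real ^ 'n \<Rightarrow> 'b" where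
  "laplacian f x = (\<Sum>i\<in>UNIV. partial i (partial i f) x)"

text \<open>\<open>v \<cdot> \<nabla>f\<close>, the derivative of \<open>f\<close> along the vector field \<open>v\<close>.\<close>

definition adv :: "(real ^ 'n \<Rightarrow> real ^ 'n) \<Rightarrow> (real ^ 'n \<Rightarrow> 'b::real_normed_vector) \<Rightarrow> real ^ 'n \<Rightarrow> 'b" where
  "adv v f x = frechet_derivative f (at x) (v x)"

definition test_functions :: "(real ^ 'n \<Rightarrow> real) set" where
  "test_functions = {\<phi>. smooth \<phi> \<and> periodic \<phi> \<and> (LINT x:cube|lborel. \<phi> x) = 0}"

definition e_basis :: "int ^ 'n \<Rightarrow> real ^ 'n \<Rightarrow> complex" where
  "e_basis k x = of_real ((2 * pi) powr (- real CARD('n) / 2)) * cis (kvec k \<bullet> x)"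

definition fourier :: "(real ^ 'n \<Rightarrow> complex) \<Rightarrow> int ^ 'n \<Rightarrow> complex" where
  "fourier f k = (LINT x:cube|lborel. f x * cnj (e_basis k x))"

text \<open>
  Distributions are identified with their Fourier coefficients; the coefficient at \<open>0\<close> is
  kept in the index set and required to vanish. The symmetry condition says that the
  distribution is real-valued.
\<close>

type_synonym 'n distr = "(int, 'n) vec \<Rightarrow> complex"

definition distribution :: "'n::finite distr \<Rightarrow> bool" where
  "distribution f \<longleftrightarrow> f 0 = 0 \<and> (\<forall>k. f (- k) = cnj (f k)) \<and>
     (\<exists>C m. \<forall>k. cmod (f k) \<le> C * (1 + norm (kvec k)) ^ m)"

definition Hsp :: "real \<Rightarrow> 'n::finite distr set" where
  "Hsp s = {f. distribution f \<and> (\<lambda>k. norm (kvec k) powr (2 * s) * (cmod (f k))\<^sup>2) summable_on - {0}}"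

definition Hnorm :: "real \<Rightarrow> 'n::finite distr \<Rightarrow> real" where
  "Hnorm s f = sqrt (\<Sum>\<^sub>\<infinity>k\<in>- {0}. norm (kvec k) powr (2 * s) * (cmod (f k))\<^sup>2)"

text \<open>
  Duality pairing of a smooth periodic function with a zero-mean distribution. It is conjugate
  linear in the first argument (only relevant for \<open>e_basis\<close>) and ignores the mean of \<open>g\<close>.
\<close>

definition pairing :: "(real ^ 'n \<Rightarrow> complex) \<Rightarrow> 'n::finite distr \<Rightarrow> complex" where
  "pairing g f = (\<Sum>\<^sub>\<infinity>k\<in>- {0}. cnj (fourier g k) * f k)"

definition fourier_vec :: "(real ^ 'n \<Rightarrow> real ^ 'n) \<Rightarrow> 'n \<Rightarrow> 'n::finite distr" where
  "fourier_vec v i = fourier (\<lambda>x. of_real (v x $ i))"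

definition Hnorm_vec :: "real \<Rightarrow> ('n \<Rightarrow> 'n::finite distr) \<Rightarrow> real" where
  "Hnorm_vec s F = sqrt (\<Sum>i\<in>UNIV. (Hnorm s (F i))\<^sup>2)"

definition pairing_vec :: "(real ^ 'n \<Rightarrow> real ^ 'n) \<Rightarrow> ('n \<Rightarrow> 'n::finite distr) \<Rightarrow> real" where
  "pairing_vec v F = Re (\<Sum>i\<in>UNIV. pairing (\<lambda>x. of_real (v x $ i)) (F i))"

section \<open>Paths with values in Sobolev spaces\<close>

definition Linf_path :: "real \<Rightarrow> (real \<Rightarrow> 'n::finite distr) \<Rightarrow> bool" where
  "Linf_path s f \<longleftrightarrow> (\<forall>k. (\<lambda>t. f t k) \<in> borel_measurable (lebesgue_on {0..1})) \<and>
     (\<exists>B. AE t in lebesgue_on {0..1}. f t \<in> Hsp s \<and> Hnorm s (f t) \<le> B)"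

definition L2_path :: "real \<Rightarrow> (real \<Rightarrow> 'n::finite distr) \<Rightarrow> bool" where
  "L2_path s f \<longleftrightarrow> (\<forall>k. (\<lambda>t. f t k) \<in> borel_measurable (lebesgue_on {0..1})) \<and>
     (AE t in lebesgue_on {0..1}. f t \<in> Hsp s) \<and>
     integrable (lebesgue_on {0..1}) (\<lambda>t. (Hnorm s (f t))\<^sup>2)"

text \<open>
  Norm of \<open>C\<^sup>\<theta>([0,1], H\<^sup>s)\<close>, with value \<open>\<infinity>\<close> outside this space. Here \<open>\<theta> = n + \<sigma>\<close> with
  \<open>\<sigma> \<in> (0,1]\<close>, and \<open>D\<close> ranges over the (unique, if it exists) sequence of \<open>n\<close> derivatives; the
  infimum over the empty set is \<open>\<infinity>\<close>. For \<open>\<theta> \<le> 1\<close> this is the sup norm plus the Hoelder seminorm.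
\<close>

definition holder_derivs :: "nat \<Rightarrow> real \<Rightarrow> (real \<Rightarrow> 'n::finite distr) \<Rightarrow> (nat \<Rightarrow> real \<Rightarrow> 'n distr) set" where
  "holder_derivs n s f = {D. (\<forall>t\<in>{0..1}. D 0 t = f t) \<and> (\<forall>i\<le>n. \<forall>t\<in>{0..1}. D i t \<in> Hsp s) \<and>
     (\<forall>i<n. \<forall>t\<in>{0..1}.
        ((\<lambda>r. Hnorm s (\<lambda>k. (D i r k - D i t k) / of_real (r - t) - D (Suc i) t k)) \<longlongrightarrow> 0)
          (at t within {0..1}))}"

definition holder_norm :: "real \<Rightarrow> real \<Rightarrow> (real \<Rightarrow> 'n::finite distr) \<Rightarrow> ennreal" where
  "holder_norm \<theta> s f = (let n = nat (\<lceil>\<theta>\<rceil> - 1) in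
     INF D \<in> holder_derivs n s f.
       (\<Sum>i\<le>n. SUP t\<in>{0..1}. ennreal (Hnorm s (D i t))) +
       (SUP (r, t) \<in> {(r, t). 0 \<le> r \<and> r < t \<and> t \<le> 1}.
          ennreal (Hnorm s (\<lambda>k. D n t k - D n r k) / (t - r) powr (\<theta> - real n))))"

section \<open>Noise\<close>

definition usual_conditions :: "'w measure \<Rightarrow> (real \<Rightarrow> 'w measure) \<Rightarrow> bool" where
  "usual_conditions M F \<longleftrightarrow> prob_space M \<and> complete_measure M \<and>
     (\<forall>t\<ge>0. subalgebra M (F t)) \<and>
     (\<forall>s t. 0 \<le> s \<and> s \<le> t \<longrightarrow> sets (F s) \<subseteq> sets (F t)) \<and>
     null_sets M \<subseteq> sets (F 0) \<and>
     (\<forall>t\<ge>0. sets (F t) = (\<Inter>s\<in>{t<..}. sets (F s)))"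

definition brownian_motion :: "'w measure \<Rightarrow> (real \<Rightarrow> 'w measure) \<Rightarrow> (real \<Rightarrow> 'w \<Rightarrow> real) \<Rightarrow> bool" where
  "brownian_motion M F W \<longleftrightarrow>
     (\<forall>t\<ge>0. W t \<in> borel_measurable (F t)) \<and>
     (AE \<omega> in M. W 0 \<omega> = 0) \<and>
     (AE \<omega> in M. continuous_on {0..} (\<lambda>t. W t \<omega>)) \<and>
     (\<forall>s t. 0 \<le> s \<and> s < t \<longrightarrow>
        distributed M lborel (\<lambda>\<omega>. W t \<omega> - W s \<omega>) (\<lambda>x. ennreal (normal_density 0 (sqrt (t - s)) x)) \<and>
        prob_space.indep_set M (sets (F s))
          (sets (vimage_algebra (space M) (\<lambda>\<omega>. W t \<omega> - W s \<omega>) borel)))"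

definition iid_brownian_motions ::
    "'w measure \<Rightarrow> (real \<Rightarrow> 'w measure) \<Rightarrow> 'j set \<Rightarrow> ('j \<Rightarrow> real \<Rightarrow> 'w \<Rightarrow> real) \<Rightarrow> bool" where
  "iid_brownian_motions M F J W \<longleftrightarrow>
     (\<forall>j\<in>J. brownian_motion M F (W j)) \<and>
     prob_space.indep_vars M (\<lambda>_. PiM {0..} (\<lambda>_. borel)) (\<lambda>j \<omega>. \<lambda>t\<in>{0..}. W j t \<omega>) J"

definition two_sided :: "(real \<Rightarrow> 'a \<Rightarrow> real) \<Rightarrow> (real \<Rightarrow> 'b \<Rightarrow> real) \<Rightarrow> real \<Rightarrow> 'a \<times> 'b \<Rightarrow> real" where
  "two_sided Wm Wp t \<omega> = (if t \<ge> 0 then Wp t (snd \<omega>) else Wm (- t) (fst \<omega>))"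

text \<open>
  The product measure is completed, so that the augmentation of a filtration lives on the
  same probability space.
\<close>

definition noise_space :: "'a measure \<Rightarrow> 'b measure \<Rightarrow> ('a \<times> 'b) measure" where
  "noise_space Mm Mp = completion (Mm \<Otimes>\<^sub>M Mp)"

definition F_infinity :: "'w measure \<Rightarrow> (real \<Rightarrow> 'w measure) \<Rightarrow> 'w measure" where
  "F_infinity M F = sigma (space M) (\<Union>t\<in>{0..}. sets (F t))"

definition augmented_filtration ::
    "'a measure \<Rightarrow> (real \<Rightarrow> 'a measure) \<Rightarrow> 'b measure \<Rightarrow> (real \<Rightarrow> 'b measure) \<Rightarrow> real \<Rightarrow> ('a \<times> 'b) measure" where
  "augmented_filtration Mm Fm Mp Fp t =
     sigma (space (noise_space Mm Mp))
       (sets (F_infinity Mm Fm \<Otimes>\<^sub>M Fp t) \<union> null_sets (noise_space Mm Mp))"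

text \<open>
  \<open>I\<close> is the Wiener integral of the deterministic \<open>f \<in> L\<^sup>2(\<real>)\<close> against the two-sided process \<open>W\<close>:
  the \<open>L\<^sup>2(M)\<close>-limit of the integrals of step functions converging to \<open>f\<close> in \<open>L\<^sup>2(\<real>)\<close>. A triple
  \<open>(c, a, b)\<close> stands for the step \<open>c 1\<^bsub>(a,b]\<^esub>\<close>.
\<close>

definition step_fun :: "(real \<times> real \<times> real) list \<Rightarrow> real \<Rightarrow> real" where
  "step_fun ps s = (\<Sum>(c, a, b)\<leftarrow>ps. c * indicat_real {a<..b} s)"

definition step_integral :: "(real \<Rightarrow> 'w \<Rightarrow> real) \<Rightarrow> (real \<times> real \<times> real) list \<Rightarrow> 'w \<Rightarrow> real" where
  "step_integral W ps \<omega> = (\<Sum>(c, a, b)\<leftarrow>ps. c * (W b \<omega> - W a \<omega>))"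

definition wiener_integral ::
    "'w measure \<Rightarrow> (real \<Rightarrow> 'w \<Rightarrow> real) \<Rightarrow> (real \<Rightarrow> real) \<Rightarrow> ('w \<Rightarrow> real) \<Rightarrow> bool" where
  "wiener_integral M W f I \<longleftrightarrow> I \<in> borel_measurable M \<and>
     (\<forall>ps. (\<forall>n. \<forall>(c, a, b)\<in>set (ps n). a \<le> b) \<and>
           (\<lambda>n. \<integral>\<^sup>+ s. ennreal ((step_fun (ps n) s - f s)\<^sup>2) \<partial>lborel) \<longlonglongrightarrow> 0 \<longrightarrow>
           (\<lambda>n. \<integral>\<^sup>+ \<omega>. ennreal ((step_integral W (ps n) \<omega> - I \<omega>)\<^sup>2) \<partial>M) \<longlonglongrightarrow> 0)"

text \<open>
  \<open>\<eta>(t) = \<integral>\<^bsub>-\<infinity>\<^esub>\<^bsup>t\<^esup> \<alpha> exp(-\<alpha>(t-s)) dW\<^sub>s\<close> for \<open>t \<in> [0,1]\<close>, in its continuous version.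
\<close>

definition ou_process :: "'w measure \<Rightarrow> (real \<Rightarrow> 'w \<Rightarrow> real) \<Rightarrow> real \<Rightarrow> (real \<Rightarrow> 'w \<Rightarrow> real) \<Rightarrow> bool" where
  "ou_process M W \<alpha> \<eta> \<longleftrightarrow>
     (\<forall>t\<in>{0..1}. wiener_integral M W (\<lambda>s. indicat_real {..t} s * (\<alpha> * exp (- \<alpha> * (t - s)))) (\<eta> t)) \<and>
     (AE \<omega> in M. continuous_on {0..1} (\<lambda>t. \<eta> t \<omega>))"

definition velocity ::
    "'j set \<Rightarrow> ('j \<Rightarrow> real ^ 'n \<Rightarrow> real ^ 'n) \<Rightarrow> ('j \<Rightarrow> real \<Rightarrow> 'w \<Rightarrow> real) \<Rightarrow> real \<Rightarrow> 'w \<Rightarrow> real ^ 'n \<Rightarrow> real ^ 'n" where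
  "velocity J u \<eta> t \<omega> x = (\<Sum>j\<in>J. \<eta> j t \<omega> *\<^sub>R u j x)"

section \<open>Operators and parameters\<close>

definition L_smooth ::
    "'j set \<Rightarrow> ('j \<Rightarrow> real ^ 'n \<Rightarrow> real ^ 'n) \<Rightarrow> (real ^ 'n \<Rightarrow> 'b::real_normed_vector) \<Rightarrow> real ^ 'n \<Rightarrow> 'b" where
  "L_smooth J u f x = (1 / 2) *\<^sub>R (\<Sum>j\<in>J. adv (u j) (adv (u j) f) x)"

text \<open>
  Action on distributions, by duality, of an operator \<open>B\<close> on smooth functions that is symmetric
  in \<open>L\<^sup>2\<close>: the \<open>k\<close>-th coefficient of \<open>B f\<close> is \<open>\<langle>e\<^sub>k, B f\<rangle> = \<langle>B e\<^sub>k, f\<rangle>\<close>. Both \<open>laplacian\<close> and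
  \<open>L_smooth J u\<close> (for divergence-free \<open>u j\<close>) are symmetric.
\<close>

definition on_distr :: "((real ^ 'n \<Rightarrow> complex) \<Rightarrow> real ^ 'n \<Rightarrow> complex) \<Rightarrow> 'n::finite distr \<Rightarrow> 'n distr" where
  "on_distr B f k = pairing (B (e_basis k)) f"

definition L_op :: "'j set \<Rightarrow> ('j \<Rightarrow> real ^ 'n \<Rightarrow> real ^ 'n) \<Rightarrow> 'n::finite distr \<Rightarrow> 'n distr" where
  "L_op J u = on_distr (L_smooth J u)"

definition A_op :: "real \<Rightarrow> 'j set \<Rightarrow> ('j \<Rightarrow> real ^ 'n \<Rightarrow> real ^ 'n) \<Rightarrow> 'n::finite distr \<Rightarrow> 'n distr" where
  "A_op \<kappa> J u f = (\<lambda>k. of_real \<kappa> * on_distr laplacian f k + L_op J u f k)"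

definition op_norm :: "real \<Rightarrow> real \<Rightarrow> ('n::finite distr \<Rightarrow> 'n distr) \<Rightarrow> real" where
  "op_norm s r B = Sup {Hnorm r (B f) | f. f \<in> Hsp s \<and> Hnorm s f \<le> 1}"

definition eps_param :: "'j set \<Rightarrow> ('j \<Rightarrow> real ^ 'n \<Rightarrow> real ^ 'n) \<Rightarrow> real" where
  "eps_param J u = sqrt (Sup {(\<Sum>j\<in>J. (pairing_vec (u j) v)\<^sup>2) | v.
     (\<forall>i. v i \<in> Hsp 0) \<and> Hnorm_vec 0 v = 1})"

definition mu_param :: "real \<Rightarrow> 'j set \<Rightarrow> ('j \<Rightarrow> real ^ 'n \<Rightarrow> real ^ 'n) \<Rightarrow> real" where
  "mu_param \<gamma> J u = Max
     {real (card J) * (\<Sum>j\<in>J. Hnorm_vec (real CARD('n) / 2 - \<gamma>) (fourier_vec (u j))),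
      real (card J) * (\<Sum>j\<in>J. SUP x. norm (u j x)),
      sqrt (op_norm 2 0 (L_op J u))}"

definition eigenvalue :: "'n::finite distr set \<Rightarrow> ('n distr \<Rightarrow> 'n distr) \<Rightarrow> real \<Rightarrow> bool" where
  "eigenvalue Dom B \<nu> \<longleftrightarrow> (\<exists>f\<in>Dom. f \<noteq> (\<lambda>_. 0) \<and> B f = (\<lambda>k. of_real \<nu> * f k))"

definition principal_eigenvalue :: "'n::finite distr set \<Rightarrow> ('n distr \<Rightarrow> 'n distr) \<Rightarrow> real \<Rightarrow> bool" where
  "principal_eigenvalue Dom B lam \<longleftrightarrow> eigenvalue Dom B lam \<and> (\<forall>\<nu>. eigenvalue Dom B \<nu> \<longrightarrow> lam \<le> \<nu>)"

text \<open>
  \<open>S\<close> is the strongly continuous semigroup on \<open>L\<^sup>2\<close> whose infinitesimal generator is \<open>B\<close> with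
  domain \<open>Dom\<close>. It is determined by \<open>B\<close> and \<open>Dom\<close>; for the elliptic operator
  \<open>A_op \<kappa> J u\<close> with domain \<open>H\<^sup>2\<close> it is the analytic semigroup generated by that operator.
\<close>

definition semigroup_generated_by ::
    "'n::finite distr set \<Rightarrow> ('n distr \<Rightarrow> 'n distr) \<Rightarrow> (real \<Rightarrow> 'n distr \<Rightarrow> 'n distr) \<Rightarrow> bool" where
  "semigroup_generated_by Dom B S \<longleftrightarrow>
     (\<forall>t\<ge>0. \<forall>f\<in>Hsp 0. S t f \<in> Hsp 0) \<and>
     (\<forall>t\<ge>0. \<forall>f\<in>Hsp 0. \<forall>g\<in>Hsp 0. \<forall>a b :: real.
        S t (\<lambda>k. of_real a * f k + of_real b * g k) = (\<lambda>k. of_real a * S t f k + of_real b * S t g k)) \<and>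
     (\<forall>t\<ge>0. \<exists>M. \<forall>f\<in>Hsp 0. Hnorm 0 (S t f) \<le> M * Hnorm 0 f) \<and>
     (\<forall>f\<in>Hsp 0. S 0 f = f) \<and>
     (\<forall>s\<ge>0. \<forall>t\<ge>0. \<forall>f\<in>Hsp 0. S (s + t) f = S s (S t f)) \<and>
     (\<forall>f\<in>Hsp 0. ((\<lambda>t. Hnorm 0 (\<lambda>k. S t f k - f k)) \<longlongrightarrow> 0) (at_right 0)) \<and>
     (\<forall>f\<in>Hsp 0. \<forall>g\<in>Hsp 0.
        ((\<lambda>t. Hnorm 0 (\<lambda>k. (S t f k - f k) / of_real t - g k)) \<longlongrightarrow> 0) (at_right 0) \<longleftrightarrow>
        f \<in> Dom \<and> g = B f)"

section \<open>Solutions\<close>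

text \<open>
  Adaptedness as an \<open>L\<^sup>2\<close>-valued process is measurability of all Fourier coefficients, \<open>L\<^sup>2\<close>
  being separable.
\<close>

definition solution ::
    "'w measure \<Rightarrow> (real \<Rightarrow> 'w measure) \<Rightarrow> real \<Rightarrow> (real \<Rightarrow> 'w \<Rightarrow> real ^ 'n \<Rightarrow> real ^ 'n) \<Rightarrow> 'n::finite distr \<Rightarrow>
     (real \<Rightarrow> 'w \<Rightarrow> 'n distr) \<Rightarrow> bool" where
  "solution M F \<kappa> v T0 T \<longleftrightarrow>
     (\<forall>t\<in>{0..1}. \<forall>\<omega>\<in>space M. T t \<omega> \<in> Hsp 0) \<and>
     (\<forall>t\<in>{0..1}. \<forall>k. (\<lambda>\<omega>. T t \<omega> k) \<in> borel_measurable (F t)) \<and>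
     (AE \<omega> in M.
        Linf_path 0 (\<lambda>t. T t \<omega>) \<and> L2_path 1 (\<lambda>t. T t \<omega>) \<and> T 0 \<omega> = T0 \<and>
        (\<forall>\<phi>\<in>test_functions. \<forall>s\<in>{0..1}. \<forall>t\<in>{0..1}. s < t \<longrightarrow>
           pairing (\<lambda>x. of_real (\<phi> x)) (T t \<omega>) = pairing (\<lambda>x. of_real (\<phi> x)) (T s \<omega>)
             + (LINT r|lebesgue_on {s..t}. pairing (\<lambda>x. of_real (adv (v r \<omega>) \<phi> x)) (T r \<omega>))
             + of_real \<kappa> * (LINT r|lebesgue_on {s..t}. pairing (\<lambda>x. of_real (laplacian \<phi> x)) (T r \<omega>))))"

definition sufficiently_large :: "real \<Rightarrow> real \<Rightarrow> real \<Rightarrow> real \<Rightarrow> bool" where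
  "sufficiently_large p1 p2 \<mu> \<alpha> \<longleftrightarrow> \<alpha> > 1 \<and> \<mu> * \<alpha> powr (- p1) * ln (1 + \<alpha>) powr p2 < 1"

definition decay_denom :: "real \<Rightarrow> real \<Rightarrow> real \<Rightarrow> real \<Rightarrow> real" where
  "decay_denom \<kappa> lam c t =
     (1 + \<kappa> / (2 * lam * c\<^sup>2) * ln ((c\<^sup>2 * exp (2 * lam * t) + 1) / (c\<^sup>2 + 1))) powr (1 / 2)"

end

theory Submission
  imports Defs
begin

text \<open>
  The solution satisfies the energy equality $\frac{d}{dt}\|T\|_{L^2}^2 = -2\kappa\|T\|_{H^1}^2$, and
  interpolation gives $\|T\|_{H^1} \ge \|T\|_{L^2}^2 / \|T\|_{H^{-1}}$. By Markov's inequality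
  $\|T_t - \bar T_t\|_{H^{-1}} < c\|T_0\|_{L^2}$ for all $t$ outside an event of probability at most $c$, while
  $\|\bar T_t\|_{H^{-1}} \le e^{-\lambda t}\|T_0\|_{L^2}$. Hence $f = \|T\|_{L^2}^2$ satisfies
  $(1/f)' \ge \kappa\|T_0\|_{L^2}^{-2} / (c^2 + e^{-2\lambda t})$, which integrates to the claim.

  The energy equality is obtained from Fourier truncations $P_N T$ without commutator estimates: incompressibility
  cancels $\langle u \cdot \nabla P_N T, P_N T\rangle$, and what remains is at most a constant times
  $\|T\|_{L^2} \|T - P_N T\|_{H^1}$. The decay of the semigroup follows from a minimizer of the Rayleigh quotient
  on $H^2$ (Rellich), which is a weak eigenvector of $A$ and, the semigroup being symmetric, a true one.
\<close>

section \<open>Symmetric semigroups on a Hilbert space\<close>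

text \<open>Distributions are given by Fourier coefficients, so operators are treated as infinite
  matrices: bounds, signs and symmetries are checked on finite sections over \<open>modes N\<close>
  and passed to the limit. Constants: c^2 is exactly the factor in the assumed estimate, so Markov's
  inequality at level c ||T0|| leaves probability c. Squaring the bound (c + e^(-lambda t)) ||T0||
  costs a factor 2 through (x + y)^2 <= 2 x^2 + 2 y^2; it cancels the 2 of the energy equality, and
  integrating kappa / (c^2 + e^(-2 lambda t)) produces the prefactor kappa / (2 lambda c^2). Three
  obstacles shape the rest. The principal eigenvalue is defined as the least eigenvalue, so it must
  be compared with the infimum of the quadratic form before it can control the semigroup. The
  solution is a bounded weak one tested against real functions, so its Fourier coefficients must
  first be shown to be differentiable in time. The Hoelder norm is not known to be measurable in
  \<omega> and time is uncountable, so the probabilistic part uses rational times and extends by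
  continuity of single coefficients.\<close>

lemma has_vector_derivative_iff_quotient:
  "(g has_vector_derivative D) (at t within X) \<longleftrightarrow> ((\<lambda>s. (g s - g t) /\<^sub>R (s - t)) \<longlongrightarrow> D) (at t within X)"
proof -
  have "\<forall>\<^sub>F s in at t within X. norm (g s - g t - (s - t) *\<^sub>R D) / norm (s - t)
      = norm ((g s - g t) /\<^sub>R (s - t) - D)"
    unfolding eventually_at
  proof (intro exI[of _ 1] conjI ballI impI)
    fix s :: real assume "s \<noteq> t \<and> dist s t < 1"
    then have "(g s - g t) /\<^sub>R (s - t) - D = (g s - g t - (s - t) *\<^sub>R D) /\<^sub>R (s - t)"
      by (simp add: scaleR_diff_right)
    then show "norm (g s - g t - (s - t) *\<^sub>R D) / norm (s - t) = norm ((g s - g t) /\<^sub>R (s - t) - D)"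
      by (simp add: divide_inverse mult.commute)
  qed simp
  then show ?thesis
    unfolding has_vector_derivative_def has_derivative_iff_norm
    by (simp add: bounded_linear_scaleR_left tendsto_cong tendsto_norm_zero_iff LIM_zero_iff)
qed

text \<open>The last assumption is an equivalence, so \<open>D\<close> is the whole set of vectors
  at which the difference quotient converges. Reading it from left to right is how vectors are shown
  to lie in the domain.\<close>

locale generated_semigroup =
  fixes S :: "real \<Rightarrow> 'a::{real_inner,banach} \<Rightarrow> 'a" and D :: "'a set" and A :: "'a \<Rightarrow> 'a"
  assumes bl: "t \<ge> 0 \<Longrightarrow> bounded_linear (S t)"
    and S_0: "S 0 f = f"
    and S_add: "s \<ge> 0 \<Longrightarrow> t \<ge> 0 \<Longrightarrow> S (s + t) f = S s (S t f)"
    and S_lim: "((\<lambda>t. S t f) \<longlongrightarrow> f) (at_right 0)"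
    and gen: "((\<lambda>t. (S t f - f) /\<^sub>R t) \<longlongrightarrow> g) (at_right 0) \<longleftrightarrow> f \<in> D \<and> g = A f"
begin

lemma generator_lim: "f \<in> D \<Longrightarrow> ((\<lambda>t. (S t f - f) /\<^sub>R t) \<longlongrightarrow> A f) (at_right 0)"
  using gen by blast

text \<open>Uniform boundedness near \<open>0\<close> by the Baire category theorem.\<close>

lemma locally_bounded: "\<exists>d>0. \<exists>M. \<forall>t\<in>{0..d}. \<forall>f. norm (S t f) \<le> M * norm f"
proof -
  \<comment> \<open>One index serves both as the bound and as the inverse length of the time window,
    so strong continuity at 0 puts every vector into some \<open>E m\<close> and the union is
    countable.\<close>
  define E where "E m = {x. \<forall>t\<in>{0..1 / real (Suc m)}. norm (S t x) \<le> real m}" for m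
  have "closed (E m)" for m
  proof -
    have "E m = (\<Inter>t\<in>{0..1 / real (Suc m)}. {x. norm (S t x) \<le> real m})"
      by (auto simp: E_def)
    moreover have "closed {x. norm (S t x) \<le> real m}" if "t \<in> {0..1 / real (Suc m)}" for t
      using that bl by (intro closed_Collect_le continuous_intros)
        (auto intro!: continuous_intros linear_continuous_on simp: bounded_linear.linear)
    ultimately show ?thesis by auto
  qed
  moreover have "(\<Union>m. E m) = UNIV"
  proof -
    have "\<exists>m. x \<in> E m" for x
    proof -
      have "\<forall>\<^sub>F t in at_right 0. norm (S t x) < norm x + 1"
        using tendsto_norm[OF S_lim[of x]] by (intro order_tendstoD(2)) auto
      then obtain b where b: "b > 0" "\<And>t. 0 < t \<Longrightarrow> t < b \<Longrightarrow> norm (S t x) < norm x + 1"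
        unfolding eventually_at_right_field by auto
      obtain m1 where m1: "1 / real (Suc m1) < b" using b(1) nat_approx_posE by metis
      obtain m2 where m2: "norm x + 1 < real m2" using reals_Archimedean2 by blast
      define m where "m = max m1 m2"
      have "1 / real (Suc m) \<le> 1 / real (Suc m1)" by (intro divide_left_mono) (auto simp: m_def)
      then have "norm (S t x) \<le> real m" if "t \<in> {0..1 / real (Suc m)}" for t
        using that b(2)[of t] m1 m2 S_0 by (cases "t = 0") (auto simp: m_def)
      then show ?thesis unfolding E_def by blast
    qed
    then show ?thesis by auto
  qed
  ultimately have "\<exists>m. interior (E m) \<noteq> {}"
    using Baire_category_alt[of "euclidean :: 'a topology" "range E"]
    by (auto simp: completely_metrizable_space_euclidean)
  then obtain m x where "x \<in> interior (E m)" by blast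
  then obtain r where r: "r > 0" "ball x r \<subseteq> E m" by (meson mem_interior)
  have "norm (S t f) \<le> 4 * real m / r * norm f" if t: "t \<in> {0..1 / real (Suc m)}" for t f
  proof (cases "f = 0")
    case True
    then show ?thesis using bl t by (simp add: linear_0 bounded_linear.linear)
  next
    case False
    interpret bounded_linear "S t" using bl t by simp
    \<comment> \<open>\<open>y\<close> is \<open>f\<close> rescaled to norm \<open>r / 2\<close>, so
      \<open>x + y\<close> stays in the ball. Under \<open>S t\<close> both \<open>x\<close> and
      \<open>x + y\<close> are bounded by \<open>m\<close>, hence \<open>y\<close> by
      \<open>2 * m\<close>; undoing the scaling gives \<open>4 * m / r\<close>.\<close>
    define y where "y = (r / (2 * norm f)) *\<^sub>R f"
    have "norm y = r / 2" using False r by (simp add: y_def)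
    then have "x + y \<in> E m" "x \<in> E m" using r by (auto simp: dist_norm intro!: subsetD[OF r(2)])
    then have "norm (S t (x + y)) \<le> m" "norm (S t x) \<le> m" using t by (auto simp: E_def)
    moreover have "S t y = S t (x + y) - S t x" by (simp add: add)
    ultimately have "norm (S t y) \<le> 2 * real m" using norm_triangle_ineq4[of "S t (x + y)" "S t x"] by simp
    moreover have "norm (S t y) = r / (2 * norm f) * norm (S t f)" using r False by (simp add: y_def scaleR)
    ultimately show ?thesis using r False by (simp add: field_simps)
  qed
  then show ?thesis by (intro exI[of _ "1 / real (Suc m)"] conjI exI[of _ "4 * real m / r"] ballI allI) auto
qed

text \<open>The local bound is iterated over \<open>Suc n\<close> equal steps, each short enough for
  it to apply. Replacing \<open>M\<close> by \<open>max M 1\<close> keeps the factor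
  nonnegative.\<close>

lemma bounded_on_interval: "\<exists>K\<ge>0. \<forall>t\<in>{0..b}. \<forall>f. norm (S t f) \<le> K * norm f"
proof -
  obtain d M where dM: "d > 0" "\<And>t f. t \<in> {0..d} \<Longrightarrow> norm (S t f) \<le> M * norm f"
    using locally_bounded by blast
  define M' where "M' = max M 1"
  have M': "norm (S t f) \<le> M' * norm f" if "t \<in> {0..d}" for t f
    using dM(2)[OF that, of f] mult_right_mono[of M M' "norm f"] by (simp add: M'_def)
  obtain n where n: "b / d < real n" using reals_Archimedean2 by blast
  have "norm (S (real k * t) f) \<le> M' ^ k * norm f" if "t \<in> {0..d}" for t f k
  proof (induction k)
    case (Suc k)
    have "S (real (Suc k) * t) f = S t (S (real k * t) f)"
      using that by (subst S_add[symmetric]) (auto simp: algebra_simps)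
    then have "norm (S (real (Suc k) * t) f) \<le> M' * norm (S (real k * t) f)" using M'[OF that] by simp
    also have "\<dots> \<le> M' * (M' ^ k * norm f)" using Suc by (intro mult_left_mono) (auto simp: M'_def)
    finally show ?case by (simp add: mult.assoc)
  qed (simp add: S_0)
  moreover have "t / real (Suc n) \<in> {0..d}" if "t \<in> {0..b}" for t
  proof -
    have "t \<le> b" "0 \<le> t" using that by auto
    moreover have "b \<le> real (Suc n) * d" using n dM(1) by (simp add: field_simps)
    ultimately show ?thesis using dM(1) by (simp add: field_simps)
  qed
  ultimately have "norm (S t f) \<le> M' ^ Suc n * norm f" if "t \<in> {0..b}" for t f
    using that by (metis nonzero_eq_divide_eq mult.commute of_nat_Suc of_nat_neq_0)
  then show ?thesis by (intro exI[of _ "M' ^ Suc n"]) (auto simp: M'_def)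
qed

text \<open>Factoring out the semigroup at the earlier time reduces two-sided continuity at
  \<open>t\<close> to right continuity at 0.\<close>

lemma shift_norm_le:
  assumes K: "\<And>t f. t \<in> {0..b} \<Longrightarrow> norm (S t f) \<le> K * norm f" and "s \<in> {0..b}" "t \<in> {0..b}"
  shows "norm (S s f - S t f) \<le> K * norm (S \<bar>s - t\<bar> f - f)"
proof -
  have *: "norm (S s f - S t f) \<le> K * norm (S \<bar>s - t\<bar> f - f)"
    if "s \<in> {0..b}" "t \<in> {0..b}" "s \<le> t" for s t
  proof -
    interpret bounded_linear "S s" using bl that by simp
    have "S t f - S s f = S s (S (t - s) f - f)" using S_add[of s "t - s" f] that by (simp add: diff)
    then show ?thesis using K that by (metis abs_minus_commute abs_of_nonneg diff_ge_0_iff_ge norm_minus_commute)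
  qed
  show ?thesis using *[of s t] *[of t s] assms(2,3)
    by (metis abs_minus_commute linear norm_minus_commute)
qed

lemma abs_diff_tendsto: "((\<lambda>s. \<bar>s - t\<bar>) \<longlongrightarrow> 0) (at (t::real) within X)"
  by (auto intro!: tendsto_eq_intros)

lemma filterlim_abs_diff: "filterlim (\<lambda>s. \<bar>s - t\<bar>) (at_right 0) (at (t::real) within X)"
  unfolding filterlim_at using abs_diff_tendsto by (auto simp: eventually_at intro!: exI[of _ 1])


lemma orbit_lim: "t \<ge> 0 \<Longrightarrow> ((\<lambda>s. S s f) \<longlongrightarrow> S t f) (at t within {0..})"
proof -
  assume t: "t \<ge> 0"
  obtain K where K: "\<And>s f. s \<in> {0..t + 1} \<Longrightarrow> norm (S s f) \<le> K * norm f"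
    using bounded_on_interval[of "t + 1"] by blast
  have "((\<lambda>s. K * norm (S \<bar>s - t\<bar> f - f)) \<longlongrightarrow> 0) (at t within {0..})"
    by (intro tendsto_mult_right_zero tendsto_norm_zero LIM_zero filterlim_compose[OF S_lim filterlim_abs_diff])
  moreover have "\<forall>\<^sub>F s in at t within {0..}. norm (S s f - S t f) \<le> K * norm (S \<bar>s - t\<bar> f - f)"
    unfolding eventually_at
  proof (intro exI[of _ 1] conjI ballI impI)
    fix s assume "s \<in> {0..}" "s \<noteq> t \<and> dist s t < 1"
    then show "norm (S s f - S t f) \<le> K * norm (S \<bar>s - t\<bar> f - f)"
      using t by (intro shift_norm_le[OF K]) (auto simp: dist_real_def)
  qed simp
  ultimately have "((\<lambda>s. S s f - S t f) \<longlongrightarrow> 0) (at t within {0..})"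
    by (rule Lim_null_comparison[rotated])
  then show "((\<lambda>s. S s f) \<longlongrightarrow> S t f) (at t within {0..})" by (rule LIM_zero_cancel)
qed

lemma orbit_continuous: "continuous_on {0..} (\<lambda>t. S t f)"
  using orbit_lim by (auto simp: continuous_on_def)

section \<open>Generator and derivatives of orbits\<close>

lemma S_commute_generator:
  assumes "f \<in> D" "t \<ge> 0"
  shows "S t f \<in> D" "A (S t f) = S t (A f)"
proof -
  interpret bounded_linear "S t" using bl assms by simp
  have "((\<lambda>h. S t ((S h f - f) /\<^sub>R h)) \<longlongrightarrow> S t (A f)) (at_right 0)"
    using generator_lim[OF assms(1)] by (intro tendsto)
  moreover have "\<forall>\<^sub>F h in at_right 0. S t ((S h f - f) /\<^sub>R h) = (S h (S t f) - S t f) /\<^sub>R h"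
    using eventually_at_right_less[of 0]
  proof eventually_elim
    case (elim h)
    then have "S t (S h f) = S h (S t f)" using S_add[of t h f] S_add[of h t f] assms(2)
      by (simp add: add.commute)
    then show ?case by (simp add: scaleR diff)
  qed
  ultimately have "((\<lambda>h. (S h (S t f) - S t f) /\<^sub>R h) \<longlongrightarrow> S t (A f)) (at_right 0)"
    by (rule Lim_transform_eventually)
  then show "S t f \<in> D" "A (S t f) = S t (A f)" using gen by auto
qed

lemma orbit_derivative:
  assumes f: "f \<in> D" and t: "t \<ge> 0"
  shows "((\<lambda>s. S s f) has_vector_derivative S t (A f)) (at t within {0..})"
proof -
  obtain K where K: "\<And>s f. s \<in> {0..t + 1} \<Longrightarrow> norm (S s f) \<le> K * norm f"
    using bounded_on_interval[of "t + 1"] by blast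
  let ?d = "\<lambda>h. (S h f - f) /\<^sub>R h"
  have "((\<lambda>s. K * norm (?d \<bar>s - t\<bar> - A f) + norm (S (min s t) (A f) - S t (A f))) \<longlongrightarrow>
      0 + 0) (at t within {0..})"
  proof (intro tendsto_add tendsto_mult_right_zero tendsto_norm_zero LIM_zero)
    show "((\<lambda>s. ?d \<bar>s - t\<bar>) \<longlongrightarrow> A f) (at t within {0..})"
      by (rule filterlim_compose[OF generator_lim[OF f] filterlim_abs_diff])
    have "continuous_on {0..} (\<lambda>s. S (min s t) (A f))"
      using t by (intro continuous_on_compose2[OF orbit_continuous]) (auto intro!: continuous_intros)
    then have "((\<lambda>s. S (min s t) (A f)) \<longlongrightarrow> S (min t t) (A f)) (at t within {0..})"
      using t unfolding continuous_on_def by blast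
    then show "((\<lambda>s. S (min s t) (A f)) \<longlongrightarrow> S t (A f)) (at t within {0..})"
      by (simp only: min.idem)
  qed
  moreover have "\<forall>\<^sub>F s in at t within {0..}. norm ((S s f - S t f) /\<^sub>R (s - t) - S t (A f))
      \<le> K * norm (?d \<bar>s - t\<bar> - A f) + norm (S (min s t) (A f) - S t (A f))"
    unfolding eventually_at
  proof (intro exI[of _ 1] conjI ballI impI)
    fix s assume s: "s \<in> {0..}" "s \<noteq> t \<and> dist s t < 1"
    \<comment> \<open>With \<open>m\<close> the earlier time and \<open>h\<close> the distance, the
      quotient on either side of \<open>t\<close> is \<open>S m\<close> applied to the right
      difference quotient of \<open>f\<close> with step \<open>h\<close>. Left and right derivatives
      are thus treated at once.\<close>
    define m h where "m = min s t" and "h = \<bar>s - t\<bar>"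
    have mh: "0 \<le> m" "m \<le> t + 1" "0 < h" using s t by (auto simp: m_def h_def dist_real_def)
    interpret bounded_linear "S m" using bl mh by simp
    have "(S s f - S t f) /\<^sub>R (s - t) = (S (m + h) f - S m f) /\<^sub>R h"
    proof (cases "s < t")
      case True
      then have "inverse (s - t) = - inverse h" by (simp add: h_def flip: inverse_minus_eq)
      then show ?thesis using True by (simp add: m_def h_def scaleR_diff_right)
    qed (auto simp: m_def h_def)
    also have "\<dots> = S m (?d h)"
      using mh by (simp add: S_add diff scaleR)
    finally have "(S s f - S t f) /\<^sub>R (s - t) - S t (A f) = S m (?d h - A f) + (S m (A f) - S t (A f))"
      by (simp add: diff)
    also have "norm \<dots> \<le> K * norm (?d h - A f) + norm (S m (A f) - S t (A f))"
      using K[of m "?d h - A f"] mh by (intro norm_triangle_le add_mono) auto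
    finally show "norm ((S s f - S t f) /\<^sub>R (s - t) - S t (A f))
      \<le> K * norm (?d \<bar>s - t\<bar> - A f) + norm (S (min s t) (A f) - S t (A f))"
      by (simp add: m_def h_def)
  qed simp
  ultimately have "((\<lambda>s. (S s f - S t f) /\<^sub>R (s - t) - S t (A f)) \<longlongrightarrow> 0) (at t within {0..})"
    unfolding add_0 by (rule Lim_null_comparison[rotated])
  then show ?thesis unfolding has_vector_derivative_iff_quotient by (rule LIM_zero_cancel)
qed

lemma orbit_derivative_at:
  assumes "f \<in> D" "t > 0"
  shows "((\<lambda>s. S s f) has_vector_derivative S t (A f)) (at t)"
proof -
  have "at t within {0..} = at t" using assms by (intro at_within_interior) (auto simp: interior_real_atLeast)
  then show ?thesis using orbit_derivative[of f t] assms by simp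
qed

section \<open>Decay, symmetry and weak eigenvectors\<close>

lemma decay_on_domain:
  assumes diss: "\<And>g. g \<in> D \<Longrightarrow> A g \<bullet> g \<le> - lam * (norm g)\<^sup>2" and f: "f \<in> D" and t: "t \<ge> 0"
  shows "norm (S t f) \<le> exp (- lam * t) * norm f"
proof -
  \<comment> \<open>An exponentially weighted energy: dissipativity applied to \<open>S t f\<close>,
    which remains in \<open>D\<close>, makes its derivative nonpositive.\<close>
  define \<phi> where "\<phi> t = exp (2 * lam * t) * (S t f \<bullet> S t f)" for t
  have "\<phi> t \<le> \<phi> 0"
  proof (rule DERIV_nonpos_imp_decreasing_open[OF t])
    show "continuous_on {0..t} \<phi>"
      unfolding \<phi>_def
      by (intro continuous_intros continuous_on_subset[OF orbit_continuous]) auto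
    fix s assume s: "0 < s" "s < t"
    have "(\<phi> has_vector_derivative exp (2 * lam * s) * (S s f \<bullet> S s (A f) + S s (A f) \<bullet> S s f)
        + (exp (2 * lam * s) * (2 * lam)) * (S s f \<bullet> S s f)) (at s)"
      unfolding \<phi>_def
      by (intro has_vector_derivative_mult bounded_bilinear.has_vector_derivative[OF bounded_bilinear_inner]
            orbit_derivative_at f s)
         (auto intro!: derivative_eq_intros simp: has_real_derivative_iff_has_vector_derivative[symmetric])
    moreover have "A (S s f) \<bullet> S s f \<le> - lam * (norm (S s f))\<^sup>2"
      using S_commute_generator(1)[OF f] s by (intro diss) auto
    then have "S s (A f) \<bullet> S s f + lam * (S s f \<bullet> S s f) \<le> 0"
      using S_commute_generator(2)[OF f] s by (simp add: power2_norm_eq_inner)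
    then have "exp (2 * lam * s) * (2 * (S s (A f) \<bullet> S s f + lam * (S s f \<bullet> S s f))) \<le> 0"
      by (intro mult_nonneg_nonpos) auto
    then have "exp (2 * lam * s) * (S s f \<bullet> S s (A f) + S s (A f) \<bullet> S s f)
        + (exp (2 * lam * s) * (2 * lam)) * (S s f \<bullet> S s f) \<le> 0"
      by (simp add: algebra_simps inner_commute)
    ultimately show "\<exists>y. DERIV \<phi> s :> y \<and> y \<le> 0"
      by (auto simp: has_real_derivative_iff_has_vector_derivative)
  qed
  then have "(norm (S t f))\<^sup>2 \<le> (exp (- lam * t) * norm f)\<^sup>2"
  proof -
    assume *: "\<phi> t \<le> \<phi> 0"
    have "(norm (S t f))\<^sup>2 = exp (- (2 * lam * t)) * \<phi> t"
      by (simp add: \<phi>_def power2_norm_eq_inner flip: exp_add mult.assoc)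
    also have "\<dots> \<le> exp (- (2 * lam * t)) * \<phi> 0" using * by (intro mult_left_mono) auto
    also have "\<dots> = (exp (- lam * t) * norm f)\<^sup>2"
      by (simp add: \<phi>_def S_0 power2_norm_eq_inner power_mult_distrib flip: exp_double)
    finally show ?thesis .
  qed
  then show ?thesis by (auto intro: power2_le_imp_le)
qed

lemma decay:
  assumes diss: "\<And>g. g \<in> D \<Longrightarrow> A g \<bullet> g \<le> - lam * (norm g)\<^sup>2" and dense: "closure D = UNIV" and t: "t \<ge> 0"
  shows "norm (S t f) \<le> exp (- lam * t) * norm f"
proof -
  have "closed {f. norm (S t f) \<le> exp (- lam * t) * norm f}"
    using bl[OF t] by (intro closed_Collect_le continuous_intros linear_continuous_on)
  then have "closure D \<subseteq> {f. norm (S t f) \<le> exp (- lam * t) * norm f}"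
    using decay_on_domain[OF diss _ t] by (intro closure_minimal) auto
  then show ?thesis using dense by auto
qed

text \<open>For \<open>f\<close> and \<open>g\<close> in the domain,
  \<open>S s f \<bullet> S (t - s) g\<close> has zero derivative in \<open>s\<close> because
  \<open>A\<close> is symmetric, and its values at the two ends are the two sides. Density removes
  the domain condition from one argument at a time.\<close>

lemma S_symmetric:
  assumes sym: "\<And>f g. f \<in> D \<Longrightarrow> g \<in> D \<Longrightarrow> A f \<bullet> g = f \<bullet> A g" and dense: "closure D = UNIV" and t: "t \<ge> 0"
  shows "S t f \<bullet> g = f \<bullet> S t g"
proof -
  have *: "S t f \<bullet> g = f \<bullet> S t g" if fg: "f \<in> D" "g \<in> D" for f g
  proof (cases "t = 0")
    case False
    define \<psi> where "\<psi> s = S s f \<bullet> S (t - s) g" for s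
    have "\<psi> t = \<psi> 0"
    proof (rule DERIV_isconst_end[of 0 t \<psi>])
      show "0 < t" using False t by simp
      show "continuous_on {0..t} \<psi>"
        unfolding \<psi>_def
        by (intro continuous_intros continuous_on_subset[OF orbit_continuous]
            continuous_on_compose2[OF orbit_continuous, of "{0..t}" "\<lambda>s. t - s"]) auto
      fix s assume s: "0 < s" "s < t"
      have "((\<lambda>s. S (t - s) g) has_vector_derivative (-1) *\<^sub>R S (t - s) (A g)) (at s)"
      proof (rule vector_diff_chain_at[of "\<lambda>s. t - s" "-1" s "\<lambda>s. S s g", unfolded o_def])
        show "((\<lambda>s. t - s) has_vector_derivative - 1) (at s)"
          by (auto intro!: derivative_eq_intros simp: has_real_derivative_iff_has_vector_derivative[symmetric])
        show "((\<lambda>s. S s g) has_vector_derivative S (t - s) (A g)) (at (t - s))"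
          using s by (intro orbit_derivative_at fg) auto
      qed
      then have "(\<psi> has_vector_derivative S s f \<bullet> ((-1) *\<^sub>R S (t - s) (A g)) + S s (A f) \<bullet> S (t - s) g) (at s)"
        unfolding \<psi>_def
        by (intro bounded_bilinear.has_vector_derivative[OF bounded_bilinear_inner] orbit_derivative_at fg s)
      moreover have "S s f \<bullet> S (t - s) (A g) = S s (A f) \<bullet> S (t - s) g"
        using sym[of "S s f" "S (t - s) g"] S_commute_generator[OF fg(1), of s]
          S_commute_generator[OF fg(2), of "t - s"] s by simp
      ultimately show "DERIV \<psi> s :> 0"
        by (simp add: has_real_derivative_iff_has_vector_derivative)
    qed
    then show ?thesis by (simp add: \<psi>_def S_0)
  qed (simp add: S_0)
  have **: "S t f \<bullet> g = f \<bullet> S t g" if g: "g \<in> D" for f g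
  proof -
    have "closed {f. S t f \<bullet> g = f \<bullet> S t g}"
      using bl[OF t] by (intro closed_Collect_eq continuous_intros linear_continuous_on)
    then have "closure D \<subseteq> {f. S t f \<bullet> g = f \<bullet> S t g}" by (intro closure_minimal) (auto simp: * g)
    then show ?thesis using dense by auto
  qed
  have "closed {g. S t f \<bullet> g = f \<bullet> S t g}"
    using bl[OF t] by (intro closed_Collect_eq continuous_intros linear_continuous_on)
  then have "closure D \<subseteq> {g. S t f \<bullet> g = f \<bullet> S t g}" by (intro closure_minimal) (auto simp: **)
  then show ?thesis using dense by auto
qed

text \<open>An eigenvector of the adjoint is moved by the semigroup along itself, hence lies in the domain:
  this replaces elliptic regularity.\<close>

lemma weak_eigenvector_in_domain:
  assumes sym: "\<And>f g. f \<in> D \<Longrightarrow> g \<in> D \<Longrightarrow> A f \<bullet> g = f \<bullet> A g" and dense: "closure D = UNIV"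
    and weak: "\<And>g. g \<in> D \<Longrightarrow> f \<bullet> A g = \<nu> * (f \<bullet> g)"
  shows "f \<in> D \<and> A f = \<nu> *\<^sub>R f"
proof -
  \<comment> \<open>The weak equation, applied along the orbit \<open>S s g\<close> inside the
    domain, makes \<open>exp (- \<nu> * s) * (f \<bullet> S s g)\<close> constant.\<close>
  have *: "f \<bullet> S t g = exp (\<nu> * t) * (f \<bullet> g)" if g: "g \<in> D" and t: "t \<ge> 0" for g t
  proof (cases "t = 0")
    case False
    define \<psi> where "\<psi> s = exp (- \<nu> * s) * (f \<bullet> S s g)" for s
    have "\<psi> t = \<psi> 0"
    proof (rule DERIV_isconst_end[of 0 t \<psi>])
      show "0 < t" using False t by simp
      show "continuous_on {0..t} \<psi>"
        unfolding \<psi>_def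
        by (intro continuous_intros continuous_on_subset[OF orbit_continuous]) auto
      fix s assume s: "0 < s" "s < t"
      have "((\<lambda>s. f \<bullet> S s g) has_vector_derivative f \<bullet> S s (A g)) (at s)"
        by (intro bounded_linear.has_vector_derivative[OF bounded_linear_inner_right] orbit_derivative_at g s)
      then have "(\<psi> has_vector_derivative exp (- \<nu> * s) * (f \<bullet> S s (A g))
          + (exp (- \<nu> * s) * (- \<nu>)) * (f \<bullet> S s g)) (at s)"
        unfolding \<psi>_def by (intro has_vector_derivative_mult)
         (auto intro!: derivative_eq_intros simp: has_real_derivative_iff_has_vector_derivative[symmetric])
      moreover have "f \<bullet> S s (A g) = \<nu> * (f \<bullet> S s g)"
        using weak[of "S s g"] S_commute_generator[OF g, of s] s by simp
      ultimately show "DERIV \<psi> s :> 0"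
        by (simp add: has_real_derivative_iff_has_vector_derivative algebra_simps)
    qed
    then show ?thesis by (simp add: \<psi>_def S_0 exp_minus field_simps)
  qed (simp add: S_0)
  \<comment> \<open>Moving \<open>S t\<close> to the other side by symmetry shows that the
    difference of the two vectors is orthogonal to the dense set \<open>D\<close>.\<close>
  have **: "S t f = exp (\<nu> * t) *\<^sub>R f" if t: "t \<ge> 0" for t
  proof -
    define v where "v = S t f - exp (\<nu> * t) *\<^sub>R f"
    have "closed {g. v \<bullet> g = 0}" by (intro closed_Collect_eq continuous_intros)
    moreover have "v \<bullet> g = 0" if "g \<in> D" for g
      using *[OF that t] S_symmetric[OF sym dense t, of f g] by (simp add: v_def inner_diff_left)
    ultimately have "closure D \<subseteq> {g. v \<bullet> g = 0}" by (intro closure_minimal) auto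
    then have "v \<bullet> v = 0" using dense by blast
    then show ?thesis by (simp add: v_def)
  qed
  have "((\<lambda>t. exp (\<nu> * t)) has_real_derivative \<nu>) (at 0)"
    by (auto intro!: derivative_eq_intros)
  then have "((\<lambda>t. (exp (\<nu> * t) - 1) / t) \<longlongrightarrow> \<nu>) (at_right 0)"
    by (simp add: has_field_derivative_iff filterlim_at_split)
  then have "((\<lambda>t. ((exp (\<nu> * t) - 1) / t) *\<^sub>R f) \<longlongrightarrow> \<nu> *\<^sub>R f) (at_right 0)"
    by (intro tendsto_intros)
  moreover have "\<forall>\<^sub>F t in at_right 0. ((exp (\<nu> * t) - 1) / t) *\<^sub>R f = (S t f - f) /\<^sub>R t"
    using eventually_at_right_less[of 0]
    by eventually_elim (simp add: ** divide_inverse algebra_simps)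
  ultimately have "((\<lambda>t. (S t f - f) /\<^sub>R t) \<longlongrightarrow> \<nu> *\<^sub>R f) (at_right 0)"
    by (rule Lim_transform_eventually)
  then show ?thesis using gen by auto
qed

end

section \<open>Square-summable sequences\<close>

lemma summable_on_mult_of_squares:
  fixes f g :: "'k \<Rightarrow> complex"
  assumes "(\<lambda>k. (cmod (f k))\<^sup>2) summable_on A" "(\<lambda>k. (cmod (g k))\<^sup>2) summable_on A"
  shows "(\<lambda>k. cmod (cnj (f k) * g k)) summable_on A"
proof (rule summable_on_comparison_test)
  show "(\<lambda>k. (cmod (f k))\<^sup>2 + (cmod (g k))\<^sup>2) summable_on A" using assms by (rule summable_on_add)
  show "cmod (cnj (f k) * g k) \<le> (cmod (f k))\<^sup>2 + (cmod (g k))\<^sup>2" for k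
  proof -
    have "2 * (cmod (f k) * cmod (g k)) \<le> (cmod (f k))\<^sup>2 + (cmod (g k))\<^sup>2"
      using sum_squares_bound[of "cmod (f k)" "cmod (g k)"] by simp
    moreover have "0 \<le> cmod (f k) * cmod (g k)" by simp
    ultimately have "cmod (f k) * cmod (g k) \<le> (cmod (f k))\<^sup>2 + (cmod (g k))\<^sup>2" by linarith
    then show ?thesis by (simp add: norm_mult)
  qed
qed simp

lemma cnj_mult_summable:
  fixes f g :: "'k \<Rightarrow> complex"
  assumes "(\<lambda>k. (cmod (f k))\<^sup>2) summable_on A" "(\<lambda>k. (cmod (g k))\<^sup>2) summable_on A"
  shows "(\<lambda>k. cnj (f k) * g k) summable_on A"
  using summable_on_mult_of_squares[OF assms] by (rule abs_summable_summable)

lemma infsum_square_bounded: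
  fixes a :: "'k \<Rightarrow> real"
  assumes "\<And>F. finite F \<Longrightarrow> F \<subseteq> A \<Longrightarrow> (\<Sum>k\<in>F. a k) \<le> B" "\<And>k. k \<in> A \<Longrightarrow> 0 \<le> a k"
  shows "a summable_on A" "infsum a A \<le> B"
proof -
  show s: "a summable_on A"
    using assms by (intro nonneg_bounded_partial_sums_imp_summable_on[of _ _ B])
      (auto intro: eventually_finite_subsets_at_top_weakI)
  show "infsum a A \<le> B" using assms by (intro infsum_le_finite_sums s) auto
qed

lemma Cauchy_Schwarz_infsum:
  fixes f g :: "'k \<Rightarrow> complex"
  assumes f: "(\<lambda>k. (cmod (f k))\<^sup>2) summable_on A" and g: "(\<lambda>k. (cmod (g k))\<^sup>2) summable_on A"
  shows "cmod (\<Sum>\<^sub>\<infinity>k\<in>A. cnj (f k) * g k)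
    \<le> sqrt (\<Sum>\<^sub>\<infinity>k\<in>A. (cmod (f k))\<^sup>2) * sqrt (\<Sum>\<^sub>\<infinity>k\<in>A. (cmod (g k))\<^sup>2)"
proof -
  have "cmod (\<Sum>\<^sub>\<infinity>k\<in>A. cnj (f k) * g k) \<le> (\<Sum>\<^sub>\<infinity>k\<in>A. cmod (cnj (f k) * g k))"
    using summable_on_mult_of_squares[OF f g] by (rule norm_infsum_bound)
  also have "\<dots> \<le> sqrt (\<Sum>\<^sub>\<infinity>k\<in>A. (cmod (f k))\<^sup>2) * sqrt (\<Sum>\<^sub>\<infinity>k\<in>A. (cmod (g k))\<^sup>2)"
  proof (rule infsum_le_finite_sums[OF summable_on_mult_of_squares[OF f g]])
    fix F assume F: "finite F" "F \<subseteq> A"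
    have "(\<Sum>k\<in>F. cmod (cnj (f k) * g k)) \<le> L2_set (\<lambda>k. cmod (f k)) F * L2_set (\<lambda>k. cmod (g k)) F"
      using L2_set_mult_ineq[of "\<lambda>k. cmod (f k)" "\<lambda>k. cmod (g k)" F] by (simp add: norm_mult)
    also have "\<dots> \<le> sqrt (\<Sum>\<^sub>\<infinity>k\<in>A. (cmod (f k))\<^sup>2) * sqrt (\<Sum>\<^sub>\<infinity>k\<in>A. (cmod (g k))\<^sup>2)"
      unfolding L2_set_def
      by (intro mult_mono real_sqrt_le_mono finite_sum_le_infsum f g F) (auto intro!: infsum_nonneg sum_nonneg)
    finally show "(\<Sum>k\<in>F. cmod (cnj (f k) * g k)) \<le> \<dots>" .
  qed
  finally show ?thesis .
qed

lemma infsum_bounded_linear':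
  assumes "bounded_linear h" "f summable_on A"
  shows "infsum (\<lambda>x. h (f x)) A = h (infsum f A)"
  using has_sum_bounded_linear[OF assms(1) has_sum_infsum[OF assms(2)]] by (simp add: infsumI)

section \<open>Fourier modes and Sobolev spaces\<close>

text \<open>The zero mode is left out because distributions have zero mean. The box is invariant
  under negation, so cutting off modes preserves real-valuedness.\<close>

definition modes :: "nat \<Rightarrow> (int ^ 'n) set" where
  "modes N = {k. k \<noteq> 0 \<and> (\<forall>i. \<bar>k $ i\<bar> \<le> int N)}"

lemma finite_modes [simp]: "finite (modes N :: (int ^ 'n::finite) set)"
proof -
  have "k \<in> (\<lambda>f. \<chi> i. f i) ` (PiE UNIV (\<lambda>_. {- int N..int N}))" if "k \<in> modes N" for k :: "int ^ 'n"
    using that by (intro image_eqI[of _ _ "\<lambda>i. k $ i"]) (auto simp: modes_def abs_le_iff minus_le_iff)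
  then show ?thesis
    by (meson finite_PiE finite_atLeastAtMost_int finite_code finite_imageI finite_subset subsetI)
qed

lemma modes_subset: "modes N \<subseteq> - {0}" and zero_notin_modes [simp]: "0 \<notin> modes N"
  by (auto simp: modes_def)

lemma minus_mem_modes [simp]: "- k \<in> modes N \<longleftrightarrow> k \<in> modes N"
  by (auto simp: modes_def)

lemma modes_exhaust:
  assumes "finite F" "F \<subseteq> - {0 :: int ^ 'n::finite}"
  shows "\<forall>\<^sub>F N in sequentially. F \<subseteq> modes N"
proof -
  define N0 where "N0 = Max (insert 0 ((\<lambda>(k, i). nat \<bar>k $ i\<bar>) ` (F \<times> UNIV)))"
  have "F \<subseteq> modes N" if "N \<ge> N0" for N
  proof
    fix k assume k: "k \<in> F"
    have "nat \<bar>k $ i\<bar> \<le> N0" for i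
      unfolding N0_def using k assms(1) by (intro Max_ge) (auto intro!: image_eqI[of _ _ "(k, i)"])
    then show "k \<in> modes N" using k assms that by (fastforce simp: modes_def nat_le_iff intro: order_trans)
  qed
  then show ?thesis by (auto simp: eventually_sequentially)
qed

text \<open>This turns unordered infinite sums into limits of sequences, to which dominated
  convergence and \<open>LIMSEQ\<close> arguments apply.\<close>

lemma filterlim_modes: "filterlim modes (finite_subsets_at_top (- {0 :: int ^ 'n::finite})) sequentially"
  unfolding filterlim_finite_subsets_at_top using modes_subset
  by (auto intro: eventually_mono[OF eventually_conj[OF modes_exhaust]] modes_exhaust
      simp: eventually_conj_iff)

lemma sum_modes_tendsto:
  fixes f :: "int ^ 'n::finite \<Rightarrow> 'b::{comm_monoid_add,t2_space}"
  assumes "f summable_on - {0}"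
  shows "(\<lambda>N. \<Sum>k\<in>modes N. f k) \<longlonglongrightarrow> (\<Sum>\<^sub>\<infinity>k\<in>- {0}. f k)"
  using filterlim_compose[OF infsum_tendsto[OF assms] filterlim_modes] .

lemma summable_on_modesI:
  fixes a :: "int ^ 'n::finite \<Rightarrow> real"
  assumes "\<And>N. (\<Sum>k\<in>modes N. a k) \<le> B" "\<And>k. 0 \<le> a k"
  shows "a summable_on - {0}" "infsum a (- {0}) \<le> B"
proof -
  have "(\<Sum>k\<in>F. a k) \<le> B" if F: "finite F" "F \<subseteq> - {0}" for F
  proof -
    obtain N where "F \<subseteq> modes N" using modes_exhaust[OF F] by (auto simp: eventually_sequentially)
    then have "(\<Sum>k\<in>F. a k) \<le> (\<Sum>k\<in>modes N. a k)" using assms by (intro sum_mono2) auto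
    then show ?thesis using assms(1)[of N] by simp
  qed
  then show "a summable_on - {0}" "infsum a (- {0}) \<le> B"
    using infsum_square_bounded[of "- {0}" a B] assms(2) by auto
qed

lemma kvec_nth [simp]: "kvec k $ i = of_int (k $ i)" by (simp add: kvec_def)
lemma kvec_0 [simp]: "kvec 0 = 0" by (simp add: vec_eq_iff)
lemma kvec_minus [simp]: "kvec (- k) = - kvec k" by (simp add: vec_eq_iff)
lemma kvec_diff: "kvec (k - l) = kvec k - kvec l" by (simp add: vec_eq_iff)
lemma abs_nth_le_norm_kvec: "\<bar>of_int (k $ i)\<bar> \<le> norm (kvec (k :: int ^ 'n::finite))"
  using component_le_norm_cart[of "kvec k" i] by simp

lemma norm_kvec_ge_1:
  assumes "k \<noteq> (0 :: int ^ 'n::finite)" shows "1 \<le> norm (kvec k)"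
proof -
  obtain i where "k $ i \<noteq> 0" using assms by (auto simp: vec_eq_iff)
  then have "(1::real) \<le> \<bar>of_int (k $ i)\<bar>" by linarith
  then show ?thesis using abs_nth_le_norm_kvec[of k i] by linarith
qed

lemma norm_kvec_notin_modes:
  assumes "k \<noteq> (0 :: int ^ 'n::finite)" "k \<notin> modes N" shows "real N \<le> norm (kvec k)"
proof -
  obtain i where "\<not> \<bar>k $ i\<bar> \<le> int N" using assms by (auto simp: modes_def)
  then have "real N \<le> \<bar>of_int (k $ i)\<bar>" by linarith
  then show ?thesis using abs_nth_le_norm_kvec[of k i] by linarith
qed

section \<open>Sobolev weights and norms\<close>

abbreviation sob_term :: "real \<Rightarrow> (int ^ 'n::finite \<Rightarrow> complex) \<Rightarrow> int ^ 'n \<Rightarrow> real" where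
  "sob_term s f k \<equiv> norm (kvec k) powr (2 * s) * (cmod (f k))\<^sup>2"

text \<open>Since \<open>0 powr 0\<close> is 0, the weight of order 0 equals 1 only away from the
  origin.\<close>

lemma weight_0: "k \<noteq> (0 :: int ^ 'n::finite) \<Longrightarrow> norm (kvec k) powr 0 = 1"
  using norm_kvec_ge_1[of k] by (cases "kvec k = 0") auto

lemma kvec_eq_0_iff [simp]: "kvec k = 0 \<longleftrightarrow> k = (0 :: int ^ 'n::finite)"
  by (cases "k = 0") (use norm_kvec_ge_1[of k] in auto)

lemma Hsp_0_weight: "(\<lambda>k. sob_term 0 f k) summable_on - {0 :: int ^ 'n::finite}
    \<longleftrightarrow> (\<lambda>k. (cmod (f k))\<^sup>2) summable_on - {0}"
  by (intro summable_on_cong) (simp add: weight_0)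

lemma Hnorm_0: "Hnorm 0 f = sqrt (\<Sum>\<^sub>\<infinity>k\<in>- {0}. (cmod (f k))\<^sup>2)"
  unfolding Hnorm_def by (intro arg_cong[of _ _ sqrt] infsum_cong) (simp add: weight_0)

lemma Hnorm_nonneg [simp]: "0 \<le> Hnorm s f"
  unfolding Hnorm_def by (intro real_sqrt_ge_zero infsum_nonneg) auto

lemma Hnorm_squared: "(Hnorm s f)\<^sup>2 = (\<Sum>\<^sub>\<infinity>k\<in>- {0}. sob_term s f k)"
  unfolding Hnorm_def by (intro real_sqrt_pow2 infsum_nonneg) auto

lemma Hsp_0I:
  assumes "f 0 = 0" "\<And>k. f (- k) = cnj (f k)" "(\<lambda>k. (cmod (f k))\<^sup>2) summable_on - {0}"
  shows "f \<in> Hsp 0"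
proof -
  have "cmod (f k) \<le> sqrt (\<Sum>\<^sub>\<infinity>k\<in>- {0}. (cmod (f k))\<^sup>2)" for k
  proof (cases "k = 0")
    case False
    then have "(\<Sum>k\<in>{k}. (cmod (f k))\<^sup>2) \<le> (\<Sum>\<^sub>\<infinity>k\<in>- {0}. (cmod (f k))\<^sup>2)"
      by (intro finite_sum_le_infsum assms) auto
    then show ?thesis by (simp add: real_le_rsqrt)
  qed (auto simp: assms(1) intro!: infsum_nonneg)
  then have "\<forall>k. cmod (f k) \<le> sqrt (\<Sum>\<^sub>\<infinity>k\<in>- {0}. (cmod (f k))\<^sup>2) * (1 + norm (kvec k)) ^ 0" by simp
  then show ?thesis using assms unfolding Hsp_def distribution_def
    by (intro CollectI conjI) (blast, blast, blast, simp add: Hsp_0_weight[simplified])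
qed

lemma Hsp_0D:
  assumes "f \<in> Hsp 0"
  shows "f 0 = 0" "f (- k) = cnj (f k)" "(\<lambda>k. (cmod (f k))\<^sup>2) summable_on - {0}"
  using assms Hsp_0_weight[of f] by (auto simp: Hsp_def distribution_def)

lemma Hsp_summable: "f \<in> Hsp s \<Longrightarrow> (\<lambda>k. sob_term s f k) summable_on - {0}"
  by (simp add: Hsp_def)

lemma weight_mono: "s \<le> r \<Longrightarrow> k \<noteq> (0 :: int ^ 'n::finite) \<Longrightarrow>
    norm (kvec k) powr (2 * s) * (cmod z)\<^sup>2 \<le> norm (kvec k) powr (2 * r) * (cmod z)\<^sup>2"
  using norm_kvec_ge_1[of k] by (intro mult_right_mono powr_mono) auto

lemma Hsp_mono: "s \<le> r \<Longrightarrow> f \<in> Hsp r \<Longrightarrow> f \<in> Hsp s"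
  unfolding Hsp_def by (auto intro!: summable_on_comparison_test[where g = "\<lambda>k. sob_term s f k"] weight_mono)

lemma Hnorm_mono: "s \<le> r \<Longrightarrow> f \<in> Hsp r \<Longrightarrow> Hnorm s f \<le> Hnorm r f"
  using Hsp_mono[of s r f] unfolding Hnorm_def
  by (intro real_sqrt_le_mono infsum_mono) (auto simp: Hsp_def intro: weight_mono)

lemma Hnorm_modes_tendsto:
  assumes "f \<in> Hsp s"
  shows "(\<lambda>N. sqrt (\<Sum>k\<in>modes N. sob_term s f k)) \<longlonglongrightarrow> Hnorm s f"
  unfolding Hnorm_def by (intro tendsto_real_sqrt sum_modes_tendsto Hsp_summable assms)

lemma Hnorm_modes_le:
  assumes "f \<in> Hsp s"
  shows "sqrt (\<Sum>k\<in>modes N. sob_term s f k) \<le> Hnorm s f"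
  unfolding Hnorm_def by (intro real_sqrt_le_mono finite_sum_le_infsum Hsp_summable assms modes_subset) auto

text \<open>A form of lower semicontinuity: a bound on the norm amounts to countably many closed
  conditions, each on finitely many coefficients. It lets bounds at almost every time, or at
  rational times, pass to all times.\<close>

lemma Hnorm_le_iff:
  assumes "f \<in> Hsp s"
  shows "Hnorm s f \<le> b \<longleftrightarrow> (\<forall>N. sqrt (\<Sum>k\<in>modes N. sob_term s f k) \<le> b)"
  using Hnorm_modes_tendsto[OF assms] Hnorm_modes_le[OF assms]
  by (auto intro: LIMSEQ_le_const2 order_trans)

text \<open>Cauchy-Schwarz for the weighted coefficients \<open>?w 1\<close> and
  \<open>?w (- 1)\<close>, whose weights multiply to 1 away from the origin.\<close>

lemma Hnorm_interpolation:
  fixes f :: "'n::finite distr"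
  assumes "f \<in> Hsp 1"
  shows "(Hnorm 0 f)\<^sup>2 \<le> Hnorm 1 f * Hnorm (- 1) f"
proof -
  let ?w = "\<lambda>s k. of_real (norm (kvec k) powr s) * f k"
  have *: "(cmod (?w s k))\<^sup>2 = sob_term s f k" if "k \<noteq> 0" for s k
    using that by (simp add: norm_mult power_mult_distrib power2_eq_square flip: powr_add)
  have s1: "(\<lambda>k. (cmod (?w s k))\<^sup>2) summable_on - {0}" if "s \<le> 1" for s
    using Hsp_summable[OF Hsp_mono[OF that assms]] by (rule summable_on_cong[THEN iffD2, rotated]) (simp add: *)
  have n1: "sqrt (\<Sum>\<^sub>\<infinity>k\<in>- {0}. (cmod (?w s k))\<^sup>2) = Hnorm s f" for s
    unfolding Hnorm_def by (intro arg_cong[of _ _ sqrt] infsum_cong) (simp add: *)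
  have "(Hnorm 0 f)\<^sup>2 = cmod (of_real ((Hnorm 0 f)\<^sup>2))" by (simp add: norm_power)
  also have "complex_of_real ((Hnorm 0 f)\<^sup>2) = (\<Sum>\<^sub>\<infinity>k\<in>- {0}. of_real ((cmod (f k))\<^sup>2))"
    using infsum_bounded_linear'[OF bounded_linear_of_real Hsp_0D(3)[OF Hsp_mono[OF _ assms]], symmetric]
    by (simp add: Hnorm_0 infsum_nonneg)
  also have "\<dots> = (\<Sum>\<^sub>\<infinity>k\<in>- {0}. cnj (?w 1 k) * ?w (- 1) k)"
  proof (rule infsum_cong)
    fix k :: "int ^ 'n" assume "k \<in> - {0}"
    then have "norm (kvec k) powr 1 * norm (kvec k) powr - 1 = 1"
      using norm_kvec_ge_1[of k] by (subst powr_add[symmetric]) (auto simp: weight_0)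
    then have w: "norm (kvec k) powr 1 * norm (kvec k) powr - 1 = 1" .
    have "cnj (?w 1 k) * ?w (- 1) k = of_real (norm (kvec k) powr 1 * norm (kvec k) powr - 1) * (f k * cnj (f k))"
      by (simp only: complex_cnj_mult complex_cnj_complex_of_real of_real_mult mult_ac)
    then show "of_real ((cmod (f k))\<^sup>2) = cnj (?w 1 k) * ?w (- 1) k"
      unfolding w by (simp only: complex_norm_square of_real_1 mult_1)
  qed
  also have "cmod \<dots> \<le> Hnorm 1 f * Hnorm (- 1) f"
    unfolding n1[symmetric] by (intro Cauchy_Schwarz_infsum s1) auto
  finally show ?thesis .
qed

section \<open>The Hilbert space of real zero-mean square-integrable distributions\<close>

lemma Hsp_0_zero: "(\<lambda>_. 0) \<in> Hsp 0"
  by (intro Hsp_0I) auto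

lemma Hsp_0_add:
  assumes f: "f \<in> Hsp 0" and g: "g \<in> Hsp 0"
  shows "(\<lambda>k. f k + g k) \<in> Hsp 0"
proof (intro Hsp_0I)
  show "(\<lambda>k. (cmod (f k + g k))\<^sup>2) summable_on - {0}"
  proof (rule summable_on_comparison_test)
    show "(\<lambda>k. 2 * (cmod (f k))\<^sup>2 + 2 * (cmod (g k))\<^sup>2) summable_on - {0}"
      by (intro summable_on_add summable_on_cmult_right Hsp_0D(3) f g)
    fix k
    have "(cmod (f k + g k))\<^sup>2 \<le> (cmod (f k) + cmod (g k))\<^sup>2" by (intro power_mono norm_triangle_ineq) auto
    also have "\<dots> \<le> 2 * (cmod (f k))\<^sup>2 + 2 * (cmod (g k))\<^sup>2"
      using sum_squares_bound[of "cmod (f k)" "cmod (g k)"] by (simp add: power2_sum)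
    finally show "(cmod (f k + g k))\<^sup>2 \<le> \<dots>" .
  qed simp
qed (use f g in \<open>auto simp: Hsp_0D\<close>)

lemma Hsp_0_scale: "f \<in> Hsp 0 \<Longrightarrow> (\<lambda>k. of_real a * f k) \<in> Hsp 0"
  by (intro Hsp_0I) (auto simp: Hsp_0D norm_mult power_mult_distrib intro!: summable_on_cmult_right)

text \<open>A type of its own makes the classes of Hilbert spaces available, so that the abstract
  semigroup results apply. The scalars are real because the conjugation symmetry survives only real
  multiples.\<close>

typedef (overloaded) 'n L2 = "Hsp 0 :: 'n::finite distr set"
  morphisms coef L2_of using Hsp_0_zero by blast

lemmas coef_0 = Hsp_0D(1)[OF coef] and coef_minus = Hsp_0D(2)[OF coef] and coef_summable = Hsp_0D(3)[OF coef]

instantiation L2 :: (finite) real_vector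
begin

definition "0 = L2_of (\<lambda>_. 0)"
definition "x + y = L2_of (\<lambda>k. coef x k + coef y k)"
definition "a *\<^sub>R x = L2_of (\<lambda>k. of_real a * coef x k)"
definition "- x = L2_of (\<lambda>k. - coef x k)"
definition "x - y = L2_of (\<lambda>k. coef x k - coef y k)"

lemma coef_zero [simp]: "coef 0 k = 0"
  by (simp add: zero_L2_def L2_of_inverse Hsp_0_zero)
lemma coef_add [simp]: "coef (x + y) k = coef x k + coef y k"
  by (simp add: plus_L2_def L2_of_inverse Hsp_0_add coef)
lemma coef_scaleR [simp]: "coef (a *\<^sub>R x) k = of_real a * coef x k"
  by (simp add: scaleR_L2_def L2_of_inverse Hsp_0_scale coef)
lemma coef_uminus [simp]: "coef (- x) k = - coef x k"
  using Hsp_0_scale[OF coef, of "- 1" x] by (simp add: uminus_L2_def L2_of_inverse)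
lemma coef_diff [simp]: "coef (x - y) k = coef x k - coef y k"
  using Hsp_0_add[OF coef Hsp_0_scale[OF coef, of "- 1" y], of x] by (simp add: minus_L2_def L2_of_inverse)

lemma L2_eqI: "(\<And>k. coef x k = coef y k) \<Longrightarrow> x = y"
  by (metis coef_inject ext)

instance
  by standard (auto intro!: L2_eqI simp: algebra_simps)

end

instantiation L2 :: (finite) real_inner
begin

text \<open>The sum is already real, since replacing \<open>k\<close> by \<open>- k\<close>
  conjugates each term; \<open>Re\<close> only makes it a real number by type.\<close>

definition "inner x y = Re (\<Sum>\<^sub>\<infinity>k\<in>- {0}. cnj (coef x k) * coef y k)"
definition "norm x = sqrt (inner x (x :: 'a L2))"
definition "dist x y = norm (x - y :: 'a L2)"
definition "sgn x = x /\<^sub>R norm (x :: 'a L2)"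
definition "(uniformity :: ('a L2 \<times> 'a L2) filter) = (INF e\<in>{0<..}. principal {(x, y). dist x y < e})"
definition "open (U :: 'a L2 set) \<longleftrightarrow> (\<forall>x\<in>U. eventually (\<lambda>(x', y). x' = x \<longrightarrow> y \<in> U) uniformity)"

lemma inner_L2_self: "inner x x = (\<Sum>\<^sub>\<infinity>k\<in>- {0}. (cmod (coef x k))\<^sup>2)"
  unfolding inner_L2_def infsum_bounded_linear'[OF bounded_linear_Re
      cnj_mult_summable[OF coef_summable coef_summable, of x x], symmetric]
  by (intro infsum_cong) (simp only: cmod_power2, simp add: power2_eq_square)

instance
proof
  fix x y z :: "'a L2" and a :: real
  show "dist x y = norm (x - y)" "sgn x = x /\<^sub>R norm x" "norm x = sqrt (inner x x)"
    "(uniformity :: ('a L2 \<times> 'a L2) filter) = (INF e\<in>{0<..}. principal {(x, y). dist x y < e})"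
    by (simp_all add: dist_L2_def sgn_L2_def norm_L2_def uniformity_L2_def)
  show "open U \<longleftrightarrow> (\<forall>x\<in>U. eventually (\<lambda>(x', y). x' = x \<longrightarrow> y \<in> U) uniformity)" for U :: "'a L2 set"
    by (simp add: open_L2_def)
  have re: "inner x y = (\<Sum>\<^sub>\<infinity>k\<in>- {0}. Re (cnj (coef x k) * coef y k))"
    and re_s: "(\<lambda>k. Re (cnj (coef x k) * coef y k)) summable_on - {0}" for x y :: "'a L2"
    using infsum_bounded_linear'[OF bounded_linear_Re cnj_mult_summable[OF coef_summable coef_summable, of x y]]
      summable_on_bounded_linear[OF bounded_linear_Re cnj_mult_summable[OF coef_summable coef_summable, of x y]]
    by (simp_all add: inner_L2_def o_def)
  show "inner x y = inner y x" unfolding re by (intro infsum_cong) (simp add: algebra_simps)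
  have "inner (x + y) z = (\<Sum>\<^sub>\<infinity>k\<in>- {0}. Re (cnj (coef x k) * coef z k) + Re (cnj (coef y k) * coef z k))"
    unfolding re by (intro infsum_cong) (simp add: algebra_simps)
  then show "inner (x + y) z = inner x z + inner y z" using re_s by (simp add: re infsum_add)
  have "inner (a *\<^sub>R x) y = (\<Sum>\<^sub>\<infinity>k\<in>- {0}. a * Re (cnj (coef x k) * coef y k))"
    unfolding re by (intro infsum_cong) (simp add: algebra_simps)
  then show "inner (a *\<^sub>R x) y = a * inner x y" by (simp add: re infsum_cmult_right')
  show "0 \<le> inner x x" unfolding inner_L2_self by (intro infsum_nonneg) auto
  show "inner x x = 0 \<longleftrightarrow> x = 0"
  proof
    assume *: "inner x x = 0"
    have "(cmod (coef x k))\<^sup>2 = 0" if "k \<in> - {0}" for k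
      by (rule nonneg_infsum_le_0D[OF _ coef_summable _ that]) (use * in \<open>auto simp: inner_L2_self\<close>)
    then show "x = 0" by (intro L2_eqI) (metis ComplI coef_0 coef_zero norm_eq_zero power_eq_0_iff singletonD)
  next
    assume "x = 0"
    then show "inner x x = 0" by (simp add: inner_L2_self)
  qed
qed

end

lemma norm_L2_eq_Hnorm: "norm x = Hnorm 0 (coef x)"
  by (simp add: norm_L2_def inner_L2_self Hnorm_0)

lemma norm_L2_squared: "(norm x)\<^sup>2 = (\<Sum>\<^sub>\<infinity>k\<in>- {0}. (cmod (coef x k))\<^sup>2)"
  by (simp add: power2_norm_eq_inner inner_L2_self)

lemma Hnorm_L2_of: "f \<in> Hsp 0 \<Longrightarrow> norm (L2_of f) = Hnorm 0 f"
  by (simp add: norm_L2_eq_Hnorm L2_of_inverse)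

lemma sum_coef_le_norm:
  "finite F \<Longrightarrow> F \<subseteq> - {0} \<Longrightarrow> (\<Sum>k\<in>F. (cmod (coef x k))\<^sup>2) \<le> (norm x)\<^sup>2"
  unfolding norm_L2_squared by (intro finite_sum_le_infsum coef_summable) auto

lemma cmod_coef_le_norm: "cmod (coef x k) \<le> norm x"
proof (cases "k = 0")
  case False
  then have "(cmod (coef x k))\<^sup>2 \<le> (norm x)\<^sup>2" using sum_coef_le_norm[of "{k}" x] by simp
  then show ?thesis by (rule power2_le_imp_le) simp
qed (simp add: coef_0)

lemma norm_L2_le:
  assumes "\<And>N. (\<Sum>k\<in>modes N. (cmod (coef x k))\<^sup>2) \<le> B\<^sup>2" "0 \<le> B"
  shows "norm x \<le> B"
proof -
  have "(norm x)\<^sup>2 \<le> B\<^sup>2" unfolding norm_L2_squared using assms by (intro summable_on_modesI) auto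
  then show ?thesis using assms(2) by (rule power2_le_imp_le)
qed

lemma bounded_linear_coef: "bounded_linear (\<lambda>x. coef x k)"
  by (rule bounded_linear_intro[of _ 1]) (auto simp: scaleR_conv_of_real cmod_coef_le_norm)

text \<open>Each coefficient is a bounded functional, so coefficients converge. Bounds on finite
  sections survive the limit: once to place the limit in \<open>Hsp 0\<close>, once to estimate the
  distance to it.\<close>

instance L2 :: (finite) banach
proof
  fix X :: "nat \<Rightarrow> 'a L2" assume X: "Cauchy X"
  have "\<exists>l. (\<lambda>n. coef (X n) k) \<longlonglongrightarrow> l" for k
    using bounded_linear.Cauchy[OF bounded_linear_coef X] by (simp add: Cauchy_convergent_iff convergent_def)
  then obtain g where g: "\<And>k. (\<lambda>n. coef (X n) k) \<longlonglongrightarrow> g k" by metis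
  obtain B where B: "\<And>n. norm (X n) \<le> B" using Cauchy_Bseq[OF X] by (auto simp: Bseq_def)
  have gH: "g \<in> Hsp 0"
  proof (rule Hsp_0I)
    show "g 0 = 0" using g[of 0] by (simp add: coef_0 LIMSEQ_const_iff)
    show "g (- k) = cnj (g k)" for k
      using LIMSEQ_unique[OF g[of "- k"]] tendsto_cnj[OF g[of k]] by (simp add: coef_minus)
    have "(\<Sum>k\<in>modes N. (cmod (g k))\<^sup>2) \<le> B\<^sup>2" for N
    proof (rule LIMSEQ_le_const2)
      show "(\<lambda>n. \<Sum>k\<in>modes N. (cmod (coef (X n) k))\<^sup>2) \<longlonglongrightarrow> (\<Sum>k\<in>modes N. (cmod (g k))\<^sup>2)"
        by (intro tendsto_intros g)
      have "(\<Sum>k\<in>modes N. (cmod (coef (X n) k))\<^sup>2) \<le> B\<^sup>2" for n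
        using sum_coef_le_norm[OF finite_modes modes_subset, of "X n" N] power_mono[OF B[of n], of 2] by simp
      then show "\<exists>n0. \<forall>n\<ge>n0. (\<Sum>k\<in>modes N. (cmod (coef (X n) k))\<^sup>2) \<le> B\<^sup>2" by blast
    qed
    then show "(\<lambda>k. (cmod (g k))\<^sup>2) summable_on - {0}" by (intro summable_on_modesI) auto
  qed
  have "X \<longlonglongrightarrow> L2_of g"
  proof (rule metric_LIMSEQ_I)
    fix r :: real assume "r > 0"
    then obtain M where M: "\<And>m n. m \<ge> M \<Longrightarrow> n \<ge> M \<Longrightarrow> norm (X m - X n) < r / 2"
      using CauchyD[OF X, of "r / 2"] by auto
    have "norm (X n - L2_of g) \<le> r / 2" if n: "n \<ge> M" for n
    proof (rule norm_L2_le)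
      fix N
      show "(\<Sum>k\<in>modes N. (cmod (coef (X n - L2_of g) k))\<^sup>2) \<le> (r / 2)\<^sup>2"
      proof (rule LIMSEQ_le_const2)
        show "(\<lambda>m. \<Sum>k\<in>modes N. (cmod (coef (X n - X m) k))\<^sup>2)
            \<longlonglongrightarrow> (\<Sum>k\<in>modes N. (cmod (coef (X n - L2_of g) k))\<^sup>2)"
          unfolding coef_diff by (intro tendsto_intros) (simp add: L2_of_inverse gH g)
        have "(\<Sum>k\<in>modes N. (cmod (coef (X n - X m) k))\<^sup>2) \<le> (r / 2)\<^sup>2" if "m \<ge> M" for m
          using sum_coef_le_norm[OF finite_modes modes_subset, of "X n - X m" N]
            power_mono[OF less_imp_le[OF M[OF n that]], of 2] by simp
        then show "\<exists>n0. \<forall>m\<ge>n0. (\<Sum>k\<in>modes N. (cmod (coef (X n - X m) k))\<^sup>2) \<le> (r / 2)\<^sup>2" by blast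
      qed
    qed (use \<open>r > 0\<close> in simp)
    then show "\<exists>no. \<forall>n\<ge>no. dist (X n) (L2_of g) < r"
      using \<open>r > 0\<close> by (intro exI[of _ M]) (force simp: dist_norm)
  qed
  then show "convergent X" by (auto simp: convergent_def)
qed

section \<open>Integration over the period cell\<close>

definition cint :: "(real ^ 'n::finite \<Rightarrow> complex) \<Rightarrow> complex" where
  "cint f = (LINT x:cube|lborel. f x)"

lemma compact_cube [simp]: "compact (cube :: (real ^ 'n::finite) set)"
  by (simp add: cube_def)

lemma sets_cube [measurable, simp]: "cube \<in> sets borel"
  by (simp add: cube_def)

lemma mem_cube: "x \<in> cube \<longleftrightarrow> (\<forall>i. 0 \<le> x $ i \<and> x $ i \<le> 2 * pi)"
  by (simp add: cube_def mem_box_cart)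

lemma cube_integrable:
  fixes f :: "real ^ 'n::finite \<Rightarrow> 'b::{banach, second_countable_topology}"
  assumes "continuous_on UNIV f" shows "set_integrable lborel cube f"
  unfolding set_integrable_def
  by (rule borel_integrable_compact) (auto intro: continuous_on_subset[OF assms])

lemma cint_add: "continuous_on UNIV f \<Longrightarrow> continuous_on UNIV g \<Longrightarrow> cint (\<lambda>x. f x + g x) = cint f + cint g"
  unfolding cint_def by (intro set_integral_add cube_integrable)

lemma cint_cmult: "cint (\<lambda>x. c * f x) = c * cint f"
  unfolding cint_def by simp

lemma cint_zero [simp]: "cint (\<lambda>x. 0) = 0"
  using cint_cmult[of 0 "\<lambda>_. 0"] by simp

lemma cint_minus: "cint (\<lambda>x. - f x) = - cint f"
  using cint_cmult[of "- 1" f] by simp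

lemma cint_diff: "continuous_on UNIV f \<Longrightarrow> continuous_on UNIV g \<Longrightarrow> cint (\<lambda>x. f x - g x) = cint f - cint g"
  using cint_add[of f "\<lambda>x. - g x"] by (simp add: cint_minus continuous_on_minus)

lemma cint_sum: "(\<And>i. i \<in> I \<Longrightarrow> continuous_on UNIV (f i)) \<Longrightarrow> cint (\<lambda>x. \<Sum>i\<in>I. f i x) = (\<Sum>i\<in>I. cint (f i))"
  by (induction I rule: infinite_finite_induct) (auto simp: cint_add continuous_on_sum)

lemma cint_cnj: "continuous_on UNIV f \<Longrightarrow> cint (\<lambda>x. cnj (f x)) = cnj (cint f)"
  unfolding cint_def set_lebesgue_integral_def
  by (subst integral_bounded_linear[OF bounded_linear_cnj, symmetric])
    (use cube_integrable[of f] in \<open>auto simp: set_integrable_def\<close>)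

lemma cint_const: "cint (\<lambda>x :: real ^ 'n::finite. c) = c * of_real ((2 * pi) ^ CARD('n))"
proof -
  have "measure lborel (cube :: (real ^ 'n) set) = (2 * pi) ^ CARD('n)"
  proof -
    have "(0 :: real ^ 'n) \<in> cube" by (simp add: mem_cube)
    then have "cbox (0 :: real ^ 'n) (\<chi> i. 2 * pi) \<noteq> {}" unfolding cube_def by blast
    then show ?thesis using content_cbox_cart[of "0 :: real ^ 'n" "\<chi> i. 2 * pi"] by (simp add: cube_def)
  qed
  moreover have "cint (\<lambda>x :: real ^ 'n. c) = measure lborel (cube :: (real ^ 'n) set) *\<^sub>R c"
  proof -
    have "emeasure lborel (cube :: (real ^ 'n) set) < \<top>"
      using emeasure_lborel_cbox_finite[of "0 :: real ^ 'n" "\<chi> i. 2 * pi"] by (simp add: cube_def)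
    then show ?thesis unfolding cint_def set_lebesgue_integral_def
      by (subst integral_scaleR_left) (auto intro!: integrable_real_indicator)
  qed
  ultimately show ?thesis by (simp add: scaleR_conv_of_real)
qed

lemma periodic_axis:
  fixes f :: "real ^ 'n::finite \<Rightarrow> 'b"
  assumes "periodic f" shows "f (x + axis i (2 * pi)) = f x"
proof -
  have "(2 * pi) *\<^sub>R kvec (axis i 1 :: int ^ 'n) = axis i (2 * pi)" by (simp add: vec_eq_iff axis_def)
  then show ?thesis using assms unfolding periodic_def by metis
qed

lemma lborel_integral_translation:
  fixes f :: "real ^ 'n::finite \<Rightarrow> complex"
  assumes "f \<in> borel_measurable borel"
  shows "(LINT x|lborel. f (x + v)) = (LINT x|lborel. f x)"
proof -
  have "(LINT x|lborel. f x) = (LINT x|distr lborel borel ((+) v). f x)" by (simp add: lborel_distr_plus)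
  also have "\<dots> = (LINT x|lborel. f (v + x))" using assms by (intro integral_distr) auto
  finally show ?thesis by (simp add: add.commute)
qed

lemma AE_nth_neq: "AE x in lborel. (x :: real ^ 'n::finite) $ i \<noteq> c"
proof -
  have "negligible {x :: real ^ 'n. x $ i = c}"
    using negligible_standard_hyperplane[of "axis i 1 :: real ^ 'n" c] by (simp add: inner_axis axis_in_Basis_iff)
  then have "AE x in lebesgue. (x :: real ^ 'n) $ i \<noteq> c"
    unfolding negligible_iff_null_sets by (intro AE_I'[of "{x. x $ i = c}"]) auto
  then show ?thesis by (simp add: AE_completion_iff)
qed

text \<open>The shifted cell is cut at the face \<open>x $ i = 2 * pi\<close>; the part sticking out
  is moved back by one period, where it fills the slab \<open>C\<close> missing from
  \<open>A\<close>.\<close>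

lemma cint_translate:
  fixes f :: "real ^ 'n::finite \<Rightarrow> complex"
  assumes f: "continuous_on UNIV f" "periodic f" and h: "0 \<le> h" "h \<le> 2 * pi"
  shows "cint (\<lambda>x. f (x + axis i h)) = cint f"
proof -
  define A where "A = {x \<in> cube :: (real ^ 'n) set. h \<le> x $ i}"
  define C where "C = {x \<in> cube :: (real ^ 'n) set. x $ i \<le> h}"
  have cA: "compact A" and cC: "compact C"
    unfolding A_def C_def Collect_conj_eq Collect_mem_eq
    by (intro compact_Int_closed compact_cube closed_Collect_le continuous_intros)+
  have iA: "integrable lborel (\<lambda>x. indicator A x *\<^sub>R f x)" and iC: "integrable lborel (\<lambda>x. indicator C x *\<^sub>R f x)"
    by (intro borel_integrable_compact cA cC continuous_on_subset[OF f(1)]; simp)+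
  define B where "B = (+) (axis i (2 * pi)) ` C"
  have cB: "compact B" unfolding B_def using cC by (rule compact_translation)
  have iB: "integrable lborel (\<lambda>x. indicator B x *\<^sub>R f x)"
    by (intro borel_integrable_compact cB continuous_on_subset[OF f(1)]; simp)
  have memB: "y \<in> B \<longleftrightarrow> y - axis i (2 * pi) \<in> C" for y
    unfolding B_def by (auto simp: image_iff algebra_simps intro!: bexI[of _ "y - axis i (2 * pi)"])
  have m: "f \<in> borel_measurable lborel" using f(1) by (simp add: borel_measurable_continuous_onI)
  have ms: "(\<lambda>y. indicat_real cube (y - axis i h) *\<^sub>R f y) \<in> borel_measurable lborel"
  proof (intro borel_measurable_scaleR m)
    show "(\<lambda>x. indicat_real cube (x - axis i h)) \<in> borel_measurable lborel"
      using measurable_compose[of "\<lambda>x. x - axis i h" borel borel "indicat_real cube"] by simp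
  qed
  have "cint (\<lambda>x. f (x + axis i h)) = (LINT x|lborel. indicator cube (x + axis i h - axis i h) *\<^sub>R f (x + axis i h))"
    by (simp add: cint_def set_lebesgue_integral_def)
  also have "\<dots> = (LINT y|lborel. indicator cube (y - axis i h) *\<^sub>R f y)"
    by (rule lborel_integral_translation) (use ms in simp)
  also have "\<dots> = (LINT y|lborel. indicator A y *\<^sub>R f y + indicator B y *\<^sub>R f y)"
  proof (rule integral_cong_AE)
    \<comment> \<open>The pieces \<open>A\<close> and \<open>B\<close> cover the shifted cell and
      overlap only in a hyperplane, which is a null set.\<close>
    show "AE y in lborel. indicat_real cube (y - axis i h) *\<^sub>R f y = indicator A y *\<^sub>R f y + indicator B y *\<^sub>R f y"
      using AE_nth_neq[of i "2 * pi"]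
    proof eventually_elim
      case (elim y)
      have y: "y - axis i h \<in> cube \<longleftrightarrow> (\<forall>j. j \<noteq> i \<longrightarrow> 0 \<le> y $ j \<and> y $ j \<le> 2 * pi) \<and> h \<le> y $ i \<and> y $ i \<le> 2 * pi + h"
        by (auto simp: mem_cube axis_def)
      have a: "y \<in> A \<longleftrightarrow> (\<forall>j. j \<noteq> i \<longrightarrow> 0 \<le> y $ j \<and> y $ j \<le> 2 * pi) \<and> h \<le> y $ i \<and> y $ i \<le> 2 * pi"
        using h by (auto simp: A_def mem_cube axis_def) (metis order_trans)
      have b: "y \<in> B \<longleftrightarrow> (\<forall>j. j \<noteq> i \<longrightarrow> 0 \<le> y $ j \<and> y $ j \<le> 2 * pi) \<and> 2 * pi \<le> y $ i \<and> y $ i \<le> 2 * pi + h"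
        using h by (auto simp: memB C_def mem_cube axis_def)
      show ?case
        using elim h y a b by (cases "y $ i < 2 * pi") (auto simp: indicator_def)
    qed
  qed (intro ms borel_measurable_add borel_measurable_integrable[OF iA] borel_measurable_integrable[OF iB])+
  also have "\<dots> = (LINT y|lborel. indicator A y *\<^sub>R f y) + (LINT y|lborel. indicator B y *\<^sub>R f y)"
    by (rule Bochner_Integration.integral_add[OF iA iB])
  also have "(LINT y|lborel. indicator B y *\<^sub>R f y)
      = (LINT y|lborel. indicator B (y + axis i (2 * pi)) *\<^sub>R f (y + axis i (2 * pi)))"
    by (rule lborel_integral_translation[symmetric]) (use borel_measurable_integrable[OF iB] in simp)
  also have "\<dots> = (LINT y|lborel. indicator C y *\<^sub>R f y)"
    using periodic_axis[OF f(2)] by (simp add: indicator_def memB)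
  also have "(LINT y|lborel. indicator A y *\<^sub>R f y) + (LINT y|lborel. indicator C y *\<^sub>R f y)
      = (LINT y|lborel. indicator A y *\<^sub>R f y + indicator C y *\<^sub>R f y)"
    by (rule Bochner_Integration.integral_add[OF iA iC, symmetric])
  also have "\<dots> = (LINT y|lborel. indicator cube y *\<^sub>R f y)"
  proof (rule integral_cong_AE)
    show "AE y in lborel. indicator A y *\<^sub>R f y + indicator C y *\<^sub>R f y = indicat_real cube y *\<^sub>R f y"
      using AE_nth_neq[of i h] by eventually_elim (auto simp: A_def C_def indicator_def)
  qed (intro borel_measurable_add borel_measurable_integrable[OF iA] borel_measurable_integrable[OF iC]
      borel_measurable_integrable[OF cube_integrable[OF f(1), unfolded set_integrable_def]])+
  finally show ?thesis by (simp add: cint_def set_lebesgue_integral_def)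
qed

section \<open>Continuously differentiable functions and integration by parts\<close>

definition C1 :: "(real ^ 'n::finite \<Rightarrow> complex) \<Rightarrow> bool" where
  "C1 f \<longleftrightarrow> (\<forall>x. f differentiable (at x)) \<and> (\<forall>i. continuous_on UNIV (partial i f))"

lemma partial_eq: "(f has_derivative D) (at x) \<Longrightarrow> partial i f x = D (axis i 1)"
  unfolding partial_def by (metis frechet_derivative_at)

lemma adv_eq: "(f has_derivative D) (at x) \<Longrightarrow> adv v f x = D (v x)"
  unfolding adv_def by (metis frechet_derivative_at)

lemma adv_eq_sum_partial:
  fixes f :: "real ^ 'n::finite \<Rightarrow> 'b::real_normed_vector"
  assumes "f differentiable (at x)"
  shows "adv v f x = (\<Sum>i\<in>UNIV. v x $ i *\<^sub>R partial i f x)"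
proof -
  have l: "linear (frechet_derivative f (at x))" using assms by (rule linear_frechet_derivative)
  have "v x = (\<Sum>i\<in>UNIV. v x $ i *\<^sub>R axis i 1)"
    by (simp add: vec_eq_iff axis_def if_distrib sum.delta cong: if_cong)
  then have "adv v f x = frechet_derivative f (at x) (\<Sum>i\<in>UNIV. v x $ i *\<^sub>R axis i 1)" by (simp add: adv_def)
  also have "\<dots> = (\<Sum>i\<in>UNIV. v x $ i *\<^sub>R partial i f x)"
    by (simp add: linear_sum[OF l] linear_cmul[OF l] partial_def)
  finally show ?thesis .
qed

lemma C1_continuous: "C1 f \<Longrightarrow> continuous_on UNIV f"
  unfolding C1_def by (metis continuous_at_imp_continuous_on differentiable_imp_continuous_within)

text \<open>Difference quotients along an axis have zero integral by translation invariance, and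
  they converge to the partial derivative under a constant bound on the cell.\<close>

lemma cint_partial_eq_0:
  fixes f :: "real ^ 'n::finite \<Rightarrow> complex"
  assumes f: "C1 f" "periodic f"
  shows "cint (partial i f) = 0"
proof -
  define h where "h n = 1 / real (Suc n)" for n
  have h: "0 < h n" "h n \<le> 1" for n by (auto simp: h_def)
  have h2: "h n \<le> 2 * pi" for n using h(2)[of n] pi_gt3 by linarith
  define q where "q n x = (f (x + axis i (h n)) - f x) / of_real (h n)" for n x
  have cf: "continuous_on UNIV f" using f by (intro C1_continuous)
  have cf2: "continuous_on UNIV (\<lambda>x. f (x + axis i (h n)))" for n
    by (intro continuous_on_compose2[OF cf] continuous_intros) auto
  have q0: "cint (q n) = 0" for n
  proof -
    have "cint (q n) = cint (\<lambda>x. inverse (of_real (h n)) * (f (x + axis i (h n)) - f x))"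
      by (intro arg_cong[of _ _ cint]) (auto simp: q_def divide_inverse)
    also have "\<dots> = 0"
      unfolding cint_cmult using h(1)[of n] h2[of n]
      by (simp add: cint_diff cf cf2 cint_translate f less_imp_le)
    finally show ?thesis .
  qed
  have line: "((\<lambda>s. f (x + axis i s)) has_vector_derivative partial i f (x + axis i s)) (at s)" for x s
  proof -
    have "((\<lambda>s. f (x + axis i s)) has_derivative (\<lambda>r. frechet_derivative f (at (x + axis i s)) (axis i r))) (at s)"
    proof (rule has_derivative_compose[of "\<lambda>s. x + axis i s"])
      have "axis i = (\<lambda>s :: real. s *\<^sub>R (axis i 1 :: real ^ 'n))" by (auto simp: vec_eq_iff axis_def)
      moreover have "((\<lambda>s. x + s *\<^sub>R axis i 1) has_derivative (\<lambda>s. s *\<^sub>R axis i 1)) (at s)"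
        by (auto intro!: derivative_eq_intros)
      ultimately show "((\<lambda>s. x + axis i s) has_derivative axis i) (at s)" by metis
      show "(f has_derivative frechet_derivative f (at (x + axis i s))) (at (x + axis i s))"
        using f(1) by (simp add: C1_def flip: frechet_derivative_works)
    qed
    moreover have "frechet_derivative f (at y) (axis i r) = r *\<^sub>R partial i f y" for y r
    proof -
      have "axis i r = r *\<^sub>R (axis i 1 :: real ^ 'n)" by (auto simp: vec_eq_iff axis_def)
      then show ?thesis using linear_cmul[OF linear_frechet_derivative[of f "at y"]] f(1)
        by (simp add: partial_def C1_def)
    qed
    ultimately show ?thesis by (simp add: has_vector_derivative_def)
  qed
  have qlim: "(\<lambda>n. q n x) \<longlonglongrightarrow> partial i f x" for x
  proof -
    have a0: "axis i (0::real) = (0 :: real ^ 'n)" by (simp add: vec_eq_iff axis_def)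
    have "((\<lambda>s. (f (x + axis i s) - f x) /\<^sub>R s) \<longlongrightarrow> partial i f x) (at 0)"
      using line[of x 0] unfolding has_vector_derivative_iff_quotient by (simp add: a0)
    moreover have "filterlim h (at 0) sequentially"
      using h(1) unfolding filterlim_at h_def by (auto intro!: LIMSEQ_Suc[OF lim_1_over_n] simp del: of_nat_Suc)
    ultimately have "(\<lambda>n. (f (x + axis i (h n)) - f x) /\<^sub>R h n) \<longlonglongrightarrow> partial i f x"
      by (rule filterlim_compose)
    then show ?thesis by (simp add: q_def scaleR_conv_of_real divide_inverse mult.commute)
  qed
  \<comment> \<open>The steps \<open>h n\<close> are at most 1, so the segments used in the mean
    value estimate may leave the cell by at most 1; hence the enlargement.\<close>
  define K where "K = cbox (0 :: real ^ 'n) (\<chi> i. 2 * pi + 1)"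
  have cp: "continuous_on UNIV (partial i f)" using f(1) by (simp add: C1_def)
  have "compact (partial i f ` K)"
    unfolding K_def by (intro compact_continuous_image continuous_on_subset[OF cp]) auto
  then obtain B where B: "\<And>x. x \<in> K \<Longrightarrow> norm (partial i f x) \<le> B"
    using compact_imp_bounded bounded_iff by (metis imageI)
  have qb: "norm (q n x) \<le> B" if x: "x \<in> cube" for n x
  proof -
    have "norm (f (x + axis i (h n)) - f (x + axis i 0)) \<le> B * norm (h n - 0)"
    proof (rule differentiable_bound[of "{0..h n}" _ "\<lambda>s r. r *\<^sub>R partial i f (x + axis i s)"])
      fix s assume s: "s \<in> {0..h n}"
      show "((\<lambda>s. f (x + axis i s)) has_derivative (\<lambda>r. r *\<^sub>R partial i f (x + axis i s))) (at s within {0..h n})"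
        using line[of x s] by (auto simp: has_vector_derivative_def intro: has_derivative_at_withinI)
      have "x + axis i s \<in> K" using x s h(2)[of n] by (auto simp: K_def mem_box_cart mem_cube axis_def intro: add_mono order_trans)
      then show "onorm (\<lambda>r. r *\<^sub>R partial i f (x + axis i s)) \<le> B"
        using B by (intro onorm_le) (auto simp: mult.commute[of B] intro!: mult_left_mono)
    qed (use h(1)[of n] in auto)
    moreover have "axis i (0::real) = (0 :: real ^ 'n)" by (simp add: vec_eq_iff axis_def)
    ultimately show ?thesis using h(1)[of n] by (simp add: q_def norm_divide divide_simps)
  qed
  have "(\<lambda>n. cint (q n)) \<longlonglongrightarrow> cint (partial i f)"
    unfolding cint_def set_lebesgue_integral_def
  proof (rule integral_dominated_convergence[of _ _ _ "\<lambda>x. indicator cube x * B"])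
    show "integrable lborel (\<lambda>x :: real ^ 'n. indicat_real cube x * B)"
      using cube_integrable[of "\<lambda>_. B"] by (simp add: set_integrable_def)
    show "AE x in lborel. (\<lambda>n. indicat_real cube x *\<^sub>R q n x) \<longlonglongrightarrow> indicat_real cube x *\<^sub>R partial i f x"
      using qlim by (intro AE_I2 tendsto_intros)
    show "AE x in lborel. norm (indicat_real cube x *\<^sub>R q n x) \<le> indicat_real cube x * B" for n
      using qb by (intro AE_I2) (auto simp: indicator_def)
    have "continuous_on UNIV (q n)" for n
      unfolding q_def using h(1)[of n] by (intro continuous_intros cf cf2) auto
    then show "(\<lambda>x. indicat_real cube x *\<^sub>R q n x) \<in> borel_measurable lborel" for n
      using cube_integrable[of "q n"] by (auto simp: set_integrable_def)
    show "(\<lambda>x. indicat_real cube x *\<^sub>R partial i f x) \<in> borel_measurable lborel"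
      using cube_integrable[OF cp] by (auto simp: set_integrable_def)
  qed
  then show ?thesis by (simp add: q0 LIMSEQ_const_iff)
qed


lemma C1_mult:
  assumes "C1 f" "C1 g"
  shows "C1 (\<lambda>x. f x * g x)" "partial i (\<lambda>x. f x * g x) x = f x * partial i g x + partial i f x * g x"
    "adv v (\<lambda>x. f x * g x) x = f x * adv v g x + adv v f x * g x"
proof -
  have d: "((\<lambda>x. f x * g x) has_derivative
      (\<lambda>h. f x * frechet_derivative g (at x) h + frechet_derivative f (at x) h * g x)) (at x)" for x
    using assms by (intro has_derivative_mult) (auto simp: C1_def simp flip: frechet_derivative_works)
  show p: "partial i (\<lambda>x. f x * g x) x = f x * partial i g x + partial i f x * g x" for i x
    using partial_eq[OF d] by (simp add: partial_def)
  show "adv v (\<lambda>x. f x * g x) x = f x * adv v g x + adv v f x * g x"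
    using adv_eq[OF d] by (simp add: adv_def)
  have "partial i (\<lambda>x. f x * g x) = (\<lambda>x. f x * partial i g x + partial i f x * g x)" for i
    by (rule ext) (rule p)
  then show "C1 (\<lambda>x. f x * g x)"
    using d assms C1_continuous[OF assms(1)] C1_continuous[OF assms(2)] unfolding C1_def
    by (auto simp: differentiable_def intro!: continuous_intros)
qed

lemma C1_cnj:
  assumes "C1 f"
  shows "C1 (\<lambda>x. cnj (f x))" "adv v (\<lambda>x. cnj (f x)) x = cnj (adv v f x)"
proof -
  have d: "((\<lambda>x. cnj (f x)) has_derivative (\<lambda>h. cnj (frechet_derivative f (at x) h))) (at x)" for x
    using assms by (intro has_derivative_cnj) (auto simp: C1_def simp flip: frechet_derivative_works)
  show "adv v (\<lambda>x. cnj (f x)) x = cnj (adv v f x)" using adv_eq[OF d] by (simp add: adv_def)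
  have "partial i (\<lambda>x. cnj (f x)) = (\<lambda>x. cnj (partial i f x))" for i
    using partial_eq[OF d] by (auto simp: partial_def)
  then show "C1 (\<lambda>x. cnj (f x))"
    using d assms unfolding C1_def by (auto simp: differentiable_def intro!: continuous_intros)
qed

lemma C1_bounded_linear:
  fixes g :: "real ^ 'n::finite \<Rightarrow> 'b::real_normed_vector"
  assumes L: "bounded_linear L" and g: "\<And>x. g differentiable (at x)" "\<And>i. continuous_on UNIV (partial i g)"
  shows "C1 (\<lambda>x. L (g x))" "partial i (\<lambda>x. L (g x)) x = L (partial i g x)" "adv v (\<lambda>x. L (g x)) x = L (adv v g x)"
proof -
  have d: "((\<lambda>x. L (g x)) has_derivative (\<lambda>h. L (frechet_derivative g (at x) h))) (at x)" for x
    using g(1) by (intro bounded_linear.has_derivative[OF L]) (simp flip: frechet_derivative_works)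
  show p: "partial i (\<lambda>x. L (g x)) x = L (partial i g x)" for i x using partial_eq[OF d] by (simp add: partial_def)
  show "adv v (\<lambda>x. L (g x)) x = L (adv v g x)" using adv_eq[OF d] by (simp add: adv_def)
  have "partial i (\<lambda>x. L (g x)) = (\<lambda>x. L (partial i g x))" for i by (rule ext) (rule p)
  then show "C1 (\<lambda>x. L (g x))"
    unfolding C1_def using bounded_linear.continuous_on[OF L g(2)] differentiableI[OF d] by simp
qed

text \<open>Only first-order regularity of the smooth fields is kept: it suffices for both transport
  and the second-order operator, where one derivative can fall on the field.\<close>

definition solenoidal :: "(real ^ 'n::finite \<Rightarrow> real ^ 'n) \<Rightarrow> bool" where
  "solenoidal v \<longleftrightarrow> (\<forall>x. v differentiable (at x)) \<and> (\<forall>i. continuous_on UNIV (partial i v)) \<and> periodic v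
    \<and> (\<forall>x. divergence v x = 0)"

lemma smooth_imp_solenoidal:
  assumes "smooth v" "periodic v" "\<And>x. divergence v x = 0"
  shows "solenoidal v"
proof -
  have "Ck (Suc 0) v" using assms(1) unfolding smooth_def by blast
  then show ?thesis using assms(2,3) by (simp add: solenoidal_def)
qed

lemma solenoidal_continuous: "solenoidal v \<Longrightarrow> continuous_on UNIV v"
  unfolding solenoidal_def by (metis continuous_at_imp_continuous_on differentiable_imp_continuous_within)

text \<open>As \<open>v\<close> is divergence free, \<open>adv v h\<close> is the divergence of the
  field \<open>h v\<close>, hence a sum of partial derivatives of periodic functions.\<close>

lemma cint_adv_eq_0:
  assumes v: "solenoidal v" and h: "C1 h" "periodic h"
  shows "cint (adv v h) = 0"
proof -
  let ?v = "\<lambda>i x. complex_of_real (v x $ i)"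
  have L: "bounded_linear (\<lambda>y :: real ^ 'a. complex_of_real (y $ i))" for i
    by (intro bounded_linear_compose[OF bounded_linear_of_real] bounded_linear_vec_nth)
  have vd: "\<And>x. v differentiable (at x)" "\<And>i. continuous_on UNIV (partial i v)" "periodic v" "\<And>x. divergence v x = 0"
    using v by (auto simp: solenoidal_def)
  have C: "C1 (?v i)" for i using C1_bounded_linear(1)[OF L vd(1,2)] .
  have pv: "partial j (?v i) x = complex_of_real (partial j v x $ i)" for i j x
    using C1_bounded_linear(2)[OF L vd(1,2)] .
  have hd: "h differentiable (at x)" "continuous_on UNIV (partial i h)" for x i using h(1) by (auto simp: C1_def)
  note ch = C1_continuous[OF h(1)]
  have "adv v h x = (\<Sum>i\<in>UNIV. partial i (\<lambda>x. ?v i x * h x) x)" for x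
  proof -
    have "(\<Sum>i\<in>UNIV. partial i (\<lambda>x. ?v i x * h x) x) = (\<Sum>i\<in>UNIV. v x $ i *\<^sub>R partial i h x) + of_real (divergence v x) * h x"
      by (simp add: C1_mult(2)[OF C h(1)] pv sum.distrib divergence_def sum_distrib_right scaleR_conv_of_real)
    then show ?thesis using adv_eq_sum_partial[OF hd(1)] vd(4) by simp
  qed
  then have "cint (adv v h) = cint (\<lambda>x. \<Sum>i\<in>UNIV. partial i (\<lambda>x. ?v i x * h x) x)"
    by (intro arg_cong[of _ _ cint]) auto
  also have "\<dots> = (\<Sum>i\<in>UNIV. cint (partial i (\<lambda>x. ?v i x * h x)))"
    using C1_mult(1)[OF C h(1)] by (intro cint_sum) (auto simp: C1_def)
  also have "\<dots> = 0"
    using vd(3) h(2) by (intro sum.neutral ballI cint_partial_eq_0 C1_mult(1) C h(1)) (simp add: periodic_def)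
  finally show ?thesis .
qed

section \<open>Orthonormality and Bessel's inequality\<close>

lemma e_basis_has_derivative:
  "(e_basis k has_derivative (\<lambda>h. \<i> * of_real (h \<bullet> kvec k) * e_basis k x)) (at x)"
  unfolding e_basis_def[abs_def]
  by (auto intro!: derivative_eq_intros simp: scaleR_conv_of_real inner_commute algebra_simps)

lemma adv_e_basis: "adv v (e_basis k) x = \<i> * of_real (v x \<bullet> kvec k) * e_basis k x"
  by (rule adv_eq[OF e_basis_has_derivative])

lemma partial_e_basis: "partial i (e_basis k) x = \<i> * of_int (k $ i) * e_basis k x"
  using partial_eq[OF e_basis_has_derivative] by (simp add: inner_axis')

lemma continuous_e_basis [continuous_intros]: "continuous_on A (e_basis k)"
  by (rule continuous_on_subset[of UNIV])
     (auto intro!: has_derivative_continuous_on e_basis_has_derivative)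

lemma C1_e_basis [simp]: "C1 (e_basis k)"
proof -
  have "partial i (e_basis k) = (\<lambda>x. \<i> * of_int (k $ i) * e_basis k x)" for i
    by (rule ext) (rule partial_e_basis)
  then show ?thesis
    unfolding C1_def using e_basis_has_derivative
    by (auto simp: differentiable_def intro!: continuous_intros)
qed

lemma periodic_e_basis [simp]: "periodic (e_basis k)"
  unfolding periodic_def
proof (intro allI)
  fix x m
  define n where "n = (\<Sum>i\<in>UNIV. k $ i * m $ i)"
  have "kvec k \<bullet> ((2 * pi) *\<^sub>R kvec m) = 2 * pi * of_int n"
    by (simp add: inner_vec_def n_def sum_distrib_left mult_ac)
  then have "cis (kvec k \<bullet> (x + (2 * pi) *\<^sub>R kvec m)) = cis (kvec k \<bullet> x)"
    unfolding inner_add_right by (simp only: cis_mult[symmetric]) (simp add: cis_multiple_2pi)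
  then show "e_basis k (x + (2 * pi) *\<^sub>R kvec m) = e_basis k x"
    by (simp add: e_basis_def)
qed

lemma cnj_e_basis: "cnj (e_basis k x) = e_basis (- k) x"
  by (simp add: e_basis_def cis_cnj)

lemma e_basis_mult_cnj:
  fixes k :: "int ^ 'n::finite"
  shows "e_basis k x * cnj (e_basis m x) = of_real ((2 * pi) powr (- real CARD('n) / 2)) * e_basis (k - m) x"
  by (simp add: e_basis_def cis_cnj cis_mult kvec_diff inner_diff_left)

text \<open>Shifting by \<open>pi / \<bar>k $ i\<bar>\<close> along an axis with
  \<open>k $ i \<noteq> 0\<close> changes the sign of \<open>e_basis k\<close> but not its
  integral.\<close>

lemma cint_e_basis_eq_0:
  assumes "k \<noteq> 0" shows "cint (e_basis k) = 0"
proof -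
  obtain i where i: "k $ i \<noteq> 0" using assms by (auto simp: vec_eq_iff)
  define h where "h = pi / \<bar>of_int (k $ i)\<bar>"
  have "\<bar>of_int (k $ i)\<bar> \<ge> (1::real)" using i by linarith
  then have h: "0 \<le> h" "h \<le> 2 * pi"
    unfolding h_def by (auto simp: divide_le_eq intro: order_trans[of _ "pi * 1"])
  have "of_int (k $ i) * h = pi \<or> of_int (k $ i) * h = - pi"
    using i by (auto simp: h_def abs_if)
  then have "cis (of_int (k $ i) * h) = - 1" by (elim disjE) (simp_all add: complex_eq_iff)
  moreover have "kvec k \<bullet> (x + axis i h) = kvec k \<bullet> x + of_int (k $ i) * h" for x
    by (simp add: inner_add_right inner_axis)
  ultimately have "e_basis k (x + axis i h) = - e_basis k x" for x
    by (simp add: e_basis_def flip: cis_mult)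
  then have "cint (e_basis k) = - cint (e_basis k)"
    using cint_translate[of "e_basis k" h i] h by (simp add: cint_minus continuous_e_basis)
  then show ?thesis by simp
qed

lemma e_basis_orthonormal: "cint (\<lambda>x. e_basis k x * cnj (e_basis m x)) = (if k = m then 1 else 0)"
proof (cases "k = m")
  case True
  have "(2 * pi) powr (- real CARD('a) / 2) * (2 * pi) powr (- real CARD('a) / 2) * (2 * pi) ^ CARD('a) = 1"
  proof -
    have p: "(2 * pi) ^ CARD('a) = (2 * pi) powr real CARD('a)" by (rule powr_realpow[symmetric]) simp
    show ?thesis unfolding p powr_add[symmetric] by simp
  qed
  then have "complex_of_real ((2 * pi) powr (- real CARD('a) / 2)) * of_real ((2 * pi) powr (- real CARD('a) / 2))
      * of_real ((2 * pi) ^ CARD('a)) = 1"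
    by (simp only: flip: of_real_mult) simp
  then show ?thesis
    unfolding e_basis_mult_cnj cint_cmult using True
    by (simp add: e_basis_def[of 0] cint_const mult.assoc)
qed (simp add: e_basis_mult_cnj cint_cmult cint_e_basis_eq_0)

lemma fourier_eq_cint: "fourier f k = cint (\<lambda>x. f x * cnj (e_basis k x))"
  by (simp add: fourier_def cint_def)

lemma fourier_e_basis: "fourier (e_basis k) m = (if k = m then 1 else 0)"
  by (simp add: fourier_eq_cint e_basis_orthonormal)

lemma fourier_add:
  "continuous_on UNIV f \<Longrightarrow> continuous_on UNIV g \<Longrightarrow> fourier (\<lambda>x. f x + g x) k = fourier f k + fourier g k"
  unfolding fourier_eq_cint distrib_right by (intro cint_add continuous_intros)

lemma fourier_cmult: "fourier (\<lambda>x. c * f x) k = c * fourier f k"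
  unfolding fourier_eq_cint mult.assoc by (rule cint_cmult)

lemma fourier_sum:
  "(\<And>i. i \<in> I \<Longrightarrow> continuous_on UNIV (f i)) \<Longrightarrow> fourier (\<lambda>x. \<Sum>i\<in>I. f i x) k = (\<Sum>i\<in>I. fourier (f i) k)"
  unfolding fourier_eq_cint sum_distrib_right by (intro cint_sum continuous_intros)

lemma fourier_cnj: "continuous_on UNIV f \<Longrightarrow> fourier (\<lambda>x. cnj (f x)) k = cnj (fourier f (- k))"
  unfolding fourier_eq_cint by (subst cint_cnj[symmetric]) (auto simp: cnj_e_basis intro!: continuous_intros)

lemma cint_norm_squared: 
  assumes "continuous_on UNIV f"
  shows "cint (\<lambda>x. f x * cnj (f x)) = of_real (LINT x:cube|lborel. (cmod (f x))\<^sup>2)"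
proof -
  have c: "continuous_on UNIV (\<lambda>x. (cmod (f x))\<^sup>2)" by (intro continuous_intros assms)
  have "cint (\<lambda>x. f x * cnj (f x)) = (LINT x|lborel. complex_of_real (indicator cube x *\<^sub>R (cmod (f x))\<^sup>2))"
    unfolding cint_def set_lebesgue_integral_def
    by (intro Bochner_Integration.integral_cong) (auto simp: complex_norm_square[symmetric] scaleR_conv_of_real)
  also have "\<dots> = of_real (LINT x:cube|lborel. (cmod (f x))\<^sup>2)"
    unfolding set_lebesgue_integral_def
    by (rule integral_bounded_linear[OF bounded_linear_of_real])
      (use cube_integrable[OF c] in \<open>simp add: set_integrable_def\<close>)
  finally show ?thesis .
qed

lemma cint_mult_cnj_trig:
  assumes "finite K" "continuous_on UNIV f"
  shows "cint (\<lambda>x. f x * cnj (\<Sum>k\<in>K. b k * e_basis k x)) = (\<Sum>k\<in>K. cnj (b k) * fourier f k)"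
proof -
  have "cint (\<lambda>x. f x * cnj (\<Sum>k\<in>K. b k * e_basis k x)) = cint (\<lambda>x. \<Sum>k\<in>K. cnj (b k) * (f x * cnj (e_basis k x)))"
    by (simp add: sum_distrib_left mult_ac)
  also have "\<dots> = (\<Sum>k\<in>K. cint (\<lambda>x. cnj (b k) * (f x * cnj (e_basis k x))))"
    by (intro cint_sum continuous_intros assms)
  finally show ?thesis by (simp only: cint_cmult fourier_eq_cint)
qed

lemma fourier_trig:
  assumes "finite K"
  shows "fourier (\<lambda>x. \<Sum>k\<in>K. b k * e_basis k x) m = (if m \<in> K then b m else 0)"
proof -
  have "fourier (\<lambda>x. \<Sum>k\<in>K. b k * e_basis k x) m = (\<Sum>k\<in>K. b k * fourier (e_basis k) m)"
    by (subst fourier_sum) (auto intro!: continuous_intros simp: fourier_cmult)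
  then show ?thesis using assms by (simp add: fourier_e_basis if_distrib sum.delta' cong: if_cong)
qed

lemma Parseval_trig:
  assumes "finite K"
  shows "(LINT x:cube|lborel. (cmod (\<Sum>k\<in>K. b k * e_basis k x))\<^sup>2) = (\<Sum>k\<in>K. (cmod (b k))\<^sup>2)"
proof -
  let ?g = "\<lambda>x. \<Sum>k\<in>K. b k * e_basis k x"
  have c: "continuous_on UNIV ?g" by (intro continuous_intros)
  have "complex_of_real (LINT x:cube|lborel. (cmod (?g x))\<^sup>2) = (\<Sum>k\<in>K. cnj (b k) * b k)"
    unfolding cint_norm_squared[OF c, symmetric] cint_mult_cnj_trig[OF assms c] fourier_trig[OF assms] by simp
  also have "\<dots> = of_real (\<Sum>k\<in>K. (cmod (b k))\<^sup>2)"
    unfolding of_real_sum by (intro sum.cong refl) (simp only: complex_norm_square mult.commute)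
  finally show ?thesis by (simp only: of_real_eq_iff)
qed

text \<open>The squared distance from \<open>f\<close> to its projection \<open>g\<close> onto the
  modes in \<open>F\<close> is nonnegative; by orthonormality all products involving
  \<open>g\<close> integrate to the same number \<open>S\<close>.\<close>

lemma Bessel:
  assumes f: "continuous_on UNIV f" and F: "finite F"
  shows "(\<Sum>m\<in>F. (cmod (fourier f m))\<^sup>2) \<le> (LINT x:cube|lborel. (cmod (f x))\<^sup>2)"
proof -
  define g where "g x = (\<Sum>m\<in>F. fourier f m * e_basis m x)" for x
  define S where "S = (\<Sum>m\<in>F. (cmod (fourier f m))\<^sup>2)"
  have g: "continuous_on UNIV g" unfolding g_def by (intro continuous_intros)
  have S: "complex_of_real S = (\<Sum>m\<in>F. cnj (fourier f m) * fourier f m)"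
    unfolding S_def of_real_sum by (intro sum.cong refl) (simp only: complex_norm_square mult.commute)
  have fg: "cint (\<lambda>x. f x * cnj (g x)) = of_real S"
    unfolding g_def cint_mult_cnj_trig[OF F f] S ..
  have gg: "cint (\<lambda>x. g x * cnj (g x)) = of_real S"
    using Parseval_trig[OF F, of "fourier f"] by (simp add: cint_norm_squared[OF g]) (simp add: g_def S_def)
  have gf: "cint (\<lambda>x. g x * cnj (f x)) = of_real S"
    using cint_cnj[of "\<lambda>x. f x * cnj (g x)"] f g by (simp add: fg mult.commute continuous_intros)
  have "of_real (LINT x:cube|lborel. (cmod (f x - g x))\<^sup>2) = cint (\<lambda>x. (f x - g x) * cnj (f x - g x))"
    by (intro cint_norm_squared[symmetric] continuous_intros f g)
  also have "\<dots> = cint (\<lambda>x. (f x * cnj (f x) - f x * cnj (g x)) - (g x * cnj (f x) - g x * cnj (g x)))"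
    by (simp add: algebra_simps)
  also have "\<dots> = (cint (\<lambda>x. f x * cnj (f x)) - of_real S) - (of_real S - of_real S)"
    by (subst cint_diff cint_diff cint_diff; (intro continuous_intros f g)?)+ (simp add: fg gg gf)
  also have "\<dots> = of_real ((LINT x:cube|lborel. (cmod (f x))\<^sup>2) - S)"
    by (simp add: cint_norm_squared[OF f])
  finally have "(LINT x:cube|lborel. (cmod (f x - g x))\<^sup>2) = (LINT x:cube|lborel. (cmod (f x))\<^sup>2) - S"
    by (simp only: of_real_eq_iff)
  moreover have "0 \<le> (LINT x:cube|lborel. (cmod (f x - g x))\<^sup>2)"
    unfolding set_lebesgue_integral_def by (intro Bochner_Integration.integral_nonneg) auto
  ultimately show ?thesis by (simp add: S_def)
qed

text \<open>Bessel controls the product, the pointwise bound takes out \<open>G\<close>, and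
  Parseval for the trigonometric polynomial evaluates what is left.\<close>

lemma multiplication_bound:
  assumes g: "continuous_on UNIV g" "\<And>x. x \<in> cube \<Longrightarrow> cmod (g x) \<le> G" and K: "finite K" and F: "finite F"
  shows "(\<Sum>m\<in>F. (cmod (fourier (\<lambda>x. g x * (\<Sum>k\<in>K. b k * e_basis k x)) m))\<^sup>2) \<le> G\<^sup>2 * (\<Sum>k\<in>K. (cmod (b k))\<^sup>2)"
proof -
  let ?h = "\<lambda>x. \<Sum>k\<in>K. b k * e_basis k x"
  have h: "continuous_on UNIV ?h" by (intro continuous_intros)
  have "(\<Sum>m\<in>F. (cmod (fourier (\<lambda>x. g x * ?h x) m))\<^sup>2) \<le> (LINT x:cube|lborel. (cmod (g x * ?h x))\<^sup>2)"
    by (intro Bessel continuous_intros g h F)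
  also have "\<dots> \<le> (LINT x:cube|lborel. G\<^sup>2 * (cmod (?h x))\<^sup>2)"
    by (intro set_integral_mono cube_integrable continuous_intros g h)
      (auto simp: norm_mult power_mult_distrib intro!: mult_right_mono power_mono g(2))
  also have "\<dots> = G\<^sup>2 * (\<Sum>k\<in>K. (cmod (b k))\<^sup>2)" by (simp add: Parseval_trig[OF K])
  finally show ?thesis .
qed

section \<open>Matrices acting between Sobolev spaces\<close>

text \<open>\<open>T k m\<close> is the \<open>m\<close>-th Fourier coefficient of the image of \<open>e\<^sub>k\<close>; the bound says that the matrix is
  bounded from \<open>H\<^sup>s\<close> to \<open>L\<^sup>2\<close>, tested on finite sections.\<close>

definition op_bound :: "real \<Rightarrow> real \<Rightarrow> (int ^ 'n::finite \<Rightarrow> int ^ 'n \<Rightarrow> complex) \<Rightarrow> bool" where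
  "op_bound s G T \<longleftrightarrow> 0 \<le> G \<and> (\<forall>K F b. finite K \<longrightarrow> K \<subseteq> - {0} \<longrightarrow> finite F \<longrightarrow>
     L2_set (\<lambda>m. cmod (\<Sum>k\<in>K. T k m * b k)) F \<le> G * sqrt (\<Sum>k\<in>K. sob_term s b k))"

definition bounded_op :: "real \<Rightarrow> (int ^ 'n::finite \<Rightarrow> int ^ 'n \<Rightarrow> complex) \<Rightarrow> bool" where
  "bounded_op s T \<longleftrightarrow> (\<exists>G. op_bound s G T)"

lemma op_boundD:
  "op_bound s G T \<Longrightarrow> finite K \<Longrightarrow> K \<subseteq> - {0} \<Longrightarrow> finite F \<Longrightarrow>
     L2_set (\<lambda>m. cmod (\<Sum>k\<in>K. T k m * b k)) F \<le> G * sqrt (\<Sum>k\<in>K. sob_term s b k)"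
  unfolding op_bound_def by blast

lemma L2_set_cmod_add: "L2_set (\<lambda>m. cmod (x m + y m)) F \<le> L2_set (\<lambda>m. cmod (x m)) F + L2_set (\<lambda>m. cmod (y m)) F"
  by (rule order_trans[OF L2_set_mono L2_set_triangle_ineq]) (auto intro: norm_triangle_ineq)

lemma bounded_op_zero: "bounded_op s (\<lambda>k m. 0)"
  unfolding bounded_op_def op_bound_def by (intro exI[of _ 0]) (simp add: L2_set_def)

lemma bounded_op_add:
  assumes "bounded_op s T" "bounded_op s U"
  shows "bounded_op s (\<lambda>k m. T k m + U k m)"
proof -
  obtain G H where GH: "op_bound s G T" "op_bound s H U" using assms by (auto simp: bounded_op_def)
  have "op_bound s (G + H) (\<lambda>k m. T k m + U k m)"
    unfolding op_bound_def
  proof (intro conjI allI impI)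
    show "0 \<le> G + H" using GH by (simp add: op_bound_def)
    fix K F :: "(int ^ 'a) set" and b assume K: "finite K" "K \<subseteq> - {0}" "finite F"
    have "L2_set (\<lambda>m. cmod (\<Sum>k\<in>K. (T k m + U k m) * b k)) F
        \<le> L2_set (\<lambda>m. cmod (\<Sum>k\<in>K. T k m * b k)) F + L2_set (\<lambda>m. cmod (\<Sum>k\<in>K. U k m * b k)) F"
      by (simp add: distrib_right sum.distrib L2_set_cmod_add)
    also have "\<dots> \<le> (G + H) * sqrt (\<Sum>k\<in>K. sob_term s b k)"
      unfolding distrib_right by (intro add_mono op_boundD GH K)
    finally show "L2_set (\<lambda>m. cmod (\<Sum>k\<in>K. (T k m + U k m) * b k)) F \<le> \<dots>" .
  qed
  then show ?thesis by (auto simp: bounded_op_def)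
qed

lemma bounded_op_sum: "(\<And>i. i \<in> I \<Longrightarrow> bounded_op s (T i)) \<Longrightarrow> bounded_op s (\<lambda>k m. \<Sum>i\<in>I. T i k m)"
  by (induction I rule: infinite_finite_induct) (auto simp: bounded_op_zero bounded_op_add)

text \<open>Differential operators are sums of multiplications preceded by a Fourier multiplier. The
  multiplier \<open>w\<close> is moved onto the input \<open>b\<close>, where its growth is absorbed
  by the weight of order \<open>s\<close>.\<close>

lemma bounded_op_weight:
  assumes T: "bounded_op 0 T" and w: "\<And>k. k \<noteq> 0 \<Longrightarrow> cmod (w k) \<le> C * norm (kvec k) powr s" and C: "0 \<le> C"
  shows "bounded_op s (\<lambda>k m. w k * T k m)"
proof -
  obtain G where G: "op_bound 0 G T" using T by (auto simp: bounded_op_def)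
  have G0: "0 \<le> G" using G by (simp add: op_bound_def)
  have "op_bound s (G * C) (\<lambda>k m. w k * T k m)"
    unfolding op_bound_def
  proof (intro conjI allI impI)
    show "0 \<le> G * C" using G0 C by simp
    fix K F :: "(int ^ 'a) set" and b assume K: "finite K" "K \<subseteq> - {0}" "finite F"
    have "L2_set (\<lambda>m. cmod (\<Sum>k\<in>K. w k * T k m * b k)) F = L2_set (\<lambda>m. cmod (\<Sum>k\<in>K. T k m * (w k * b k))) F"
      by (simp add: mult_ac)
    also have "\<dots> \<le> G * sqrt (\<Sum>k\<in>K. norm (kvec k) powr (2 * 0) * (cmod (w k * b k))\<^sup>2)"
      by (intro op_boundD G K)
    also have "\<dots> \<le> G * sqrt (\<Sum>k\<in>K. C\<^sup>2 * (sob_term s b k))"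
    proof (intro mult_left_mono real_sqrt_le_mono sum_mono G0)
      fix k assume "k \<in> K"
      then have k: "k \<noteq> 0" using K by auto
      have "(cmod (w k * b k))\<^sup>2 \<le> (C * norm (kvec k) powr s * cmod (b k))\<^sup>2"
        unfolding norm_mult using w[OF k] by (intro power_mono mult_right_mono) auto
      then show "norm (kvec k) powr (2 * 0) * (cmod (w k * b k))\<^sup>2
          \<le> C\<^sup>2 * (sob_term s b k)"
        using k by (simp add: power_mult_distrib power2_eq_square[of "_ powr _"] flip: powr_add)
    qed
    also have "\<dots> = G * C * sqrt (\<Sum>k\<in>K. sob_term s b k)"
      using C by (simp add: real_sqrt_mult flip: sum_distrib_left)
    finally show "L2_set (\<lambda>m. cmod (\<Sum>k\<in>K. w k * T k m * b k)) F \<le> \<dots>" .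
  qed
  then show ?thesis by (auto simp: bounded_op_def)
qed

lemma bounded_op_cmult:
  assumes T: "bounded_op s T"
  shows "bounded_op s (\<lambda>k m. c * T k m)"
proof -
  obtain G where G: "op_bound s G T" using T by (auto simp: bounded_op_def)
  have "op_bound s (cmod c * G) (\<lambda>k m. c * T k m)"
    unfolding op_bound_def
  proof (intro conjI allI impI)
    show "0 \<le> cmod c * G" using G by (simp add: op_bound_def)
    fix K F :: "(int ^ 'a) set" and b assume K: "finite K" "K \<subseteq> - {0}" "finite F"
    have "L2_set (\<lambda>m. cmod (\<Sum>k\<in>K. c * T k m * b k)) F = cmod c * L2_set (\<lambda>m. cmod (\<Sum>k\<in>K. T k m * b k)) F"
      by (simp add: mult.assoc norm_mult L2_set_right_distrib flip: sum_distrib_left)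
    also have "\<dots> \<le> cmod c * (G * sqrt (\<Sum>k\<in>K. sob_term s b k))"
      by (intro mult_left_mono op_boundD G K) simp
    finally show "L2_set (\<lambda>m. cmod (\<Sum>k\<in>K. c * T k m * b k)) F
      \<le> cmod c * G * sqrt (\<Sum>k\<in>K. sob_term s b k)" by (simp add: mult.assoc)
  qed
  then show ?thesis by (auto simp: bounded_op_def)
qed

lemma bounded_op_multiplication:
  fixes g :: "real ^ 'n::finite \<Rightarrow> complex"
  assumes g: "continuous_on UNIV g"
  shows "bounded_op 0 (\<lambda>k m. fourier (\<lambda>x. g x * e_basis k x) m)"
proof -
  have "compact (g ` cube)"
    by (intro compact_continuous_image continuous_on_subset[OF g]) auto
  then obtain G where G: "\<And>x. x \<in> cube \<Longrightarrow> cmod (g x) \<le> G"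
    using compact_imp_bounded bounded_iff by (metis imageI)
  have "cmod (g 0) \<le> G" using G[of 0] by (simp add: mem_cube)
  then have G0: "0 \<le> G" using norm_ge_zero[of "g 0"] by linarith
  have "op_bound 0 G (\<lambda>k m. fourier (\<lambda>x. g x * e_basis k x) m)"
    unfolding op_bound_def
  proof (intro conjI allI impI G0)
    fix K F :: "(int ^ 'n) set" and b assume K: "finite K" "K \<subseteq> - {0}" "finite F"
    have "(\<Sum>k\<in>K. fourier (\<lambda>x. g x * e_basis k x) m * b k) = fourier (\<lambda>x. g x * (\<Sum>k\<in>K. b k * e_basis k x)) m" for m
    proof -
      have "fourier (\<lambda>x. g x * (\<Sum>k\<in>K. b k * e_basis k x)) m = fourier (\<lambda>x. \<Sum>k\<in>K. b k * (g x * e_basis k x)) m"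
        by (simp add: sum_distrib_left mult_ac)
      also have "\<dots> = (\<Sum>k\<in>K. b k * fourier (\<lambda>x. g x * e_basis k x) m)"
        by (subst fourier_sum) (auto intro!: continuous_intros g simp: fourier_cmult)
      finally show ?thesis by (simp add: mult.commute)
    qed
    then have "L2_set (\<lambda>m. cmod (\<Sum>k\<in>K. fourier (\<lambda>x. g x * e_basis k x) m * b k)) F
        \<le> sqrt (G\<^sup>2 * (\<Sum>k\<in>K. (cmod (b k))\<^sup>2))"
      unfolding L2_set_def by (simp add: real_sqrt_le_mono multiplication_bound[OF g G K(1,3)])
    also have "(\<Sum>k\<in>K. (cmod (b k))\<^sup>2) = (\<Sum>k\<in>K. sob_term 0 b k)"
      using K by (intro sum.cong) (auto simp: weight_0)
    finally show "L2_set (\<lambda>m. cmod (\<Sum>k\<in>K. fourier (\<lambda>x. g x * e_basis k x) m * b k)) F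
        \<le> G * sqrt (\<Sum>k\<in>K. sob_term 0 b k)"
      using G0 by (simp add: real_sqrt_mult)
  qed
  then show ?thesis by (auto simp: bounded_op_def)
qed

section \<open>Matrices applied to sequences, and their sesquilinear forms\<close>

definition appl :: "(int ^ 'n::finite \<Rightarrow> int ^ 'n \<Rightarrow> complex) \<Rightarrow> 'n distr \<Rightarrow> 'n distr" where
  "appl T f k = (\<Sum>\<^sub>\<infinity>m\<in>- {0}. T m k * f m)"

definition tail :: "nat \<Rightarrow> 'n::finite distr \<Rightarrow> 'n distr" where
  "tail N f k = (if k \<in> modes N then 0 else f k)"

text \<open>Diffusion matrices satisfy this with \<sigma> = 1, transport matrices with \<sigma> =
  -1; one definition serves all convergence arguments.\<close>

definition hermitian_upto :: "complex \<Rightarrow> (int ^ 'n::finite \<Rightarrow> int ^ 'n \<Rightarrow> complex) \<Rightarrow> bool" where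
  "hermitian_upto \<sigma> T \<longleftrightarrow> (\<forall>k m. T m k = \<sigma> * cnj (T k m))"

lemma hermitian_uptoD: "hermitian_upto \<sigma> T \<Longrightarrow> T m k = \<sigma> * cnj (T k m)"
  unfolding hermitian_upto_def by blast

lemma row_summable:
  assumes "bounded_op s T" "k \<noteq> 0"
  shows "(\<lambda>m. (cmod (T k m))\<^sup>2) summable_on - {0}"
proof -
  obtain G where G: "op_bound s G T" using assms by (auto simp: bounded_op_def)
  let ?B = "G * sqrt (\<Sum>k\<in>{k}. norm (kvec k) powr (2 * s) * (cmod 1)\<^sup>2)"
  have "(\<Sum>m\<in>modes N. (cmod (T k m))\<^sup>2) \<le> ?B\<^sup>2" for N
  proof -
    have "L2_set (\<lambda>m. cmod (T k m)) (modes N) \<le> ?B"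
      using op_boundD[OF G, of "{k}" "modes N" "\<lambda>_. 1"] assms(2) by simp
    then have "(L2_set (\<lambda>m. cmod (T k m)) (modes N))\<^sup>2 \<le> ?B\<^sup>2" by (intro power_mono) (auto simp: L2_set_nonneg)
    then show ?thesis by (simp add: L2_set_def sum_nonneg)
  qed
  then show ?thesis by (intro summable_on_modesI) auto
qed

text \<open>Boundedness controls the image of a single mode, that is \<open>T k m\<close> as
  \<open>m\<close> varies. The symmetry up to \<sigma> converts this into square summability in the
  other index, which \<open>appl\<close> sums over.\<close>

lemma appl_summable:
  assumes T: "bounded_op s T" "hermitian_upto \<sigma> T" and f: "f \<in> Hsp 0" and k: "k \<noteq> 0"
  shows "(\<lambda>m. T m k * f m) summable_on - {0}"
proof -
  have "(\<lambda>m. cnj (T k m) * f m) summable_on - {0}"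
    by (intro cnj_mult_summable row_summable[OF T(1) k] Hsp_0D(3)[OF f])
  then have "(\<lambda>m. \<sigma> * (cnj (T k m) * f m)) summable_on - {0}" by (rule summable_on_cmult_right)
  moreover have "(\<lambda>m. T m k * f m) = (\<lambda>m. \<sigma> * (cnj (T k m) * f m))"
    by (rule ext) (simp only: hermitian_uptoD[OF T(2), where k = k] mult.assoc)
  ultimately show ?thesis by simp
qed

lemma tail_Hsp:
  assumes "f \<in> Hsp s" shows "tail N f \<in> Hsp s"
proof -
  obtain C m where C: "\<forall>k. cmod (f k) \<le> C * (1 + norm (kvec k)) ^ m"
    using assms by (auto simp: Hsp_def distribution_def)
  then have "\<forall>k. cmod (tail N f k) \<le> C * (1 + norm (kvec k)) ^ m"
    by (auto simp: tail_def intro: order_trans[OF norm_ge_zero])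
  moreover have "(\<lambda>k. sob_term s (tail N f) k) summable_on - {0}"
    by (rule summable_on_comparison_test[OF Hsp_summable[OF assms]]) (auto simp: tail_def)
  moreover have "tail N f 0 = 0" "\<forall>k. tail N f (- k) = cnj (tail N f k)"
    using assms by (auto simp: tail_def Hsp_def distribution_def)
  ultimately show ?thesis unfolding Hsp_def distribution_def by blast
qed

lemma Hnorm_tail_le:
  assumes "f \<in> Hsp s" shows "Hnorm s (tail N f) \<le> Hnorm s f"
  unfolding Hnorm_def
  by (intro real_sqrt_le_mono infsum_mono Hsp_summable assms tail_Hsp) (auto simp: tail_def)

lemma Hnorm_tail_tendsto:
  assumes "f \<in> Hsp s" shows "(\<lambda>N. Hnorm s (tail N f)) \<longlonglongrightarrow> 0"
proof -
  let ?a = "\<lambda>k. sob_term s f k"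
  have s: "?a summable_on - {0}" by (rule Hsp_summable[OF assms])
  have "(\<Sum>\<^sub>\<infinity>k\<in>- {0}. sob_term s (tail N f) k) = infsum ?a (- {0}) - sum ?a (modes N)" for N
  proof -
    have "infsum ?a (- {0} - modes N) = infsum ?a (- {0}) - infsum ?a (modes N)"
      by (intro infsum_Diff s) (auto simp: modes_subset)
    moreover have "infsum ?a (- {0} - modes N) = (\<Sum>\<^sub>\<infinity>k\<in>- {0}. sob_term s (tail N f) k)"
      by (rule infsum_cong_neutral) (auto simp: tail_def)
    ultimately show ?thesis by simp
  qed
  moreover have "(\<lambda>N. sqrt (infsum ?a (- {0}) - sum ?a (modes N))) \<longlonglongrightarrow> sqrt (infsum ?a (- {0}) - infsum ?a (- {0}))"
    by (intro tendsto_intros sum_modes_tendsto s)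
  ultimately show ?thesis by (simp add: Hnorm_def)
qed

text \<open>The output set \<open>F\<close> stays fixed while the input truncation grows, so only
  finitely many limits are taken at a time.\<close>

lemma appl_bound:
  assumes T: "op_bound s G T" "hermitian_upto \<sigma> T" and s: "0 \<le> s" and f: "f \<in> Hsp s"
    and F: "finite F" "F \<subseteq> - {0}"
  shows "L2_set (\<lambda>k. cmod (appl T f k)) F \<le> G * Hnorm s f"
proof (rule LIMSEQ_le_const2)
  have f0: "f \<in> Hsp 0" using Hsp_mono[OF s f] .
  have Tb: "bounded_op s T" using T by (auto simp: bounded_op_def)
  have lim: "(\<lambda>N. cmod (\<Sum>m\<in>modes N. T m k * f m)) \<longlonglongrightarrow> cmod (appl T f k)" if "k \<in> F" for k
    unfolding appl_def using F that by (intro tendsto_norm sum_modes_tendsto appl_summable[OF Tb T(2) f0]) auto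
  show "(\<lambda>N. L2_set (\<lambda>k. cmod (\<Sum>m\<in>modes N. T m k * f m)) F) \<longlonglongrightarrow> L2_set (\<lambda>k. cmod (appl T f k)) F"
    unfolding L2_set_def by (intro tendsto_real_sqrt tendsto_sum tendsto_power) (rule lim)
  have "L2_set (\<lambda>k. cmod (\<Sum>m\<in>modes N. T m k * f m)) F \<le> G * Hnorm s f" for N
    using op_boundD[OF T(1) finite_modes[of N] modes_subset F(1), of f] mult_left_mono[OF Hnorm_modes_le[OF f], of G N] T(1)
    by (auto simp: op_bound_def)
  then show "\<exists>N. \<forall>n\<ge>N. L2_set (\<lambda>k. cmod (\<Sum>m\<in>modes n. T m k * f m)) F \<le> G * Hnorm s f" by blast
qed

lemma appl_square_summable:
  assumes T: "op_bound s G T" "hermitian_upto \<sigma> T" and s: "0 \<le> s" and f: "f \<in> Hsp s"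
  shows "(\<lambda>k. (cmod (appl T f k))\<^sup>2) summable_on - {0}" "Hnorm 0 (appl T f) \<le> G * Hnorm s f"
proof -
  have *: "(\<Sum>k\<in>modes N. (cmod (appl T f k))\<^sup>2) \<le> (G * Hnorm s f)\<^sup>2" for N
  proof -
    have "(L2_set (\<lambda>k. cmod (appl T f k)) (modes N))\<^sup>2 \<le> (G * Hnorm s f)\<^sup>2"
      by (intro power_mono appl_bound[OF T s f]) (auto simp: L2_set_nonneg modes_subset)
    then show ?thesis by (simp add: L2_set_def sum_nonneg)
  qed
  then show "(\<lambda>k. (cmod (appl T f k))\<^sup>2) summable_on - {0}" by (intro summable_on_modesI) auto
  have "(Hnorm 0 (appl T f))\<^sup>2 \<le> (G * Hnorm s f)\<^sup>2"
    using summable_on_modesI(2)[OF *] by (simp add: Hnorm_0 infsum_nonneg)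
  then show "Hnorm 0 (appl T f) \<le> G * Hnorm s f"
    by (rule power2_le_imp_le) (use T in \<open>auto simp: op_bound_def\<close>)
qed

lemma appl_split:
  assumes T: "bounded_op s T" "hermitian_upto \<sigma> T" and f: "f \<in> Hsp 0" and k: "k \<noteq> 0"
  shows "appl T f k = (\<Sum>m\<in>modes N. T m k * f m) + appl T (tail N f) k"
proof -
  let ?g = "\<lambda>m. T m k * f m"
  have s: "?g summable_on - {0}" by (rule appl_summable[OF T f k])
  have "infsum ?g (- {0} - modes N) = infsum ?g (- {0}) - infsum ?g (modes N)"
    by (intro infsum_Diff s) (auto simp: modes_subset)
  moreover have "infsum ?g (- {0} - modes N) = (\<Sum>\<^sub>\<infinity>m\<in>- {0}. T m k * tail N f m)"
    by (rule infsum_cong_neutral) (auto simp: tail_def)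
  ultimately show ?thesis by (simp add: appl_def)
qed

text \<open>On the first modes the two expressions differ by \<open>appl T (tail N f)\<close> alone.
  All \<open>s\<close> derivatives fall on the tail of \<open>f\<close>, and \<open>g\<close> is
  measured only in \<open>L2\<close>.\<close>

lemma form_error:
  assumes T: "op_bound s G T" "hermitian_upto \<sigma> T" and s: "0 \<le> s" and f: "f \<in> Hsp s" and g: "g \<in> Hsp 0"
  shows "cmod ((\<Sum>k\<in>modes N. cnj (g k) * appl T f k) - (\<Sum>k\<in>modes N. \<Sum>m\<in>modes N. cnj (g k) * (T m k * f m)))
    \<le> G * Hnorm s (tail N f) * Hnorm 0 g"
proof -
  have f0: "f \<in> Hsp 0" using Hsp_mono[OF s f] .
  have Tb: "bounded_op s T" using T by (auto simp: bounded_op_def)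
  have G0: "0 \<le> G" using T by (auto simp: op_bound_def)
  have "(\<Sum>k\<in>modes N. cnj (g k) * appl T f k) - (\<Sum>k\<in>modes N. \<Sum>m\<in>modes N. cnj (g k) * (T m k * f m))
      = (\<Sum>k\<in>modes N. cnj (g k) * appl T (tail N f) k)"
    unfolding sum_subtractf[symmetric] sum_distrib_left[symmetric]
  proof (rule sum.cong[OF refl])
    fix k :: "(int, 'a) vec" assume "k \<in> modes N"
    then have "k \<noteq> 0" by (auto simp: modes_def)
    from appl_split[OF Tb T(2) f0 this, of N]
    show "cnj (g k) * appl T f k - cnj (g k) * (\<Sum>m\<in>modes N. T m k * f m) = cnj (g k) * appl T (tail N f) k"
      by (simp add: distrib_left)
  qed
  also have "cmod \<dots> \<le> (\<Sum>k\<in>modes N. \<bar>cmod (g k)\<bar> * \<bar>cmod (appl T (tail N f) k)\<bar>)"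
    by (intro order_trans[OF norm_sum] sum_mono) (simp add: norm_mult)
  also have "\<dots> \<le> L2_set (\<lambda>k. cmod (g k)) (modes N) * L2_set (\<lambda>k. cmod (appl T (tail N f) k)) (modes N)"
    by (rule L2_set_mult_ineq)
  also have "\<dots> \<le> Hnorm 0 g * (G * Hnorm s (tail N f))"
  proof (intro mult_mono appl_bound[OF T s tail_Hsp[OF f]])
    have "(\<Sum>k\<in>modes N. (cmod (g k))\<^sup>2) \<le> (\<Sum>\<^sub>\<infinity>k\<in>- {0}. (cmod (g k))\<^sup>2)"
      by (intro finite_sum_le_infsum Hsp_0D(3) g modes_subset) auto
    then show "L2_set (\<lambda>k. cmod (g k)) (modes N) \<le> Hnorm 0 g"
      by (simp add: L2_set_def Hnorm_0)
  qed (auto simp: modes_subset L2_set_nonneg)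
  finally show ?thesis by (simp add: mult_ac)
qed

text \<open>Symmetry and sign of a quadratic form can therefore be verified on finite double sums,
  where summations may be exchanged freely.\<close>

lemma form_tendsto:
  assumes T: "bounded_op s T" "hermitian_upto \<sigma> T" and s: "0 \<le> s" and f: "f \<in> Hsp s" and g: "g \<in> Hsp 0"
  shows "(\<lambda>N. \<Sum>k\<in>modes N. \<Sum>m\<in>modes N. cnj (g k) * (T m k * f m)) \<longlonglongrightarrow> (\<Sum>\<^sub>\<infinity>k\<in>- {0}. cnj (g k) * appl T f k)"
proof -
  obtain G where G: "op_bound s G T" using T by (auto simp: bounded_op_def)
  let ?S = "\<lambda>N. \<Sum>k\<in>modes N. cnj (g k) * appl T f k"
  let ?D = "\<lambda>N. \<Sum>k\<in>modes N. \<Sum>m\<in>modes N. cnj (g k) * (T m k * f m)"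
  have S: "?S \<longlonglongrightarrow> (\<Sum>\<^sub>\<infinity>k\<in>- {0}. cnj (g k) * appl T f k)"
    by (intro sum_modes_tendsto cnj_mult_summable Hsp_0D(3) g appl_square_summable(1)[OF G T(2) s f])
  have "(\<lambda>N. G * Hnorm s (tail N f) * Hnorm 0 g) \<longlonglongrightarrow> 0"
    using tendsto_mult[OF tendsto_mult[OF tendsto_const Hnorm_tail_tendsto[OF f]] tendsto_const, of G "Hnorm 0 g"] by simp
  then have "(\<lambda>N. ?S N - ?D N) \<longlonglongrightarrow> 0"
    by (rule Lim_null_comparison[rotated]) (intro always_eventually allI form_error[OF G T(2) s f g])
  from tendsto_diff[OF S this] show ?thesis by simp
qed

lemma appl_minus:
  assumes "\<And>k m. T (- k) (- m) = cnj (T k m)" "\<And>k. f (- k) = cnj (f k)"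
  shows "appl T f (- k) = cnj (appl T f k)"
proof -
  have T': "T a (- k) = cnj (T (- a) k)" for a using assms(1)[of "- a" k] by simp
  have "appl T f (- k) = (\<Sum>\<^sub>\<infinity>m\<in>- {0}. cnj (T m k * f m))"
    unfolding appl_def
    by (rule infsum_reindex_bij_witness[of _ uminus uminus]) (auto simp: T' assms(2))
  then show ?thesis by (simp only: appl_def infsum_cnj)
qed

section \<open>The matrices of the transport and diffusion operators\<close>

definition adv_mat :: "(real ^ 'n \<Rightarrow> real ^ 'n) \<Rightarrow> int ^ 'n::finite \<Rightarrow> int ^ 'n \<Rightarrow> complex" where
  "adv_mat v k m = fourier (adv v (e_basis k)) m"

lemma continuous_adv_e_basis:
  assumes "continuous_on UNIV v" shows "continuous_on UNIV (adv v (e_basis k))"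
proof -
  have "adv v (e_basis k) = (\<lambda>x. \<i> * of_real (v x \<bullet> kvec k) * e_basis k x)" by (rule ext) (rule adv_e_basis)
  then show ?thesis by (simp only:) (intro continuous_intros assms)
qed

lemma inner_kvec: "v \<bullet> kvec k = (\<Sum>a\<in>UNIV. v $ a * of_int (k $ a))"
  by (simp add: inner_vec_def)

lemma bounded_op_adv:
  assumes v: "continuous_on UNIV v"
  shows "bounded_op 1 (adv_mat v)"
proof -
  have cv: "continuous_on UNIV (\<lambda>x. complex_of_real (v x $ a))" for a
    by (intro continuous_intros continuous_on_of_real continuous_on_component v)
  have "adv_mat v = (\<lambda>k m. \<Sum>a\<in>UNIV. (\<i> * of_int (k $ a)) * fourier (\<lambda>x. of_real (v x $ a) * e_basis k x) m)"
  proof (intro ext)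
    fix k m
    have "adv v (e_basis k) = (\<lambda>x. \<Sum>a\<in>UNIV. (\<i> * of_int (k $ a)) * (of_real (v x $ a) * e_basis k x))"
      by (rule ext) (simp add: adv_e_basis inner_kvec sum_distrib_left sum_distrib_right mult_ac)
    then show "adv_mat v k m = (\<Sum>a\<in>UNIV. (\<i> * of_int (k $ a)) * fourier (\<lambda>x. of_real (v x $ a) * e_basis k x) m)"
      unfolding adv_mat_def
      by (simp only:) (subst fourier_sum, auto intro!: continuous_intros cv simp: fourier_cmult)
  qed
  moreover have "bounded_op 1 (\<lambda>k m. \<Sum>a\<in>UNIV. (\<i> * of_int (k $ a)) * fourier (\<lambda>x. of_real (v x $ a) * e_basis k x) m)"
    by (intro bounded_op_sum bounded_op_weight[where C = 1] bounded_op_multiplication cv)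
      (auto simp: norm_mult abs_nth_le_norm_kvec)
  ultimately show ?thesis by simp
qed

text \<open>The derivative of the product \<open>f * cnj g\<close> along \<open>v\<close> has zero
  mean; the product rule then gives the identity.\<close>

lemma cint_adv_by_parts:
  assumes v: "solenoidal v" and f: "C1 f" "periodic f" and g: "C1 g" "periodic g"
    and cf: "continuous_on UNIV (adv v f)" and cg: "continuous_on UNIV (adv v g)"
  shows "cint (\<lambda>x. adv v f x * cnj (g x)) = - cint (\<lambda>x. f x * cnj (adv v g x))"
proof -
  have "cint (adv v (\<lambda>x. f x * cnj (g x))) = 0"
    using f(2) g(2) by (intro cint_adv_eq_0 v C1_mult(1) C1_cnj(1) f g) (simp add: periodic_def)
  moreover have "adv v (\<lambda>x. f x * cnj (g x)) = (\<lambda>x. f x * cnj (adv v g x) + adv v f x * cnj (g x))"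
    by (rule ext) (simp add: C1_mult(3)[OF f(1) C1_cnj(1)[OF g(1)]] C1_cnj(2)[OF g(1)])
  ultimately have "cint (\<lambda>x. f x * cnj (adv v g x)) + cint (\<lambda>x. adv v f x * cnj (g x)) = 0"
    using C1_continuous[OF f(1)] C1_continuous[OF g(1)] cf cg
    by (subst cint_add[symmetric]) (auto intro!: continuous_on_mult continuous_on_cnj)
  then show ?thesis by (simp add: add_eq_0_iff2)
qed

lemma adv_mat_antihermitian:
  assumes v: "solenoidal v"
  shows "hermitian_upto (- 1) (adv_mat v)"
proof -
  note c = continuous_adv_e_basis[OF solenoidal_continuous[OF v]]
  have "adv_mat v m k = - cnj (adv_mat v k m)" for k m
  proof -
    have "adv_mat v m k = - cint (\<lambda>x. e_basis m x * cnj (adv v (e_basis k) x))"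
      unfolding adv_mat_def fourier_eq_cint by (intro cint_adv_by_parts v c) auto
    also have "cint (\<lambda>x. e_basis m x * cnj (adv v (e_basis k) x)) = cnj (adv_mat v k m)"
      unfolding adv_mat_def fourier_eq_cint
      by (subst cint_cnj[symmetric]) (auto intro!: continuous_intros c simp: mult.commute)
    finally show ?thesis .
  qed
  then show ?thesis unfolding hermitian_upto_def mult_minus1 by blast
qed

section \<open>Second-order transport operators and the matrix of \<open>A\<close>\<close>

definition adv2_mat :: "(real ^ 'n \<Rightarrow> real ^ 'n) \<Rightarrow> int ^ 'n::finite \<Rightarrow> int ^ 'n \<Rightarrow> complex" where
  "adv2_mat v k m = fourier (adv v (adv v (e_basis k))) m"

definition L_mat :: "'j set \<Rightarrow> ('j \<Rightarrow> real ^ 'n \<Rightarrow> real ^ 'n) \<Rightarrow> int ^ 'n::finite \<Rightarrow> int ^ 'n \<Rightarrow> complex" where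
  "L_mat J u k m = (1 / 2) * (\<Sum>j\<in>J. adv2_mat (u j) k m)"

definition A_mat :: "real \<Rightarrow> 'j set \<Rightarrow> ('j \<Rightarrow> real ^ 'n \<Rightarrow> real ^ 'n) \<Rightarrow> int ^ 'n::finite \<Rightarrow> int ^ 'n \<Rightarrow> complex" where
  "A_mat \<kappa> J u k m = L_mat J u k m + (if k = m then - of_real (\<kappa> * (norm (kvec k))\<^sup>2) else 0)"

lemma solenoidal_C1:
  assumes v: "solenoidal v" and L: "bounded_linear L"
  shows "C1 (\<lambda>x. L (v x))" "adv w (\<lambda>x. L (v x)) x = L (adv w v x)"
  using v C1_bounded_linear(1,3)[OF L] by (auto simp: solenoidal_def)

lemma bounded_linear_symbol: "bounded_linear (\<lambda>y. \<i> * complex_of_real (y \<bullet> w))"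
  by (intro bounded_linear_compose[OF bounded_linear_mult_right]
      bounded_linear_compose[OF bounded_linear_of_real] bounded_linear_inner_left)

lemma continuous_adv_self:
  assumes v: "solenoidal v" shows "continuous_on UNIV (adv v v)"
proof -
  have "adv v v = (\<lambda>x. \<Sum>i\<in>UNIV. v x $ i *\<^sub>R partial i v x)"
    using v by (auto simp: solenoidal_def adv_eq_sum_partial)
  then show ?thesis
    using v solenoidal_continuous[OF v] unfolding solenoidal_def
    by (simp only:) (intro continuous_intros continuous_on_component, auto)
qed

lemma adv_e_basis_fun: "adv v (e_basis k) = (\<lambda>x. \<i> * of_real (v x \<bullet> kvec k) * e_basis k x)"
  by (rule ext) (rule adv_e_basis)

lemma C1_adv_e_basis:
  assumes v: "solenoidal v" shows "C1 (adv v (e_basis k))" "periodic (adv v (e_basis k))"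
proof -
  show "C1 (adv v (e_basis k))" unfolding adv_e_basis_fun
    by (intro C1_mult(1) solenoidal_C1(1)[OF v bounded_linear_symbol]) simp
  show "periodic (adv v (e_basis k))"
    using v periodic_e_basis[of k] by (simp add: adv_e_basis_fun periodic_def solenoidal_def)
qed

text \<open>The second derivative along \<open>v\<close> falls either on the exponential, giving the
  square of the symbol, or on the symbol itself, giving the first-order term with
  \<open>adv v v\<close>.\<close>

lemma adv2_e_basis:
  assumes v: "solenoidal v"
  shows "adv v (adv v (e_basis k)) x
    = (\<i> * of_real (adv v v x \<bullet> kvec k) - of_real ((v x \<bullet> kvec k)\<^sup>2)) * e_basis k x"
proof -
  have "adv v (adv v (e_basis k)) x = adv v (\<lambda>x. (\<i> * of_real (v x \<bullet> kvec k)) * e_basis k x) x"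
    by (simp add: adv_e_basis_fun)
  also have "\<dots> = \<i> * of_real (v x \<bullet> kvec k) * adv v (e_basis k) x + \<i> * of_real (adv v v x \<bullet> kvec k) * e_basis k x"
    by (subst C1_mult(3)[OF solenoidal_C1(1)[OF v bounded_linear_symbol] C1_e_basis])
      (simp only: solenoidal_C1(2)[OF v bounded_linear_symbol])
  finally show ?thesis by (simp add: adv_e_basis power2_eq_square algebra_simps)
qed

lemma continuous_adv2_e_basis:
  assumes v: "solenoidal v" shows "continuous_on UNIV (adv v (adv v (e_basis k)))"
proof -
  have "adv v (adv v (e_basis k)) = (\<lambda>x. (\<i> * of_real (adv v v x \<bullet> kvec k) - of_real ((v x \<bullet> kvec k)\<^sup>2)) * e_basis k x)"
    by (rule ext) (rule adv2_e_basis[OF v])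
  then show ?thesis
    by (simp only:) (intro continuous_intros continuous_adv_self[OF v] solenoidal_continuous[OF v])
qed

lemma norm_kvec_le_square: "k \<noteq> 0 \<Longrightarrow> norm (kvec (k :: int ^ 'n::finite)) \<le> norm (kvec k) powr 2"
  using norm_kvec_ge_1[of k] by (simp add: powr_numeral power2_eq_square)

text \<open>Expanded in components, the operator is a sum of multiplications with weights linear and
  quadratic in \<open>k\<close>. As nonzero frequencies have norm at least 1, the linear weights are
  dominated by the quadratic order too.\<close>

lemma bounded_op_adv2:
  assumes v: "solenoidal v"
  shows "bounded_op 2 (adv2_mat v)"
proof -
  note cv = solenoidal_continuous[OF v] and cq = continuous_adv_self[OF v]
  have c1: "continuous_on UNIV (\<lambda>x. complex_of_real (adv v v x $ a))" for a
    by (intro continuous_on_of_real continuous_on_component cq)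
  have c2: "continuous_on UNIV (\<lambda>x. complex_of_real (v x $ a * v x $ c))" for a c
    by (intro continuous_on_of_real continuous_on_mult continuous_on_component cv)
  let ?M = "\<lambda>g k m. fourier (\<lambda>x. g x * e_basis k x) m"
  have eq: "adv v (adv v (e_basis k)) = (\<lambda>x. (\<Sum>a\<in>UNIV. (\<i> * of_int (k $ a)) * (of_real (adv v v x $ a) * e_basis k x))
      + (\<Sum>a\<in>UNIV. \<Sum>c\<in>UNIV. (- of_int (k $ a * k $ c)) * (of_real (v x $ a * v x $ c) * e_basis k x)))" (is "_ = (\<lambda>x. ?f x + ?g x)") for k
  proof (rule ext)
    fix x
    have "(\<i> * of_real (adv v v x \<bullet> kvec k)) * e_basis k x = ?f x"
      by (simp add: inner_kvec sum_distrib_left sum_distrib_right mult_ac)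
    moreover have "- of_real ((v x \<bullet> kvec k)\<^sup>2) * e_basis k x = ?g x"
    proof -
      have "(v x \<bullet> kvec k)\<^sup>2 = (\<Sum>a\<in>UNIV. \<Sum>c\<in>UNIV. of_int (k $ a * k $ c) * (v x $ a * v x $ c))"
        unfolding power2_eq_square inner_kvec sum_product by (intro sum.cong) auto
      then show ?thesis by (simp add: sum_distrib_left sum_distrib_right sum_negf mult_ac)
    qed
    ultimately show "adv v (adv v (e_basis k)) x = ?f x + ?g x"
      unfolding adv2_e_basis[OF v] by (simp add: left_diff_distrib)
  qed
  have "adv2_mat v = (\<lambda>k m. (\<Sum>a\<in>UNIV. (\<i> * of_int (k $ a)) * ?M (\<lambda>x. of_real (adv v v x $ a)) k m)
      + (\<Sum>a\<in>UNIV. \<Sum>c\<in>UNIV. (- of_int (k $ a * k $ c)) * ?M (\<lambda>x. of_real (v x $ a * v x $ c)) k m))"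
    unfolding adv2_mat_def eq
    by (intro ext, subst fourier_add, (intro continuous_intros c1 c2)+, subst fourier_sum, (intro continuous_intros c1 c2)+,
        subst fourier_sum, (intro continuous_intros c1 c2)+, subst fourier_sum, (intro continuous_intros c1 c2)+)
       (simp only: fourier_cmult)
  moreover have "bounded_op 2 \<dots>"
  proof (intro bounded_op_add bounded_op_sum bounded_op_weight[where C = 1] bounded_op_multiplication c1 c2)
    fix a c and k :: "(int, 'a) vec" assume k: "k \<noteq> 0"
    show "cmod (\<i> * of_int (k $ a)) \<le> 1 * norm (kvec k) powr 2"
      using abs_nth_le_norm_kvec[of k a] norm_kvec_le_square[OF k] by (simp add: norm_mult)
    have "\<bar>real_of_int (k $ a)\<bar> * \<bar>real_of_int (k $ c)\<bar> \<le> norm (kvec k) * norm (kvec k)"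
      by (intro mult_mono abs_nth_le_norm_kvec) auto
    then show "cmod (- of_int (k $ a * k $ c)) \<le> 1 * norm (kvec k) powr 2"
      using norm_kvec_ge_1[OF k] by (simp add: norm_mult powr_numeral power2_eq_square)
  qed auto
  ultimately show ?thesis by simp
qed

text \<open>One integration by parts distributes the derivatives evenly; in this form Hermitian
  symmetry and the sign can be read off.\<close>

lemma adv2_mat_eq:
  assumes v: "solenoidal v"
  shows "adv2_mat v k m = - cint (\<lambda>x. adv v (e_basis k) x * cnj (adv v (e_basis m) x))"
  unfolding adv2_mat_def fourier_eq_cint
  by (intro cint_adv_by_parts v C1_adv_e_basis continuous_adv2_e_basis
      continuous_adv_e_basis solenoidal_continuous[OF v]) auto

lemma adv2_mat_hermitian:
  assumes v: "solenoidal v"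
  shows "adv2_mat v m k = cnj (adv2_mat v k m)"
proof -
  note c = continuous_adv_e_basis[OF solenoidal_continuous[OF v]]
  show ?thesis unfolding adv2_mat_eq[OF v] complex_cnj_minus
    by (subst cint_cnj[symmetric]) (auto intro!: continuous_intros c simp: mult.commute)
qed

lemma adv2_mat_minus:
  assumes v: "solenoidal v"
  shows "adv2_mat v (- k) (- m) = cnj (adv2_mat v k m)"
proof -
  have "adv v (adv v (e_basis (- k))) = (\<lambda>x. cnj (adv v (adv v (e_basis k)) x))"
    by (rule ext) (simp add: adv2_e_basis[OF v] cnj_e_basis)
  then show ?thesis
    unfolding adv2_mat_def using fourier_cnj[OF continuous_adv2_e_basis[OF v]] by simp
qed

text \<open>The form is minus the integral of the squared modulus of \<open>?w\<close>, the
  derivative along \<open>v\<close> of the trigonometric polynomial with coefficients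
  \<open>f\<close>.\<close>

lemma adv2_form_nonpos:
  assumes v: "solenoidal v" and K: "finite K"
  shows "Re (\<Sum>k\<in>K. \<Sum>m\<in>K. cnj (f k) * (adv2_mat v m k * f m)) \<le> 0"
proof -
  note c = continuous_adv_e_basis[OF solenoidal_continuous[OF v]]
  let ?w = "\<lambda>x. \<Sum>m\<in>K. f m * adv v (e_basis m) x"
  have cw: "continuous_on UNIV ?w" by (intro continuous_intros c)
  have "cint (\<lambda>x. ?w x * cnj (?w x)) = cint (\<lambda>x. \<Sum>k\<in>K. \<Sum>m\<in>K. (cnj (f k) * f m) * (adv v (e_basis m) x * cnj (adv v (e_basis k) x)))"
  proof (intro arg_cong[of _ _ cint] ext)
    fix x
    have "?w x * cnj (?w x) = (\<Sum>m\<in>K. \<Sum>k\<in>K. f m * adv v (e_basis m) x * cnj (f k * adv v (e_basis k) x))"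
      unfolding cnj_sum sum_product ..
    also have "\<dots> = (\<Sum>k\<in>K. \<Sum>m\<in>K. f m * adv v (e_basis m) x * cnj (f k * adv v (e_basis k) x))"
      by (rule sum.swap)
    finally show "?w x * cnj (?w x) = (\<Sum>k\<in>K. \<Sum>m\<in>K. (cnj (f k) * f m) * (adv v (e_basis m) x * cnj (adv v (e_basis k) x)))"
      by (simp add: mult_ac)
  qed
  also have "\<dots> = (\<Sum>k\<in>K. \<Sum>m\<in>K. (cnj (f k) * f m) * cint (\<lambda>x. adv v (e_basis m) x * cnj (adv v (e_basis k) x)))"
    by (subst cint_sum, (intro continuous_intros c)+, subst cint_sum, (intro continuous_intros c)+) (simp only: cint_cmult)
  also have "\<dots> = - (\<Sum>k\<in>K. \<Sum>m\<in>K. cnj (f k) * (adv2_mat v m k * f m))"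
    by (simp add: adv2_mat_eq[OF v] sum_negf mult_ac)
  finally have e: "- (\<Sum>k\<in>K. \<Sum>m\<in>K. cnj (f k) * (adv2_mat v m k * f m)) = of_real (LINT x:cube|lborel. (cmod (?w x))\<^sup>2)"
    unfolding cint_norm_squared[OF cw] by (rule sym)
  have "Re (\<Sum>k\<in>K. \<Sum>m\<in>K. cnj (f k) * (adv2_mat v m k * f m)) = - (LINT x:cube|lborel. (cmod (?w x))\<^sup>2)"
    using arg_cong[OF e, of Re] by (simp only: uminus_complex.sel Re_complex_of_real)
  moreover have "0 \<le> (LINT x:cube|lborel. (cmod (?w x))\<^sup>2)"
    unfolding set_lebesgue_integral_def by (intro Bochner_Integration.integral_nonneg) auto
  ultimately show ?thesis by simp
qed

section \<open>The elliptic operator as a symmetric operator on \<open>L2\<close>\<close>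

locale diffusion =
  fixes \<kappa> :: real and J :: "'j set" and u :: "'j \<Rightarrow> real ^ 'n::finite \<Rightarrow> real ^ 'n"
  assumes kappa: "0 < \<kappa>" and J: "finite J" and u: "j \<in> J \<Longrightarrow> solenoidal (u j)"
begin

lemma bounded_op_A: "bounded_op 2 (A_mat \<kappa> J u)"
proof -
  have "A_mat \<kappa> J u = (\<lambda>k m. (1 / 2) * (\<Sum>j\<in>J. adv2_mat (u j) k m)
      + (- of_real (\<kappa> * (norm (kvec k))\<^sup>2)) * fourier (\<lambda>x. 1 * e_basis k x) m)"
    by (auto simp: A_mat_def L_mat_def fourier_e_basis fun_eq_iff)
  moreover have "bounded_op 2 \<dots>"
    using kappa by (intro bounded_op_add bounded_op_cmult bounded_op_sum bounded_op_adv2 u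
        bounded_op_weight[where C = \<kappa>] bounded_op_multiplication)
      (auto simp: norm_mult norm_power powr_numeral)
  ultimately show ?thesis by simp
qed

lemma A_mat_hermitian: "hermitian_upto 1 (A_mat \<kappa> J u)"
  unfolding hermitian_upto_def
proof (intro allI)
  fix k m
  have "(\<Sum>j\<in>J. adv2_mat (u j) m k) = (\<Sum>j\<in>J. cnj (adv2_mat (u j) k m))"
    by (intro sum.cong adv2_mat_hermitian u) auto
  then show "A_mat \<kappa> J u m k = 1 * cnj (A_mat \<kappa> J u k m)" by (simp add: A_mat_def L_mat_def)
qed

lemma A_mat_minus: "A_mat \<kappa> J u (- k) (- m) = cnj (A_mat \<kappa> J u k m)"
proof -
  have "(\<Sum>j\<in>J. adv2_mat (u j) (- k) (- m)) = (\<Sum>j\<in>J. cnj (adv2_mat (u j) k m))"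
    by (intro sum.cong adv2_mat_minus u) auto
  then show ?thesis by (simp add: A_mat_def L_mat_def)
qed

lemma A_mat_0: "A_mat \<kappa> J u m 0 = 0"
proof -
  have "adv2_mat (u j) m 0 = 0" if "j \<in> J" for j
    unfolding adv2_mat_eq[OF u[OF that]] by (simp add: adv_e_basis)
  then show ?thesis by (simp add: A_mat_def L_mat_def)
qed

lemma fourier_L_smooth: "fourier (L_smooth J u (e_basis k)) m = L_mat J u k m"
proof -
  have "L_smooth J u (e_basis k) = (\<lambda>x. (1 / 2) * (\<Sum>j\<in>J. adv (u j) (adv (u j) (e_basis k)) x))"
    by (auto simp: L_smooth_def scaleR_conv_of_real)
  then have "fourier (L_smooth J u (e_basis k)) m = (1 / 2) * fourier (\<lambda>x. \<Sum>j\<in>J. adv (u j) (adv (u j) (e_basis k)) x) m"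
    by (simp only: fourier_cmult)
  also have "fourier (\<lambda>x. \<Sum>j\<in>J. adv (u j) (adv (u j) (e_basis k)) x) m = (\<Sum>j\<in>J. adv2_mat (u j) k m)"
    by (subst fourier_sum) (auto simp: adv2_mat_def intro: continuous_adv2_e_basis u)
  finally show ?thesis by (simp add: L_mat_def)
qed

lemma laplacian_e_basis: "laplacian (e_basis k) x = - of_real ((norm (kvec k))\<^sup>2) * e_basis k x"
proof -
  have p: "partial i (e_basis k) = (\<lambda>x. (\<i> * of_int (k $ i)) * e_basis k x)" for i and k :: "int ^ 'm::finite"
    by (rule ext) (rule partial_e_basis)
  have "partial i (partial i (e_basis k)) x = - of_real ((of_int (k $ i))\<^sup>2) * e_basis k x" for i
  proof -
    have "((\<lambda>x. (\<i> * of_int (k $ i)) * e_basis k x) has_derivative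
        (\<lambda>h. (\<i> * of_int (k $ i)) * (\<i> * of_real (h \<bullet> kvec k) * e_basis k x))) (at x)"
      by (intro has_derivative_mult_right e_basis_has_derivative)
    from partial_eq[OF this, of i]
    have "partial i (partial i (e_basis k)) x = (\<i> * \<i>) * (of_int (k $ i) * of_int (k $ i) * e_basis k x)"
      unfolding p by (simp add: inner_axis' mult_ac)
    then show ?thesis by (simp add: power2_eq_square)
  qed
  moreover have "(norm (kvec k))\<^sup>2 = (\<Sum>i\<in>UNIV. (of_int (k $ i))\<^sup>2)"
    unfolding power2_norm_eq_inner inner_vec_def by (simp add: power2_eq_square)
  ultimately show ?thesis
    unfolding laplacian_def by (simp add: sum_negf flip: sum_distrib_right)
qed

lemma on_distr_laplacian:
  fixes f :: "'n distr"
  assumes "f 0 = 0"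
  shows "on_distr laplacian f k = - of_real ((norm (kvec k))\<^sup>2) * f k"
proof -
  have "laplacian (e_basis k) = (\<lambda>x. - of_real ((norm (kvec k))\<^sup>2) * e_basis k x)"
    by (rule ext) (rule laplacian_e_basis)
  then have "on_distr laplacian f k = (\<Sum>\<^sub>\<infinity>m\<in>- {0}. cnj (- of_real ((norm (kvec k))\<^sup>2) * (if k = m then 1 else 0)) * f m)"
    by (simp only: on_distr_def pairing_def fourier_cmult fourier_e_basis)
  also have "\<dots> = (\<Sum>\<^sub>\<infinity>m\<in>{k}. - of_real ((norm (kvec k))\<^sup>2) * f m)"
    using assms by (intro infsum_cong_neutral) auto
  finally show ?thesis by simp
qed

text \<open>The operator is defined by duality, so its coefficients involve conjugated matrix
  entries with exchanged indices; Hermitian symmetry removes both changes.\<close>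

lemma A_op_eq_appl:
  assumes f: "f \<in> Hsp 0"
  shows "A_op \<kappa> J u f = appl (A_mat \<kappa> J u) f"
proof
  fix k
  have L: "L_op J u f k = (\<Sum>\<^sub>\<infinity>m\<in>- {0}. L_mat J u m k * f m)"
  proof -
    have "cnj (L_mat J u k m) = L_mat J u m k" for m
    proof -
      have "(\<Sum>j\<in>J. adv2_mat (u j) m k) = (\<Sum>j\<in>J. cnj (adv2_mat (u j) k m))"
        by (intro sum.cong adv2_mat_hermitian u) auto
      then show ?thesis by (simp add: L_mat_def)
    qed
    then show ?thesis by (simp add: L_op_def on_distr_def pairing_def fourier_L_smooth)
  qed
  show "A_op \<kappa> J u f k = appl (A_mat \<kappa> J u) f k"
  proof (cases "k = 0")
    case True
    have "L_mat J u m 0 = 0" for m using A_mat_0[of m] by (auto simp: A_mat_def split: if_splits)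
    then show ?thesis using True Hsp_0D(1)[OF f]
      by (simp add: A_op_def L[unfolded True] appl_def A_mat_0 on_distr_laplacian)
  next
    case False
    let ?d = "\<lambda>m. (if m = k then - of_real (\<kappa> * (norm (kvec m))\<^sup>2) else 0) * f m"
    have d: "(?d has_sum (- of_real (\<kappa> * (norm (kvec k))\<^sup>2) * f k)) (- {0})"
      using has_sum_finite_neutralI[of "{k}" "- {0}" ?d] False by auto
    \<comment> \<open>Summability is known for the full matrix \<open>A_mat\<close>; adding its
      diagonal back isolates \<open>L_mat\<close>, so that the sum may be split.\<close>
    let ?e = "\<lambda>m. (if m = k then of_real (\<kappa> * (norm (kvec m))\<^sup>2) else 0) * f m"
    have "?e summable_on - {0}"
      by (rule has_sum_imp_summable, rule has_sum_finite_neutralI[of "{k}" "- {0}" ?e]) (use False in auto)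
    then have "(\<lambda>m. A_mat \<kappa> J u m k * f m + ?e m) summable_on - {0}"
      by (intro summable_on_add appl_summable[OF bounded_op_A A_mat_hermitian f False])
    moreover have "A_mat \<kappa> J u m k * f m + ?e m = L_mat J u m k * f m" for m
      by (simp add: A_mat_def algebra_simps)
    ultimately have Ls: "(\<lambda>m. L_mat J u m k * f m) summable_on - {0}" by simp
    have "appl (A_mat \<kappa> J u) f k = (\<Sum>\<^sub>\<infinity>m\<in>- {0}. L_mat J u m k * f m + ?d m)"
      unfolding appl_def by (intro infsum_cong) (simp add: A_mat_def distrib_right)
    also have "\<dots> = L_op J u f k - of_real (\<kappa> * (norm (kvec k))\<^sup>2) * f k"
      unfolding L using infsum_add[OF Ls has_sum_imp_summable[OF d]] infsumI[OF d] by simp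
    finally show ?thesis
      using Hsp_0D(1)[OF f] by (simp add: A_op_def on_distr_laplacian)
  qed
qed

lemma A_op_Hsp: assumes f: "f \<in> Hsp 2" shows "A_op \<kappa> J u f \<in> Hsp 0"
proof -
  have f0: "f \<in> Hsp 0" using Hsp_mono[OF _ f] by simp
  obtain G where G: "op_bound 2 G (A_mat \<kappa> J u)" using bounded_op_A by (auto simp: bounded_op_def)
  show ?thesis unfolding A_op_eq_appl[OF f0]
  proof (rule Hsp_0I)
    show "appl (A_mat \<kappa> J u) f 0 = 0" by (simp add: appl_def A_mat_0)
    show "appl (A_mat \<kappa> J u) f (- k) = cnj (appl (A_mat \<kappa> J u) f k)" for k
      by (intro appl_minus A_mat_minus Hsp_0D(2)[OF f0])
    show "(\<lambda>k. (cmod (appl (A_mat \<kappa> J u) f k))\<^sup>2) summable_on - {0}"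
      by (rule appl_square_summable(1)[OF G A_mat_hermitian _ f]) simp
  qed
qed

definition dom_A :: "'n L2 set" where "dom_A = {x. coef x \<in> Hsp 2}"
definition A_L2 :: "'n L2 \<Rightarrow> 'n L2" where "A_L2 x = L2_of (A_op \<kappa> J u (coef x))"

lemma coef_A_L2: "x \<in> dom_A \<Longrightarrow> coef (A_L2 x) = appl (A_mat \<kappa> J u) (coef x)"
  by (simp add: dom_A_def A_L2_def L2_of_inverse A_op_Hsp) (simp add: A_op_eq_appl coef)

lemma inner_A_L2_tendsto:
  assumes "y \<in> dom_A"
  shows "(\<lambda>N. Re (\<Sum>k\<in>modes N. \<Sum>m\<in>modes N. cnj (coef x k) * (A_mat \<kappa> J u m k * coef y m))) \<longlonglongrightarrow> x \<bullet> A_L2 y"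
  unfolding inner_L2_def coef_A_L2[OF assms]
  using assms by (intro tendsto_Re form_tendsto[OF bounded_op_A A_mat_hermitian] coef) (auto simp: dom_A_def)

lemma A_L2_symmetric:
  assumes "x \<in> dom_A" "y \<in> dom_A" shows "A_L2 x \<bullet> y = x \<bullet> A_L2 y"
proof -
  have "Re (\<Sum>k\<in>modes N. \<Sum>m\<in>modes N. cnj (coef y k) * (A_mat \<kappa> J u m k * coef x m))
      = Re (\<Sum>k\<in>modes N. \<Sum>m\<in>modes N. cnj (coef x k) * (A_mat \<kappa> J u m k * coef y m))" for N
  proof -
    have "(\<Sum>k\<in>modes N. \<Sum>m\<in>modes N. cnj (coef y k) * (A_mat \<kappa> J u m k * coef x m))
        = (\<Sum>m\<in>modes N. \<Sum>k\<in>modes N. cnj (coef y k) * (A_mat \<kappa> J u m k * coef x m))"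
      by (rule sum.swap)
    also have "\<dots> = cnj (\<Sum>k\<in>modes N. \<Sum>m\<in>modes N. cnj (coef x k) * (A_mat \<kappa> J u m k * coef y m))"
      unfolding cnj_sum
    proof (intro sum.cong refl)
      fix k m :: "int ^ 'n"
      have h: "A_mat \<kappa> J u k m = cnj (A_mat \<kappa> J u m k)"
        using hermitian_uptoD[OF A_mat_hermitian, where m = k and k = m] by simp
      show "cnj (coef y m) * (A_mat \<kappa> J u k m * coef x k) = cnj (cnj (coef x k) * (A_mat \<kappa> J u m k * coef y m))"
        unfolding h by (simp add: mult_ac)
    qed
    finally show ?thesis by (simp only: cnj.sel)
  qed
  then have "y \<bullet> A_L2 x = x \<bullet> A_L2 y"
    using inner_A_L2_tendsto[OF assms(1), of y] inner_A_L2_tendsto[OF assms(2), of x] LIMSEQ_unique by auto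
  then show ?thesis by (simp add: inner_commute)
qed

text \<open>The part coming from the fields is nonpositive on every finite section, and the diagonal
  part contributes exactly the truncated \<open>H\<^sup>1\<close> norm.\<close>

lemma A_L2_coercive:
  assumes "x \<in> dom_A" shows "A_L2 x \<bullet> x \<le> - \<kappa> * (Hnorm 1 (coef x))\<^sup>2"
proof -
  let ?f = "coef x"
  have x1: "?f \<in> Hsp 1" using assms Hsp_mono[of 1 2] by (simp add: dom_A_def)
  have "Re (\<Sum>k\<in>modes N. \<Sum>m\<in>modes N. cnj (?f k) * (A_mat \<kappa> J u m k * ?f m))
      \<le> - \<kappa> * (\<Sum>k\<in>modes N. sob_term 1 ?f k)" for N
  proof -
    have "(\<Sum>k\<in>modes N. \<Sum>m\<in>modes N. cnj (?f k) * (A_mat \<kappa> J u m k * ?f m))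
        = (\<Sum>k\<in>modes N. \<Sum>m\<in>modes N. cnj (?f k) * (L_mat J u m k * ?f m))
        + (\<Sum>k\<in>modes N. \<Sum>m\<in>modes N. cnj (?f k) * ((if m = k then - of_real (\<kappa> * (norm (kvec m))\<^sup>2) else 0) * ?f m))"
      unfolding A_mat_def by (simp only: distrib_right distrib_left sum.distrib)
    also have "(\<Sum>k\<in>modes N. \<Sum>m\<in>modes N. cnj (?f k) * ((if m = k then - of_real (\<kappa> * (norm (kvec m))\<^sup>2) else 0) * ?f m))
        = of_real (- \<kappa> * (\<Sum>k\<in>modes N. sob_term 1 ?f k))"
    proof -
      have "(\<Sum>m\<in>modes N. cnj (?f k) * ((if m = k then - of_real (\<kappa> * (norm (kvec m))\<^sup>2) else 0) * ?f m))
          = of_real (- \<kappa> * (sob_term 1 ?f k))" if "k \<in> modes N" for k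
      proof -
        have "(\<Sum>m\<in>modes N. cnj (?f k) * ((if m = k then - of_real (\<kappa> * (norm (kvec m))\<^sup>2) else 0) * ?f m))
            = (\<Sum>m\<in>modes N. if m = k then cnj (?f k) * (- of_real (\<kappa> * (norm (kvec k))\<^sup>2) * ?f k) else 0)"
          by (intro sum.cong) auto
        also have "\<dots> = - of_real (\<kappa> * (norm (kvec k))\<^sup>2) * (?f k * cnj (?f k))"
          using that by simp
        also have "?f k * cnj (?f k) = of_real ((cmod (?f k))\<^sup>2)" by (simp only: complex_norm_square)
        finally show ?thesis by (simp add: powr_numeral mult.assoc)
      qed
      then show ?thesis by (simp add: sum_distrib_left)
    qed
    also have "(\<Sum>k\<in>modes N. \<Sum>m\<in>modes N. cnj (?f k) * (L_mat J u m k * ?f m))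
        = (1 / 2) * (\<Sum>j\<in>J. \<Sum>k\<in>modes N. \<Sum>m\<in>modes N. cnj (?f k) * (adv2_mat (u j) m k * ?f m))"
      unfolding L_mat_def sum_distrib_left sum_distrib_right
      by (subst sum.swap[of _ _ J], intro sum.cong refl, subst sum.swap[of _ _ J]) (simp add: mult_ac)
    finally have *: "(\<Sum>k\<in>modes N. \<Sum>m\<in>modes N. cnj (?f k) * (A_mat \<kappa> J u m k * ?f m)) =
        (1 / 2) * (\<Sum>j\<in>J. \<Sum>k\<in>modes N. \<Sum>m\<in>modes N. cnj (?f k) * (adv2_mat (u j) m k * ?f m))
        + of_real (- \<kappa> * (\<Sum>k\<in>modes N. sob_term 1 ?f k))" .
    have "Re ((1 / 2) * (\<Sum>j\<in>J. \<Sum>k\<in>modes N. \<Sum>m\<in>modes N. cnj (?f k) * (adv2_mat (u j) m k * ?f m)))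
        = (1 / 2) * (\<Sum>j\<in>J. Re (\<Sum>k\<in>modes N. \<Sum>m\<in>modes N. cnj (?f k) * (adv2_mat (u j) m k * ?f m)))"
      by (simp only: Re_sum) simp
    also have "\<dots> \<le> 0"
      using adv2_form_nonpos[OF u finite_modes] by (intro mult_nonneg_nonpos sum_nonpos) auto
    finally show ?thesis unfolding * by simp
  qed
  moreover have "(\<lambda>N. - \<kappa> * (\<Sum>k\<in>modes N. sob_term 1 ?f k)) \<longlonglongrightarrow> - \<kappa> * (Hnorm 1 ?f)\<^sup>2"
    unfolding Hnorm_squared by (intro tendsto_intros sum_modes_tendsto Hsp_summable x1)
  ultimately have "x \<bullet> A_L2 x \<le> - \<kappa> * (Hnorm 1 ?f)\<^sup>2"
    using inner_A_L2_tendsto[OF assms, of x] by (intro LIMSEQ_le) auto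
  then show ?thesis by (simp add: inner_commute)
qed

end

section \<open>Rellich compactness\<close>

text \<open>Tychonoff's theorem for a product of discs; countability of the index type makes the
  compact product sequentially compact, so no diagonal sequence has to be constructed.\<close>

lemma coordinatewise_subsequence:
  fixes f :: "nat \<Rightarrow> 'k::countable \<Rightarrow> complex"
  assumes "\<And>n k. cmod (f n k) \<le> 1"
  obtains r g where "strict_mono (r :: nat \<Rightarrow> nat)" "\<And>k. (\<lambda>n. f (r n) k) \<longlonglongrightarrow> g k"
proof -
  have "compact (PiE UNIV (\<lambda>_. cball 0 1) :: ('k \<Rightarrow> complex) set)"
    using compactin_PiE[of "\<lambda>_. euclidean :: complex topology" UNIV "\<lambda>_. cball 0 1"]
    by (simp add: euclidean_product_topology compactin_euclidean_iff)
  then have "seq_compact (PiE UNIV (\<lambda>_. cball 0 1) :: ('k \<Rightarrow> complex) set)" by (rule compact_imp_seq_compact)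
  moreover have "\<forall>n. f n \<in> PiE UNIV (\<lambda>_. cball 0 1)" using assms by (auto simp: PiE_UNIV_domain)
  ultimately obtain g r where r: "strict_mono (r :: nat \<Rightarrow> nat)" and g: "(f \<circ> r) \<longlonglongrightarrow> g"
    by (rule seq_compactE)
  have "(\<lambda>n. f (r n) k) \<longlonglongrightarrow> g k" for k
  proof -
    have "continuous_on UNIV (\<lambda>h :: 'k \<Rightarrow> complex. h k)" by (rule continuous_on_product_coordinates)
    from continuous_on_tendsto_compose[OF this g] show ?thesis by simp
  qed
  then show ?thesis using r that by blast
qed

lemma tail_sum_bound:
  assumes f: "f \<in> Hsp 1" and N: "0 < N"
  shows "(\<Sum>k\<in>modes M - modes N. (cmod (f k))\<^sup>2) \<le> (Hnorm 1 f)\<^sup>2 / (real N)\<^sup>2"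
proof -
  have "(\<Sum>k\<in>modes M - modes N. (cmod (f k))\<^sup>2)
      \<le> (\<Sum>k\<in>modes M - modes N. sob_term 1 f k / (real N)\<^sup>2)"
  proof (rule sum_mono)
    fix k :: "(int, 'a) vec" assume k: "k \<in> modes M - modes N"
    then have "k \<noteq> 0" by (auto simp: modes_def)
    then have "real N \<le> norm (kvec k)" using norm_kvec_notin_modes[of k N] k by auto
    then have "(real N)\<^sup>2 \<le> norm (kvec k) powr 2" by (simp add: powr_numeral)
    then have "(real N)\<^sup>2 * (cmod (f k))\<^sup>2 \<le> norm (kvec k) powr 2 * (cmod (f k))\<^sup>2" by (rule mult_right_mono) simp
    then show "(cmod (f k))\<^sup>2 \<le> sob_term 1 f k / (real N)\<^sup>2"
      using N by (simp add: field_simps)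
  qed
  also have "\<dots> = (\<Sum>k\<in>modes M - modes N. sob_term 1 f k) / (real N)\<^sup>2"
    by (simp add: sum_divide_distrib)
  also have "\<dots> \<le> (Hnorm 1 f)\<^sup>2 / (real N)\<^sup>2"
    unfolding Hnorm_squared using modes_subset by (intro divide_right_mono finite_sum_le_infsum Hsp_summable f) auto
  finally show ?thesis .
qed

text \<open>The \<open>H\<^sup>1\<close> bound makes the high modes uniformly small, and the
  finitely many low modes converge along a common subsequence.\<close>

lemma Rellich:
  fixes x :: "nat \<Rightarrow> 'n::finite L2"
  assumes x: "\<And>n. norm (x n) \<le> 1" "\<And>n. coef (x n) \<in> Hsp 1" "\<And>n. (Hnorm 1 (coef (x n)))\<^sup>2 \<le> B"
  obtains r l where "strict_mono (r :: nat \<Rightarrow> nat)" "(\<lambda>n. x (r n)) \<longlonglongrightarrow> l"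
proof -
  obtain r g where r: "strict_mono (r :: nat \<Rightarrow> nat)" and g: "\<And>k. (\<lambda>n. coef (x (r n)) k) \<longlonglongrightarrow> g k"
    using coordinatewise_subsequence[of "\<lambda>n. coef (x n)"] cmod_coef_le_norm x(1) order_trans by metis
  have B: "0 \<le> B" using x(3)[of 0] zero_le_power2 order_trans by blast
  let ?y = "\<lambda>n. x (r n)"
  have "Cauchy ?y"
  proof (rule CauchyI)
    fix e :: real assume e: "0 < e"
    \<comment> \<open>The tail of a difference is at most \<open>4 * B / N\<^sup>2\<close>: two
      tails of size \<open>B / N\<^sup>2\<close>, each doubled by (a + b)^2 <= 2 a^2 + 2 b^2. Once
      \<open>N\<close> is at least 1, a bound on \<open>N\<close> is also one on its square.\<close>
    obtain N where N: "4 * B / (e\<^sup>2 / 4) < real N" using reals_Archimedean2 by blast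
    have N0: "0 < N"
    proof (rule ccontr)
      assume "\<not> 0 < N"
      moreover have "0 \<le> 4 * B / (e\<^sup>2 / 4)" using B by simp
      ultimately show False using N by simp
    qed
    then have "real N * 1 \<le> real N * real N" by (intro mult_left_mono) auto
    then have "4 * B / (e\<^sup>2 / 4) < (real N)\<^sup>2" using N by (simp add: power2_eq_square)
    then have tailN: "4 * B / (real N)\<^sup>2 < e\<^sup>2 / 4" using e N0 by (simp add: field_simps)
    define h where "h m n = (\<Sum>k\<in>modes N. (cmod (coef (?y m) k - coef (?y n) k))\<^sup>2)" for m n
    have "\<exists>M. \<forall>m\<ge>M. \<forall>n\<ge>M. h m n < e\<^sup>2 / 4"
    proof -
      \<comment> \<open>The allowance \<open>e\<^sup>2 / 4\<close> is shared among the low modes;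
        the added 1 keeps the divisor positive and makes the total strictly smaller.\<close>
      define c where "c = real (card (modes N :: (int ^ 'n) set)) + 1"
      have c: "0 < c" by (simp add: c_def)
      define \<delta> where "\<delta> = e\<^sup>2 / 4 / c"
      have \<delta>: "0 < \<delta>" using e c by (simp add: \<delta>_def)
      have "\<exists>M. \<forall>m\<ge>M. \<forall>n\<ge>M. (cmod (coef (?y m) k - coef (?y n) k))\<^sup>2 < \<delta>" for k
      proof -
        have "Cauchy (\<lambda>n. coef (?y n) k)" using g[of k] by (rule LIMSEQ_imp_Cauchy)
        then obtain M where "\<forall>m\<ge>M. \<forall>n\<ge>M. cmod (coef (?y m) k - coef (?y n) k) < sqrt \<delta>"
          using CauchyD[of _ "sqrt \<delta>"] \<delta> by (meson real_sqrt_gt_zero)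
        then have "\<forall>m\<ge>M. \<forall>n\<ge>M. (cmod (coef (?y m) k - coef (?y n) k))\<^sup>2 < (sqrt \<delta>)\<^sup>2"
          by (auto intro!: power_strict_mono)
        then show ?thesis using \<delta> by auto
      qed
      then obtain M where M: "\<And>k m n. m \<ge> M k \<Longrightarrow> n \<ge> M k \<Longrightarrow> (cmod (coef (?y m) k - coef (?y n) k))\<^sup>2 < \<delta>" by metis
      have "h m n < e\<^sup>2 / 4" if "m \<ge> Max (insert 0 (M ` modes N))" "n \<ge> Max (insert 0 (M ` modes N))" for m n
      proof -
        have "h m n \<le> (\<Sum>k\<in>(modes N :: (int ^ 'n) set). \<delta>)"
          unfolding h_def
        proof (rule sum_mono)
          fix k :: "int ^ 'n" assume "k \<in> modes N"
          then have "M k \<le> Max (insert 0 (M ` modes N))" by (intro Max_ge) auto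
          then have "M k \<le> m" "M k \<le> n" using that by linarith+
          then show "(cmod (coef (?y m) k - coef (?y n) k))\<^sup>2 \<le> \<delta>"
            using M less_imp_le by blast
        qed
        also have "\<dots> = real (card (modes N :: (int ^ 'n) set)) * \<delta>" by simp
        also have "\<dots> < c * \<delta>" using \<delta> by (simp add: c_def)
        also have "\<dots> = e\<^sup>2 / 4" using c by (simp add: \<delta>_def)
        finally show ?thesis .
      qed
      then show ?thesis by blast
    qed
    then obtain M where M: "\<And>m n. m \<ge> M \<Longrightarrow> n \<ge> M \<Longrightarrow> h m n < e\<^sup>2 / 4" by blast
    have "norm (?y m - ?y n) < e" if mn: "m \<ge> M" "n \<ge> M" for m n
    proof -
      have "norm (?y m - ?y n) \<le> sqrt (e\<^sup>2 / 2)"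
      proof (rule norm_L2_le)
        fix M'
        have "(\<Sum>k\<in>modes M'. (cmod (coef (?y m - ?y n) k))\<^sup>2)
            \<le> (\<Sum>k\<in>modes N \<union> (modes M' - modes N). (cmod (coef (?y m - ?y n) k))\<^sup>2)"
          by (intro sum_mono2) auto
        also have "\<dots> = h m n + (\<Sum>k\<in>modes M' - modes N. (cmod (coef (?y m) k - coef (?y n) k))\<^sup>2)"
          unfolding h_def by (subst sum.union_disjoint) auto
        also have "(\<Sum>k\<in>modes M' - modes N. (cmod (coef (?y m) k - coef (?y n) k))\<^sup>2)
            \<le> (\<Sum>k\<in>modes M' - modes N. 2 * (cmod (coef (?y m) k))\<^sup>2 + 2 * (cmod (coef (?y n) k))\<^sup>2)"
        proof (rule sum_mono)
          fix k
          have "(cmod (coef (?y m) k - coef (?y n) k))\<^sup>2 \<le> (cmod (coef (?y m) k) + cmod (coef (?y n) k))\<^sup>2"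
            by (intro power_mono norm_triangle_ineq4) auto
          also have "\<dots> \<le> 2 * (cmod (coef (?y m) k))\<^sup>2 + 2 * (cmod (coef (?y n) k))\<^sup>2"
            using sum_squares_bound[of "cmod (coef (?y m) k)" "cmod (coef (?y n) k)"] by (simp add: power2_sum)
          finally show "(cmod (coef (?y m) k - coef (?y n) k))\<^sup>2 \<le> \<dots>" .
        qed
        also have "\<dots> = 2 * (\<Sum>k\<in>modes M' - modes N. (cmod (coef (?y m) k))\<^sup>2)
            + 2 * (\<Sum>k\<in>modes M' - modes N. (cmod (coef (?y n) k))\<^sup>2)"
          by (simp add: sum.distrib sum_distrib_left)
        also have "\<dots> \<le> 2 * (B / (real N)\<^sup>2) + 2 * (B / (real N)\<^sup>2)"
        proof -
          have "(\<Sum>k\<in>modes M' - modes N. (cmod (coef (x i) k))\<^sup>2) \<le> B / (real N)\<^sup>2" for i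
            by (rule order_trans[OF tail_sum_bound[OF x(2) N0] divide_right_mono[OF x(3) zero_le_power2]])
          then show ?thesis by (intro add_mono mult_left_mono) auto
        qed
        also have "\<dots> = 4 * B / (real N)\<^sup>2" by simp
        finally show "(\<Sum>k\<in>modes M'. (cmod (coef (?y m - ?y n) k))\<^sup>2) \<le> (sqrt (e\<^sup>2 / 2))\<^sup>2"
          using M[OF mn] tailN by simp
      qed simp
      also have "\<dots> < sqrt (e\<^sup>2)" using e by (intro real_sqrt_less_mono) simp
      finally show ?thesis using e by simp
    qed
    then show "\<exists>M. \<forall>m\<ge>M. \<forall>n\<ge>M. norm (?y m - ?y n) < e" by blast
  qed
  then obtain l where "?y \<longlonglongrightarrow> l" using Cauchy_convergent convergent_def by blast
  then show ?thesis using r that by blast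
qed

section \<open>The principal eigenvalue controls the semigroup\<close>

text \<open>The assumptions concern only the line through \<open>f\<close> in direction
  \<open>g\<close>, because the form to which this is applied is bilinear only on the domain of the
  operator.\<close>

lemma psd_Cauchy_Schwarz:
  fixes B :: "'v::real_vector \<Rightarrow> 'v \<Rightarrow> real"
  assumes nonneg: "\<And>t. 0 \<le> B (f + t *\<^sub>R g) (f + t *\<^sub>R g)"
    and expand: "\<And>t. B (f + t *\<^sub>R g) (f + t *\<^sub>R g) = B f f + 2 * t * B f g + t\<^sup>2 * B g g"
    and "0 \<le> B g g"
  shows "(B f g)\<^sup>2 \<le> B f f * B g g"
proof (cases "B g g = 0")
  case True
  have "B f g = 0"
  proof (rule ccontr)
    assume n: "B f g \<noteq> 0"
    \<comment> \<open>With no quadratic term the expression is affine in the parameter, which is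
      chosen so that its value is -1.\<close>
    have "0 \<le> B f f + 2 * (- (B f f + 1) / (2 * B f g)) * B f g"
      using nonneg[of "- (B f f + 1) / (2 * B f g)"] True unfolding expand by simp
    also have "2 * (- (B f f + 1) / (2 * B f g)) * B f g = - (B f f + 1)" using n by simp
    finally show False by simp
  qed
  then show ?thesis using True by simp
next
  case False
  have "0 \<le> B f f + 2 * (- B f g / B g g) * B f g + (- B f g / B g g)\<^sup>2 * B g g"
    using nonneg[of "- B f g / B g g"] unfolding expand .
  also have "\<dots> = B f f - (B f g)\<^sup>2 / B g g" using False by (simp add: power2_eq_square field_simps)
  finally have *: "0 \<le> B f f - (B f g)\<^sup>2 / B g g" .
  have "0 < B g g" using False assms(3) by simp
  then show ?thesis using * by (simp add: field_simps)
qed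

context diffusion
begin

lemma dom_A_add: "x \<in> dom_A \<Longrightarrow> y \<in> dom_A \<Longrightarrow> x + y \<in> dom_A" and dom_A_scale: "x \<in> dom_A \<Longrightarrow> a *\<^sub>R x \<in> dom_A"
proof -
  have dom_A_iff: "z \<in> dom_A \<longleftrightarrow> (\<lambda>k. sob_term 2 (coef z) k) summable_on - {0}" for z :: "'n L2"
    using coef[of z] by (simp add: dom_A_def Hsp_def)
  show "x + y \<in> dom_A" if "x \<in> dom_A" "y \<in> dom_A"
    unfolding dom_A_iff
  proof (rule summable_on_comparison_test)
    show "(\<lambda>k. 2 * (sob_term 2 (coef x) k) + 2 * (sob_term 2 (coef y) k))
        summable_on - {0}"
      using that unfolding dom_A_iff by (intro summable_on_add summable_on_cmult_right)
    fix k
    have "(cmod (coef x k + coef y k))\<^sup>2 \<le> (cmod (coef x k) + cmod (coef y k))\<^sup>2"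
      by (intro power_mono norm_triangle_ineq) auto
    also have "\<dots> \<le> 2 * (cmod (coef x k))\<^sup>2 + 2 * (cmod (coef y k))\<^sup>2"
      using sum_squares_bound[of "cmod (coef x k)" "cmod (coef y k)"] by (simp add: power2_sum)
    finally have "sob_term 2 (coef (x + y)) k
        \<le> norm (kvec k) powr (2 * 2) * (2 * (cmod (coef x k))\<^sup>2 + 2 * (cmod (coef y k))\<^sup>2)"
      by (intro mult_left_mono) auto
    then show "sob_term 2 (coef (x + y)) k
      \<le> 2 * (sob_term 2 (coef x) k) + 2 * (sob_term 2 (coef y) k)"
      by (simp add: algebra_simps)
  qed auto
  show "a *\<^sub>R x \<in> dom_A" if "x \<in> dom_A"
    using summable_on_cmult_right[OF that[unfolded dom_A_iff], of "a\<^sup>2"]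
    by (simp add: dom_A_iff norm_mult power_mult_distrib mult_ac)
qed

text \<open>Fourier truncations have finitely many nonzero coefficients, hence lie in
  \<open>Hsp 2\<close>, and they converge because the tails vanish in norm.\<close>

lemma dom_A_dense: "closure dom_A = UNIV"
proof -
  have "x \<in> closure dom_A" for x
  proof -
    define y where "y N = x - L2_of (tail N (coef x))" for N
    have t: "tail N (coef x) \<in> Hsp 0" for N by (rule tail_Hsp[OF coef])
    have "y N \<in> dom_A" for N
    proof -
      have c: "coef (y N) k = (if k \<in> modes N then coef x k else 0)" for k
        by (simp add: y_def L2_of_inverse t tail_def)
      have "(\<lambda>k. sob_term 2 (coef (y N)) k) summable_on - {0}"
        using has_sum_finite_neutralI[of "modes N" "- {0}" "\<lambda>k. sob_term 2 (coef (y N)) k", OF _ modes_subset]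
        by (auto simp: c summable_on_def)
      then show ?thesis using coef[of "y N"] by (simp add: dom_A_def Hsp_def)
    qed
    moreover have "y \<longlonglongrightarrow> x"
    proof -
      have "(\<lambda>N. norm (y N - x)) \<longlonglongrightarrow> 0"
        using Hnorm_tail_tendsto[OF coef] by (simp add: y_def Hnorm_L2_of t)
      then show ?thesis by (simp add: LIM_zero_iff tendsto_norm_zero_iff)
    qed
    ultimately show ?thesis by (auto simp: closure_sequential)
  qed
  then show ?thesis by auto
qed

lemma A_L2_linear: "x \<in> dom_A \<Longrightarrow> y \<in> dom_A \<Longrightarrow> A_L2 (x + y) = A_L2 x + A_L2 y" "x \<in> dom_A \<Longrightarrow> A_L2 (a *\<^sub>R x) = a *\<^sub>R A_L2 x"
proof -
  show "A_L2 (x + y) = A_L2 x + A_L2 y" if xy: "x \<in> dom_A" "y \<in> dom_A"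
  proof (rule L2_eqI)
    fix k
    show "coef (A_L2 (x + y)) k = coef (A_L2 x + A_L2 y) k"
    proof (cases "k = 0")
      case False
      show ?thesis
        using infsum_add[OF appl_summable[OF bounded_op_A A_mat_hermitian coef False, of x]
            appl_summable[OF bounded_op_A A_mat_hermitian coef False, of y]]
        by (simp add: coef_A_L2 xy dom_A_add appl_def distrib_left)
    qed (simp add: coef_0)
  qed
  show "A_L2 (a *\<^sub>R x) = a *\<^sub>R A_L2 x" if x: "x \<in> dom_A"
  proof (rule L2_eqI)
    fix k
    have "(\<Sum>\<^sub>\<infinity>m\<in>- {0}. A_mat \<kappa> J u m k * (of_real a * coef x m)) = (\<Sum>\<^sub>\<infinity>m\<in>- {0}. of_real a * (A_mat \<kappa> J u m k * coef x m))"
      by (simp add: mult_ac)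
    then show "coef (A_L2 (a *\<^sub>R x)) k = coef (a *\<^sub>R A_L2 x) k"
      by (simp add: coef_A_L2 x dom_A_scale appl_def infsum_cmult_right')
  qed
qed

definition S_L2 :: "(real \<Rightarrow> 'n distr \<Rightarrow> 'n distr) \<Rightarrow> real \<Rightarrow> 'n L2 \<Rightarrow> 'n L2" where
  "S_L2 S t x = L2_of (S t (coef x))"

section \<open>The given semigroup and the principal eigenvalue\<close>

context
  fixes S :: "real \<Rightarrow> 'n distr \<Rightarrow> 'n distr"
  assumes S: "semigroup_generated_by (Hsp 2) (A_op \<kappa> J u) S"
begin

lemma S_Hsp: "t \<ge> 0 \<Longrightarrow> f \<in> Hsp 0 \<Longrightarrow> S t f \<in> Hsp 0"
  using S unfolding semigroup_generated_by_def by blast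

lemma coef_S_L2: "t \<ge> 0 \<Longrightarrow> coef (S_L2 S t x) = S t (coef x)"
  by (simp add: S_L2_def L2_of_inverse S_Hsp coef)

lemma generated_semigroup_L2: "generated_semigroup (S_L2 S) dom_A A_L2"
proof (rule generated_semigroup.intro)
  note s = S[unfolded semigroup_generated_by_def, THEN conjunct2]
  note S_lin = s[THEN conjunct1] and S_bd = s[THEN conjunct2, THEN conjunct1]
    and S_0 = s[THEN conjunct2, THEN conjunct2, THEN conjunct1]
    and S_add = s[THEN conjunct2, THEN conjunct2, THEN conjunct2, THEN conjunct1]
    and S_lim = s[THEN conjunct2, THEN conjunct2, THEN conjunct2, THEN conjunct2, THEN conjunct1]
    and S_gen = s[THEN conjunct2, THEN conjunct2, THEN conjunct2, THEN conjunct2, THEN conjunct2]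
  show "bounded_linear (S_L2 S t)" if t: "t \<ge> 0" for t
  proof -
    have lin: "S t (\<lambda>k. of_real a * f k + of_real b * g k) = (\<lambda>k. of_real a * S t f k + of_real b * S t g k)"
      if "f \<in> Hsp 0" "g \<in> Hsp 0" for f g and a b :: real
      using S_lin t that by simp
    obtain M where M: "\<And>f. f \<in> Hsp 0 \<Longrightarrow> Hnorm 0 (S t f) \<le> M * Hnorm 0 f" using S_bd t by blast
    show ?thesis
    proof (rule bounded_linear_intro)
      show "S_L2 S t (x + y) = S_L2 S t x + S_L2 S t y" for x y
      proof (rule L2_eqI)
        fix k
        have "coef (x + y) = (\<lambda>k. of_real 1 * coef x k + of_real 1 * coef y k)" by auto
        then show "coef (S_L2 S t (x + y)) k = coef (S_L2 S t x + S_L2 S t y) k"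
          using lin[OF coef coef, of 1 x 1 y] t by (simp add: coef_S_L2)
      qed
      show "S_L2 S t (r *\<^sub>R x) = r *\<^sub>R S_L2 S t x" for r x
      proof (rule L2_eqI)
        fix k
        have "coef (r *\<^sub>R x) = (\<lambda>k. of_real r * coef x k + of_real 0 * coef x k)" by auto
        then show "coef (S_L2 S t (r *\<^sub>R x)) k = coef (r *\<^sub>R S_L2 S t x) k"
          using lin[OF coef coef, of r x 0 x] t by (simp add: coef_S_L2)
      qed
      show "norm (S_L2 S t x) \<le> norm x * M" for x
        using M[OF coef, of x] t by (simp add: norm_L2_eq_Hnorm coef_S_L2 mult.commute)
    qed
  qed
  show "S_L2 S 0 f = f" for f
    using S_0 coef[of f] by (simp add: S_L2_def coef_inverse)
  show "S_L2 S (s + t) f = S_L2 S s (S_L2 S t f)" if "s \<ge> 0" "t \<ge> 0" for s t f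
  proof -
    have "S (s + t) (coef f) = S s (S t (coef f))" using S_add that coef[of f] by simp
    then show ?thesis using that by (simp add: S_L2_def L2_of_inverse S_Hsp coef)
  qed
  show "((\<lambda>t. S_L2 S t f) \<longlongrightarrow> f) (at_right 0)" for f
  proof -
    have "((\<lambda>t. Hnorm 0 (\<lambda>k. S t (coef f) k - coef f k)) \<longlongrightarrow> 0) (at_right 0)"
      using S_lim coef[of f] by simp
    moreover have "\<forall>\<^sub>F t in at_right 0. Hnorm 0 (\<lambda>k. S t (coef f) k - coef f k) = norm (S_L2 S t f - f)"
      using eventually_at_right_less[of 0]
    proof eventually_elim
      case (elim t)
      have "coef (S_L2 S t f - f) = (\<lambda>k. S t (coef f) k - coef f k)" using elim by (auto simp: coef_S_L2)
      then show ?case by (simp add: norm_L2_eq_Hnorm)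
    qed
    ultimately have "((\<lambda>t. norm (S_L2 S t f - f)) \<longlongrightarrow> 0) (at_right 0)" by (rule Lim_transform_eventually)
    then show ?thesis by (simp add: tendsto_norm_zero_iff LIM_zero_iff)
  qed
  show "((\<lambda>t. (S_L2 S t f - f) /\<^sub>R t) \<longlongrightarrow> g) (at_right 0) \<longleftrightarrow> f \<in> dom_A \<and> g = A_L2 f" for f g
  proof -
    have "\<forall>\<^sub>F t in at_right 0. Hnorm 0 (\<lambda>k. (S t (coef f) k - coef f k) / of_real t - coef g k) = norm ((S_L2 S t f - f) /\<^sub>R t - g)"
      using eventually_at_right_less[of 0]
    proof eventually_elim
      case (elim t)
      have "coef ((S_L2 S t f - f) /\<^sub>R t - g) = (\<lambda>k. (S t (coef f) k - coef f k) / of_real t - coef g k)"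
        using elim by (auto simp: coef_S_L2 divide_inverse mult.commute)
      then show ?case by (simp add: norm_L2_eq_Hnorm)
    qed
    from tendsto_cong[OF this]
    have "((\<lambda>t. (S_L2 S t f - f) /\<^sub>R t) \<longlongrightarrow> g) (at_right 0)
        \<longleftrightarrow> ((\<lambda>t. Hnorm 0 (\<lambda>k. (S t (coef f) k - coef f k) / of_real t - coef g k)) \<longlongrightarrow> 0) (at_right 0)"
      by (simp add: tendsto_norm_zero_iff LIM_zero_iff)
    also have "\<dots> \<longleftrightarrow> coef f \<in> Hsp 2 \<and> coef g = A_op \<kappa> J u (coef f)"
      using S_gen coef[of f] coef[of g] by simp
    also have "\<dots> \<longleftrightarrow> f \<in> dom_A \<and> g = A_L2 f"
      using coef_inject[of g "A_L2 f"] by (auto simp: dom_A_def A_L2_def L2_of_inverse A_op_Hsp)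
    finally show ?thesis .
  qed
qed

lemma eigenvalueI:
  assumes "x \<in> dom_A" "A_L2 x = (- \<nu>) *\<^sub>R x" "x \<noteq> 0"
  shows "eigenvalue (Hsp 2) (\<lambda>f k. - A_op \<kappa> J u f k) \<nu>"
  unfolding eigenvalue_def
proof (intro bexI conjI)
  show "coef x \<in> Hsp 2" using assms by (simp add: dom_A_def)
  show "coef x \<noteq> (\<lambda>_. 0)" using assms(3) by (metis L2_eqI coef_zero)
  have "coef (A_L2 x) = A_op \<kappa> J u (coef x)" by (simp only: coef_A_L2[OF assms(1)] A_op_eq_appl[OF coef])
  then have "A_op \<kappa> J u (coef x) k = of_real (- \<nu>) * coef x k" for k
    unfolding assms(2) by (metis coef_scaleR)
  then show "(\<lambda>k. - A_op \<kappa> J u (coef x) k) = (\<lambda>k. of_real \<nu> * coef x k)" by simp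
qed

text \<open>By definition \<open>lam\<close> is only the least eigenvalue, so the infimum
  \<open>\<nu>\<close> of the form on the unit sphere has to be exhibited as an eigenvalue.
  Coercivity bounds a minimizing sequence in \<open>H\<^sup>1\<close> only, so its \<open>L2\<close>
  limit is not yet known to lie in the domain.\<close>

lemma principal_eigenvalue_dissipative:
  assumes lam: "principal_eigenvalue (Hsp 2) (\<lambda>f k. - A_op \<kappa> J u f k) lam" and g: "g \<in> dom_A"
  shows "A_L2 g \<bullet> g \<le> - lam * (norm g)\<^sup>2"
proof -
  interpret S_L2: generated_semigroup "S_L2 S" dom_A A_L2 by (rule generated_semigroup_L2)
  define q where "q x = - (A_L2 x \<bullet> x)" for x
  define Q where "Q = {q x | x. x \<in> dom_A \<and> norm x = 1}"
  define \<nu> where "\<nu> = Inf Q"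
  have q_scale: "q (a *\<^sub>R x) = a\<^sup>2 * q x" if "x \<in> dom_A" for a x
    using that by (simp add: q_def A_L2_linear power2_eq_square)
  have qH: "\<kappa> * (Hnorm 1 (coef x))\<^sup>2 \<le> q x" if "x \<in> dom_A" for x
    using A_L2_coercive[OF that] by (simp add: q_def)
  have q0: "0 \<le> q x" if "x \<in> dom_A" for x by (rule order_trans[OF _ qH[OF that]]) (use kappa in simp)
  have bdd: "bdd_below Q" by (rule bdd_belowI[of _ 0]) (auto simp: Q_def q0)
  \<comment> \<open>The eigenvector contained in the hypothesis supplies a nonzero element of the
    domain, so the infimum is taken over a nonempty set.\<close>
  have "eigenvalue (Hsp 2) (\<lambda>f k. - A_op \<kappa> J u f k) lam"
    using lam unfolding principal_eigenvalue_def by (rule conjunct1)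
  then obtain f :: "'n distr" where f: "f \<in> Hsp 2" "f \<noteq> (\<lambda>_. 0)"
    unfolding eigenvalue_def by (elim bexE conjE)
  define e where "e = L2_of f"
  have f0: "f \<in> Hsp 0" using Hsp_mono[OF _ f(1)] by simp
  have ce: "coef e = f" by (simp add: e_def L2_of_inverse f0)
  have e1: "e \<in> dom_A" using f(1) by (simp add: dom_A_def ce)
  have e2: "e \<noteq> 0"
  proof
    assume "e = 0"
    then have "f = coef 0" using ce by simp
    then show False using f(2) by (simp add: fun_eq_iff)
  qed
  note e = e1 e2
  have Q_ne: "Q \<noteq> {}"
    unfolding Q_def using e dom_A_scale[OF e(1), of "inverse (norm e)"] by auto
  have \<nu>_le: "\<nu> * (norm x)\<^sup>2 \<le> q x" if x: "x \<in> dom_A" for x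
  proof (cases "x = 0")
    case False
    have "q (inverse (norm x) *\<^sub>R x) \<in> Q" unfolding Q_def using False dom_A_scale[OF x] by auto
    then have "\<nu> \<le> q (inverse (norm x) *\<^sub>R x)" unfolding \<nu>_def by (rule cInf_lower[OF _ bdd])
    then show ?thesis using False by (simp add: q_scale[OF x] power_inverse field_simps)
  qed (use q0[OF x] in simp)
  have "\<exists>y. y \<in> dom_A \<and> norm y = 1 \<and> q y < \<nu> + 1 / real (Suc n)" for n
  proof -
    have "\<exists>z\<in>Q. z < \<nu> + 1 / real (Suc n)"
      using cInf_less_iff[OF Q_ne bdd, of "\<nu> + 1 / real (Suc n)"] by (simp add: \<nu>_def)
    then show ?thesis by (auto simp: Q_def)
  qed
  then obtain y where y: "\<And>n. y n \<in> dom_A" "\<And>n. norm (y n) = 1" "\<And>n. q (y n) < \<nu> + 1 / real (Suc n)" by metis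
  have "(Hnorm 1 (coef (y n)))\<^sup>2 \<le> (\<nu> + 1) / \<kappa>" for n
  proof -
    have "1 / real (Suc n) \<le> 1" by simp
    then have "\<kappa> * (Hnorm 1 (coef (y n)))\<^sup>2 \<le> \<nu> + 1" using qH[OF y(1)[of n]] y(3)[of n] by linarith
    then show ?thesis using kappa by (simp add: field_simps)
  qed
  moreover have "coef (y n) \<in> Hsp 1" for n using y(1)[of n] Hsp_mono[of 1 2] by (simp add: dom_A_def)
  ultimately obtain r l where r: "strict_mono (r :: nat \<Rightarrow> nat)" and l: "(\<lambda>n. y (r n)) \<longlonglongrightarrow> l"
    using Rellich[of y] y(2) by (metis order_refl)
  have "norm l = 1" using tendsto_norm[OF l] y(2) by (simp add: LIMSEQ_const_iff)
  have weak: "l \<bullet> A_L2 h = (- \<nu>) * (l \<bullet> h)" if h: "h \<in> dom_A" for h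
  proof -
    \<comment> \<open>This is the form of \<open>- A_L2 - \<nu>\<close>, positive semidefinite on
      the domain. As \<open>B (y n) (y n)\<close> tends to 0, Cauchy-Schwarz forces
      \<open>B h (y n)\<close> to 0; in the limit \<open>A_L2\<close> acts only on \<open>h\<close>,
      so the weak equation for \<open>l\<close> makes sense.\<close>
    define B where "B x z = - (A_L2 x \<bullet> z) - \<nu> * (x \<bullet> z)" for x z
    have CS: "(B h (y n))\<^sup>2 \<le> B h h * B (y n) (y n)" for n
    proof (rule psd_Cauchy_Schwarz)
      fix t
      have "h + t *\<^sub>R y n \<in> dom_A" by (intro dom_A_add dom_A_scale h y)
      from \<nu>_le[OF this] show "0 \<le> B (h + t *\<^sub>R y n) (h + t *\<^sub>R y n)"
        by (simp add: B_def q_def power2_norm_eq_inner)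
      show "B (h + t *\<^sub>R y n) (h + t *\<^sub>R y n) = B h h + 2 * t * B h (y n) + t\<^sup>2 * B (y n) (y n)"
        using A_L2_symmetric[OF h y(1)[of n]]
        by (simp add: B_def A_L2_linear h y dom_A_scale inner_add_left inner_add_right inner_commute
            power2_eq_square algebra_simps)
      show "0 \<le> B (y n) (y n)" using \<nu>_le[OF y(1)[of n]] by (simp add: B_def q_def power2_norm_eq_inner)
    qed
    have Bhh: "0 \<le> B h h" using \<nu>_le[OF h] by (simp add: B_def q_def power2_norm_eq_inner)
    have "(B h (y n))\<^sup>2 \<le> B h h * (1 / real (Suc n))" for n
    proof -
      have "B (y n) (y n) = q (y n) - \<nu>" using y(2)[of n] by (simp add: B_def q_def norm_eq_1)
      then have "B (y n) (y n) \<le> 1 / real (Suc n)" using y(3)[of n] by linarith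
      from mult_left_mono[OF this Bhh] show ?thesis using CS[of n] by linarith
    qed
    then have *: "(B h (y (r n)))\<^sup>2 \<le> B h h * (1 / real (Suc (r n)))" for n .
    have "(\<lambda>n. B h h * (1 / real (Suc (r n)))) \<longlonglongrightarrow> B h h * 0"
      by (intro tendsto_mult tendsto_const LIMSEQ_subseq_LIMSEQ[OF _ r, of "\<lambda>n. 1 / real (Suc n)", unfolded o_def]
          LIMSEQ_Suc[OF lim_1_over_n])
    moreover have "(\<lambda>n. (B h (y (r n)))\<^sup>2) \<longlonglongrightarrow> (B h l)\<^sup>2"
      unfolding B_def by (intro tendsto_intros l)
    ultimately have "(B h l)\<^sup>2 \<le> B h h * 0" using * by (intro LIMSEQ_le) auto
    then have "B h l = 0" by simp
    then show ?thesis by (simp add: B_def inner_commute)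
  qed
  have "l \<in> dom_A \<and> A_L2 l = (- \<nu>) *\<^sub>R l"
    by (rule S_L2.weak_eigenvector_in_domain[OF A_L2_symmetric dom_A_dense weak])
  then have "eigenvalue (Hsp 2) (\<lambda>f k. - A_op \<kappa> J u f k) \<nu>"
    using \<open>norm l = 1\<close> by (intro eigenvalueI[of l]) auto
  then have "lam \<le> \<nu>" using lam by (simp add: principal_eigenvalue_def)
  then have "lam * (norm g)\<^sup>2 \<le> \<nu> * (norm g)\<^sup>2" by (rule mult_right_mono) simp
  then show ?thesis using \<nu>_le[OF g] by (simp add: q_def)
qed

lemma semigroup_decay:
  assumes "principal_eigenvalue (Hsp 2) (\<lambda>f k. - A_op \<kappa> J u f k) lam" "f \<in> Hsp 0" "t \<ge> 0"
  shows "Hnorm 0 (S t f) \<le> exp (- lam * t) * Hnorm 0 f"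
  using generated_semigroup.decay[OF generated_semigroup_L2 principal_eigenvalue_dissipative[OF assms(1)] dom_A_dense assms(3), of "L2_of f"]
    assms(2,3) by (simp add: norm_L2_eq_Hnorm coef_S_L2 L2_of_inverse)

lemma semigroup_coef_continuous:
  assumes "f \<in> Hsp 0"
  shows "continuous_on {0..} (\<lambda>t. S t f k)"
proof -
  have "continuous_on {0..} (\<lambda>t. coef (S_L2 S t (L2_of f)) k)"
    by (intro bounded_linear.continuous_on[OF bounded_linear_coef]
        generated_semigroup.orbit_continuous[OF generated_semigroup_L2])
  then show ?thesis
    by (rule continuous_on_cong[THEN iffD1, rotated -1]) (auto simp: coef_S_L2 L2_of_inverse assms)
qed

end

end

section \<open>Trigonometric test functions\<close>

text \<open>The weak formulation admits real test functions only, so exponentials enter through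
  their real and imaginary parts. The two-parameter family is closed under partial derivatives,
  which makes smoothness an induction.\<close>

definition trig :: "real \<Rightarrow> real \<Rightarrow> int ^ 'n \<Rightarrow> real ^ 'n::finite \<Rightarrow> real" where
  "trig a b k x = a * Re (e_basis k x) + b * Im (e_basis k x)"

lemma trig_has_derivative:
  "(trig a b k has_derivative (\<lambda>h. (h \<bullet> kvec k) * (b * Re (e_basis k x) - a * Im (e_basis k x)))) (at x)"
proof -
  have "((\<lambda>x. a * Re (e_basis k x) + b * Im (e_basis k x)) has_derivative
      (\<lambda>h. a * Re (\<i> * of_real (h \<bullet> kvec k) * e_basis k x) + b * Im (\<i> * of_real (h \<bullet> kvec k) * e_basis k x))) (at x)"
    by (intro has_derivative_add has_derivative_mult_right has_derivative_Re has_derivative_Im e_basis_has_derivative)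
  then show ?thesis by (simp add: trig_def[abs_def] algebra_simps)
qed

lemma partial_trig: "partial i (trig a b k) = trig (of_int (k $ i) * b) (- (of_int (k $ i) * a)) k"
  by (rule ext) (simp add: partial_eq[OF trig_has_derivative] inner_axis' trig_def algebra_simps)

lemma continuous_trig: "continuous_on A (trig a b k)"
  unfolding trig_def[abs_def] by (intro continuous_intros)

lemma smooth_trig: "smooth (trig a b k)"
proof -
  have "Ck m (trig a b k)" for m
    by (induction m arbitrary: a b)
      (auto simp: continuous_trig partial_trig intro: differentiableI[OF trig_has_derivative])
  then show ?thesis by (simp add: smooth_def)
qed

text \<open>\<open>ca a b\<close> and \<open>cb a b\<close> are the coefficients of
  \<open>trig a b k\<close> at the frequencies \<open>k\<close> and \<open>- k\<close>.\<close>

abbreviation ca :: "real \<Rightarrow> real \<Rightarrow> complex" where "ca a b \<equiv> Complex (a / 2) (- (b / 2))"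
abbreviation cb :: "real \<Rightarrow> real \<Rightarrow> complex" where "cb a b \<equiv> Complex (a / 2) (b / 2)"

text \<open>The value of the pairing of \<open>trig a b k\<close> with \<open>f\<close>; the
  conjugates appear because the pairing is conjugate linear in its first argument.\<close>

abbreviation mix :: "real \<Rightarrow> real \<Rightarrow> (int ^ 'n \<Rightarrow> complex) \<Rightarrow> int ^ 'n::finite \<Rightarrow> complex" where
  "mix a b f k \<equiv> cnj (ca a b) * f k + cnj (cb a b) * f (- k)"

lemma of_real_trig:
  "complex_of_real (trig a b k x) = ca a b * e_basis k x + cb a b * e_basis (- k) x"
  by (simp add: trig_def complex_eq_iff cnj_e_basis[symmetric])

lemma of_real_adv_trig:
  "complex_of_real (adv v (trig a b k) x) = ca a b * adv v (e_basis k) x + cb a b * adv v (e_basis (- k)) x"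
  by (simp add: adv_eq[OF trig_has_derivative] adv_e_basis complex_eq_iff cnj_e_basis[symmetric] algebra_simps)

lemma laplacian_trig: "laplacian (trig a b k) x = - (norm (kvec k))\<^sup>2 * trig a b k x"
proof -
  have "(norm (kvec k))\<^sup>2 = (\<Sum>i\<in>UNIV. (of_int (k $ i))\<^sup>2)"
    unfolding power2_norm_eq_inner inner_vec_def by (simp add: power2_eq_square)
  moreover have "partial i (partial i (trig a b k)) x = - ((of_int (k $ i))\<^sup>2 * trig a b k x)" for i
    unfolding partial_trig by (simp add: trig_def power2_eq_square algebra_simps)
  ultimately show ?thesis by (simp add: laplacian_def sum_negf sum_distrib_right)
qed

lemma of_real_laplacian_trig:
  "complex_of_real (laplacian (trig a b k) x) = (- of_real ((norm (kvec k))\<^sup>2)) * (ca a b * e_basis k x + cb a b * e_basis (- k) x)"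
  by (simp only: laplacian_trig of_real_mult of_real_trig of_real_minus)

lemma cint_of_real:
  assumes f: "continuous_on UNIV f" shows "cint (\<lambda>x. of_real (f x)) = of_real (LINT x:cube|lborel. f x)"
proof -
  have "cint (\<lambda>x. of_real (f x)) = (LINT x|lborel. complex_of_real (indicator cube x *\<^sub>R f x))"
    unfolding cint_def set_lebesgue_integral_def by (simp add: scaleR_conv_of_real)
  then show ?thesis
    unfolding set_lebesgue_integral_def
    using integral_bounded_linear[OF bounded_linear_of_real, of lborel "\<lambda>x. indicator cube x *\<^sub>R f x"] cube_integrable[OF f]
    by (simp add: set_integrable_def)
qed

lemma trig_test_function:
  assumes "k \<noteq> 0" shows "trig a b k \<in> test_functions"
proof -
  have "complex_of_real (LINT x:cube|lborel. trig a b k x) = cint (\<lambda>x. ca a b * e_basis k x + cb a b * e_basis (- k) x)"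
    by (simp only: cint_of_real[OF continuous_trig, symmetric] of_real_trig)
  also have "\<dots> = 0"
    using assms by (subst cint_add) (auto simp: cint_cmult cint_e_basis_eq_0 intro!: continuous_intros)
  finally have "(LINT x:cube|lborel. trig a b k x) = 0" by simp
  moreover have "periodic (trig a b k)" using periodic_e_basis[of k] by (simp add: periodic_def trig_def)
  ultimately show ?thesis by (simp add: test_functions_def smooth_trig)
qed

section \<open>The duality pairing\<close>

lemma fourier_square_summable:
  assumes "continuous_on UNIV f" shows "(\<lambda>m. (cmod (fourier f m))\<^sup>2) summable_on - {0}"
  using Bessel[OF assms finite_modes] by (intro summable_on_modesI) auto

lemma pairing_summable:
  "continuous_on UNIV g \<Longrightarrow> f \<in> Hsp 0 \<Longrightarrow> (\<lambda>k. cnj (fourier g k) * f k) summable_on - {0}"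
  by (intro cnj_mult_summable fourier_square_summable Hsp_0D(3))

lemma pairing_add:
  assumes "continuous_on UNIV g" "continuous_on UNIV h" "f \<in> Hsp 0"
  shows "pairing (\<lambda>x. g x + h x) f = pairing g f + pairing h f"
  unfolding pairing_def using infsum_add[OF pairing_summable[OF assms(1,3)] pairing_summable[OF assms(2,3)]]
  by (simp add: fourier_add assms distrib_right)

lemma pairing_cmult: "pairing (\<lambda>x. c * g x) f = cnj c * pairing g f"
  unfolding pairing_def by (simp add: fourier_cmult mult.assoc infsum_cmult_right')

lemma pairing_zero: "pairing (\<lambda>x. 0) f = 0"
  using pairing_cmult[of 0 "\<lambda>_. 0" f] by simp

lemma pairing_sum:
  assumes "\<And>i. i \<in> I \<Longrightarrow> continuous_on UNIV (g i)" "f \<in> Hsp 0"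
  shows "pairing (\<lambda>x. \<Sum>i\<in>I. g i x) f = (\<Sum>i\<in>I. pairing (g i) f)"
  using assms(1)
  by (induction I rule: infinite_finite_induct) (auto simp: pairing_zero pairing_add assms(2) continuous_on_sum)

lemma pairing_e_basis:
  fixes f :: "'n::finite distr"
  assumes "f 0 = 0" shows "pairing (e_basis k) f = f k"
proof -
  have "pairing (e_basis k) f = (\<Sum>\<^sub>\<infinity>m\<in>{k}. f m)"
    unfolding pairing_def fourier_e_basis using assms by (intro infsum_cong_neutral) auto
  then show ?thesis by simp
qed

lemma pairing_bound:
  assumes "continuous_on UNIV g" "f \<in> Hsp 0"
  shows "cmod (pairing g f) \<le> Hnorm 0 (fourier g) * Hnorm 0 f"
  unfolding pairing_def Hnorm_0 by (intro Cauchy_Schwarz_infsum fourier_square_summable Hsp_0D(3) assms)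

lemma pairing_adv:
  assumes v: "solenoidal v"
  shows "pairing (adv v (e_basis k)) f = - appl (adv_mat v) f k"
proof -
  have "cnj (adv_mat v k m) = - adv_mat v m k" for m
    using hermitian_uptoD[OF adv_mat_antihermitian[OF v], where m = m and k = k] by simp
  then show ?thesis
    unfolding pairing_def appl_def adv_mat_def[symmetric] by (simp add: infsum_uminus)
qed

section \<open>Bounded weakly continuous paths\<close>

text \<open>Finite partial sums are continuous and converge uniformly in time: the remainder is at
  most the square root of the tail of \<open>a\<close> times the common bound
  \<open>B\<close>.\<close>

lemma weakly_continuous_pairing:
  fixes T :: "real \<Rightarrow> 'n::finite distr"
  assumes a: "(\<lambda>k. (cmod (a k))\<^sup>2) summable_on - {0}"
    and T: "\<And>r. r \<in> X \<Longrightarrow> T r \<in> Hsp 0" "\<And>r. r \<in> X \<Longrightarrow> Hnorm 0 (T r) \<le> B"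
    and c: "\<And>k. continuous_on X (\<lambda>r. T r k)"
  shows "continuous_on X (\<lambda>r. \<Sum>\<^sub>\<infinity>k\<in>- {0}. cnj (a k) * T r k)"
proof (rule uniform_limit_theorem)
  show "\<forall>\<^sub>F N in sequentially. continuous_on X (\<lambda>r. \<Sum>k\<in>modes N. cnj (a k) * T r k)"
    by (intro always_eventually allI continuous_intros c)
  show "uniform_limit X (\<lambda>N r. \<Sum>k\<in>modes N. cnj (a k) * T r k) (\<lambda>r. \<Sum>\<^sub>\<infinity>k\<in>- {0}. cnj (a k) * T r k) sequentially"
  proof (rule uniform_limitI)
    fix e :: real assume e: "0 < e"
    define \<tau> where "\<tau> N = (\<Sum>\<^sub>\<infinity>k\<in>- {0} - modes N. (cmod (a k))\<^sup>2)" for N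
    have "\<tau> N = (\<Sum>\<^sub>\<infinity>k\<in>- {0}. (cmod (a k))\<^sup>2) - (\<Sum>k\<in>modes N. (cmod (a k))\<^sup>2)" for N
      using infsum_Diff[OF a _ modes_subset, of N] by (simp add: \<tau>_def)
    moreover have "(\<lambda>N. sqrt ((\<Sum>\<^sub>\<infinity>k\<in>- {0}. (cmod (a k))\<^sup>2) - (\<Sum>k\<in>modes N. (cmod (a k))\<^sup>2)) * B)
        \<longlonglongrightarrow> sqrt ((\<Sum>\<^sub>\<infinity>k\<in>- {0}. (cmod (a k))\<^sup>2) - (\<Sum>\<^sub>\<infinity>k\<in>- {0}. (cmod (a k))\<^sup>2)) * B"
      by (intro tendsto_intros sum_modes_tendsto a)
    ultimately have "\<forall>\<^sub>F N in sequentially. sqrt (\<tau> N) * B < e"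
      using e by (intro order_tendstoD(2)) auto
    then show "\<forall>\<^sub>F N in sequentially. \<forall>r\<in>X. dist (\<Sum>k\<in>modes N. cnj (a k) * T r k) (\<Sum>\<^sub>\<infinity>k\<in>- {0}. cnj (a k) * T r k) < e"
    proof eventually_elim
      case (elim N)
      show ?case
      proof
        fix r assume r: "r \<in> X"
        have sT: "(\<lambda>k. (cmod (T r k))\<^sup>2) summable_on - {0}" by (rule Hsp_0D(3)[OF T(1)[OF r]])
        have s: "(\<lambda>k. cnj (a k) * T r k) summable_on - {0}"
          by (intro cnj_mult_summable a sT)
        have "(\<Sum>\<^sub>\<infinity>k\<in>- {0}. cnj (a k) * T r k) - (\<Sum>k\<in>modes N. cnj (a k) * T r k) = (\<Sum>\<^sub>\<infinity>k\<in>- {0} - modes N. cnj (a k) * T r k)"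
          using infsum_Diff[OF s _ modes_subset, of N] by simp
        note d = this
        have "dist (\<Sum>k\<in>modes N. cnj (a k) * T r k) (\<Sum>\<^sub>\<infinity>k\<in>- {0}. cnj (a k) * T r k)
            = cmod (\<Sum>\<^sub>\<infinity>k\<in>- {0} - modes N. cnj (a k) * T r k)"
          by (subst dist_commute) (simp only: dist_norm d)
        also have "\<dots> \<le> sqrt (\<tau> N) * sqrt (\<Sum>\<^sub>\<infinity>k\<in>- {0} - modes N. (cmod (T r k))\<^sup>2)"
          unfolding \<tau>_def
          by (intro Cauchy_Schwarz_infsum summable_on_subset_banach[OF a] summable_on_subset_banach[OF sT]) auto
        also have "\<dots> \<le> sqrt (\<tau> N) * B"
        proof (intro mult_left_mono)
          have "sqrt (\<Sum>\<^sub>\<infinity>k\<in>- {0} - modes N. (cmod (T r k))\<^sup>2) \<le> Hnorm 0 (T r)"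
            unfolding Hnorm_0
            by (intro real_sqrt_le_mono infsum_mono2 sT summable_on_subset_banach[OF sT]) auto
          then show "sqrt (\<Sum>\<^sub>\<infinity>k\<in>- {0} - modes N. (cmod (T r k))\<^sup>2) \<le> B" using T(2)[OF r] by linarith
          show "0 \<le> sqrt (\<tau> N)" by (simp add: \<tau>_def infsum_nonneg)
        qed
        also have "\<dots> < e" by (rule elim)
        finally show "dist (\<Sum>k\<in>modes N. cnj (a k) * T r k) (\<Sum>\<^sub>\<infinity>k\<in>- {0}. cnj (a k) * T r k) < e" .
      qed
    qed
  qed
qed auto

text \<open>A continuous function exceeding \<open>c\<close> at one point does so on a nondegenerate
  interval, which cannot lie in a null set.\<close>

lemma AE_le_imp_le:
  fixes h :: "real \<Rightarrow> real"
  assumes h: "continuous_on {a..b} h" and ab: "a < b" and AE: "AE r in lebesgue_on {a..b}. h r \<le> c" and t: "t \<in> {a..b}"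
  shows "h t \<le> c"
proof (rule ccontr)
  assume "\<not> h t \<le> c"
  then have "0 < h t - c" by simp
  then obtain d where d: "d > 0" "\<And>s. s \<in> {a..b} \<Longrightarrow> dist s t < d \<Longrightarrow> dist (h s) (h t) < h t - c"
    using h t unfolding continuous_on_iff by metis
  define l where "l = max a (t - d / 2)"
  define m where "m = min b (t + d / 2)"
  have lm: "l < m" "a \<le> l" "m \<le> b" "t - d < l" "m < t + d" using d(1) ab t by (auto simp: l_def m_def)
  have "h s > c" if "s \<in> {l..m}" for s
  proof -
    have "s \<in> {a..b}" "dist s t < d" using that lm by (auto simp: dist_real_def)
    from d(2)[OF this] show ?thesis by (auto simp: dist_real_def)
  qed
  moreover have "AE r in lebesgue. r \<in> {a..b} \<longrightarrow> h r \<le> c"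
    using AE by (simp add: AE_restrict_space_iff)
  then obtain N where N: "N \<in> null_sets lebesgue" "{r. \<not> (r \<in> {a..b} \<longrightarrow> h r \<le> c)} \<subseteq> N"
    unfolding eventually_ae_filter by auto
  ultimately have "{l..m} \<subseteq> N" using lm by force
  then have "emeasure lebesgue {l..m} \<le> emeasure lebesgue N" using N by (intro emeasure_mono) auto
  then have "emeasure lebesgue {l..m} = 0" using N by (auto simp: null_sets_def)
  then show False using lm by simp
qed

text \<open>The integral of a non-integrable function is 0 by convention, so the bound holds without
  measurability of \<open>f\<close>. It is applied before the integrands of the weak equation are
  known to be measurable.\<close>

lemma LINT_norm_le:
  fixes f :: "real \<Rightarrow> complex"
  assumes st: "s \<le> t" and AE: "AE r in lebesgue_on {s..t}. cmod (f r) \<le> M" and M: "0 \<le> M"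
  shows "cmod (LINT r|lebesgue_on {s..t}. f r) \<le> M * (t - s)"
proof (cases "integrable (lebesgue_on {s..t}) f")
  case True
  have c: "integrable (lebesgue_on {s..t}) (\<lambda>_. M)" by (intro continuous_imp_integrable_real continuous_on_const)
  have "cmod (LINT r|lebesgue_on {s..t}. f r) \<le> (LINT r|lebesgue_on {s..t}. cmod (f r))"
    by (rule integral_norm_bound)
  also have "\<dots> \<le> (LINT r|lebesgue_on {s..t}. M)"
    using True c AE by (intro integral_mono_AE) auto
  also have "\<dots> = M * (t - s)"
    using lebesgue_integral_eq_integral[OF c] st by simp
  finally show ?thesis .
qed (use st M in \<open>simp add: not_integrable_integral_eq\<close>)

lemma AE_lebesgue_on_subset:
  assumes "AE r in lebesgue_on S. P r" "S' \<subseteq> S" "S \<in> sets lebesgue" "S' \<in> sets lebesgue"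
  shows "AE r in lebesgue_on S'. P r"
  using assms by (auto simp: AE_restrict_space_iff elim!: eventually_mono)

section \<open>The energy equality\<close>

text \<open>One realisation of the noise and of the solution: \<open>\<eta>\<close> consists of
  continuous real paths, and the energy argument is carried out path by path.\<close>

locale transport = diffusion \<kappa> J u for \<kappa> :: real and J :: "'j set" and u :: "'j \<Rightarrow> real ^ 'n::finite \<Rightarrow> real ^ 'n" +
  fixes \<eta> :: "'j \<Rightarrow> real \<Rightarrow> real" and v :: "real \<Rightarrow> real ^ 'n \<Rightarrow> real ^ 'n" and T :: "real \<Rightarrow> 'n distr"
  assumes v_def: "v r x = (\<Sum>j\<in>J. \<eta> j r *\<^sub>R u j x)"
    and eta: "j \<in> J \<Longrightarrow> continuous_on {0..1} (\<eta> j)"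
    and T_L2: "t \<in> {0..1} \<Longrightarrow> T t \<in> Hsp 0"
    and T_Linf: "Linf_path 0 T"
    and T_H1: "L2_path 1 T"
    and weak: "\<phi> \<in> test_functions \<Longrightarrow> 0 \<le> s \<Longrightarrow> s < t \<Longrightarrow> t \<le> 1 \<Longrightarrow>
           pairing (\<lambda>x. of_real (\<phi> x)) (T t) = pairing (\<lambda>x. of_real (\<phi> x)) (T s)
             + (LINT r|lebesgue_on {s..t}. pairing (\<lambda>x. of_real (adv (v r) \<phi> x)) (T r))
             + of_real \<kappa> * (LINT r|lebesgue_on {s..t}. pairing (\<lambda>x. of_real (laplacian \<phi> x)) (T r))"
begin

definition adv_rate :: "int ^ 'n \<Rightarrow> real \<Rightarrow> complex" where
  "adv_rate k r = (\<Sum>j\<in>J. of_real (\<eta> j r) * pairing (adv (u j) (e_basis k)) (T r))"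

lemma continuous_adv_u: "j \<in> J \<Longrightarrow> continuous_on UNIV (adv (u j) (e_basis k))"
  by (intro continuous_adv_e_basis solenoidal_continuous u)

lemma adv_v_e_basis: "adv (v r) (e_basis k) = (\<lambda>x. \<Sum>j\<in>J. of_real (\<eta> j r) * adv (u j) (e_basis k) x)"
proof
  fix x
  have "v r x \<bullet> kvec k = (\<Sum>j\<in>J. \<eta> j r * (u j x \<bullet> kvec k))"
    by (simp add: v_def inner_sum_left)
  then show "adv (v r) (e_basis k) x = (\<Sum>j\<in>J. of_real (\<eta> j r) * adv (u j) (e_basis k) x)"
    by (simp add: adv_e_basis sum_distrib_left sum_distrib_right mult_ac)
qed

lemma continuous_adv_v: "continuous_on UNIV (adv (v r) (e_basis k))"
  unfolding adv_v_e_basis by (intro continuous_intros continuous_adv_u)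

lemma pairing_adv_v: "r \<in> {0..1} \<Longrightarrow> pairing (adv (v r) (e_basis k)) (T r) = adv_rate k r"
  unfolding adv_v_e_basis adv_rate_def
  by (subst pairing_sum) (auto simp: pairing_cmult T_L2 intro!: continuous_intros continuous_adv_u)

lemma weak_trig:
  assumes k: "k \<noteq> 0" and st: "0 \<le> s" "s < t" "t \<le> 1"
  shows "mix a b (T t) k = mix a b (T s) k
     + (LINT r|lebesgue_on {s..t}. mix a b (\<lambda>k. adv_rate k r) k)
     + of_real \<kappa> * (LINT r|lebesgue_on {s..t}. (- of_real ((norm (kvec k))\<^sup>2)) * (mix a b (T r) k))"
proof -
  have ph: "pairing (\<lambda>x. of_real (trig a b k x)) (T r) = mix a b (T r) k"
    if "r \<in> {0..1}" for r
    unfolding of_real_trig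
    using T_L2[OF that] Hsp_0D(1)[OF T_L2[OF that]]
    by (subst pairing_add) (auto simp: pairing_cmult pairing_e_basis intro!: continuous_intros)
  have pa: "pairing (\<lambda>x. of_real (adv (v r) (trig a b k) x)) (T r) = mix a b (\<lambda>k. adv_rate k r) k"
    if "r \<in> {0..1}" for r
    unfolding of_real_adv_trig
    using T_L2[OF that] pairing_adv_v[OF that]
    by (subst pairing_add) (auto simp: pairing_cmult intro!: continuous_intros continuous_adv_v)
  have pl: "pairing (\<lambda>x. of_real (laplacian (trig a b k) x)) (T r)
      = (- of_real ((norm (kvec k))\<^sup>2)) * (mix a b (T r) k)"
    if "r \<in> {0..1}" for r
    using ph[OF that] unfolding of_real_laplacian_trig pairing_cmult of_real_trig by simp
  have i1: "(LINT r|lebesgue_on {s..t}. pairing (\<lambda>x. of_real (adv (v r) (trig a b k) x)) (T r))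
      = (LINT r|lebesgue_on {s..t}. mix a b (\<lambda>k. adv_rate k r) k)"
    using st by (intro Bochner_Integration.integral_cong pa) auto
  have i2: "(LINT r|lebesgue_on {s..t}. pairing (\<lambda>x. of_real (laplacian (trig a b k) x)) (T r))
      = (LINT r|lebesgue_on {s..t}. (- of_real ((norm (kvec k))\<^sup>2)) * (mix a b (T r) k))"
    using st by (intro Bochner_Integration.integral_cong pl) auto
  show ?thesis
    using weak[OF trig_test_function[OF k] st, of a b] st unfolding i1 i2 by (simp add: ph)
qed

lemma Linf_bound: obtains B where "0 \<le> B" "AE r in lebesgue_on {0..1}. Hnorm 0 (T r) \<le> B"
proof -
  obtain B where "AE r in lebesgue_on {0..1}. T r \<in> Hsp 0 \<and> Hnorm 0 (T r) \<le> B"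
    using T_Linf by (auto simp: Linf_path_def)
  then have "AE r in lebesgue_on {0..1}. Hnorm 0 (T r) \<le> max B 0" by eventually_elim auto
  then show ?thesis using that[of "max B 0"] by simp
qed

lemma eta_bound: obtains E where "0 \<le> E" "\<And>j r. j \<in> J \<Longrightarrow> r \<in> {0..1} \<Longrightarrow> \<bar>\<eta> j r\<bar> \<le> E"
proof -
  have "\<exists>E. \<forall>r\<in>{0..1}. \<bar>\<eta> j r\<bar> \<le> E" if "j \<in> J" for j
  proof -
    have "compact (\<eta> j ` {0..1})" by (intro compact_continuous_image eta that) simp
    then show ?thesis using compact_imp_bounded bounded_iff by (metis imageI real_norm_def)
  qed
  then obtain E where E: "\<And>j r. j \<in> J \<Longrightarrow> r \<in> {0..1} \<Longrightarrow> \<bar>\<eta> j r\<bar> \<le> E j" by metis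
  have "\<bar>\<eta> j r\<bar> \<le> (\<Sum>j\<in>J. \<bar>E j\<bar>)" if "j \<in> J" "r \<in> {0..1}" for j r
    using E[OF that] member_le_sum[of j J "\<lambda>j. \<bar>E j\<bar>"] J that(1) by simp
  then show ?thesis using that[of "\<Sum>j\<in>J. \<bar>E j\<bar>"] by (simp add: sum_nonneg)
qed

section \<open>Regularity in time of the Fourier coefficients\<close>

lemma adv_rate_bound: "\<exists>M\<ge>0. AE r in lebesgue_on {0..1}. cmod (adv_rate k r) \<le> M"
proof -
  obtain B where B: "0 \<le> B" "AE r in lebesgue_on {0..1}. Hnorm 0 (T r) \<le> B" by (rule Linf_bound) blast
  obtain E where E: "0 \<le> E" "\<And>j r. j \<in> J \<Longrightarrow> r \<in> {0..1} \<Longrightarrow> \<bar>\<eta> j r\<bar> \<le> E" by (rule eta_bound) blast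
  let ?M = "\<Sum>j\<in>J. E * (Hnorm 0 (fourier (adv (u j) (e_basis k))) * B)"
  have "AE r in lebesgue_on {0..1}. r \<in> {0..1}" by (rule AE_I2) simp
  with B(2) have "AE r in lebesgue_on {0..1}. cmod (adv_rate k r) \<le> ?M"
  proof eventually_elim
    case (elim r)
    have "cmod (of_real (\<eta> j r) * pairing (adv (u j) (e_basis k)) (T r)) \<le> E * (Hnorm 0 (fourier (adv (u j) (e_basis k))) * B)"
      if j: "j \<in> J" for j
    proof -
      have "cmod (pairing (adv (u j) (e_basis k)) (T r)) \<le> Hnorm 0 (fourier (adv (u j) (e_basis k))) * Hnorm 0 (T r)"
        by (intro pairing_bound continuous_adv_u j T_L2 elim)
      also have "\<dots> \<le> Hnorm 0 (fourier (adv (u j) (e_basis k))) * B" using elim by (intro mult_left_mono) auto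
      finally show ?thesis unfolding norm_mult using E j elim by (intro mult_mono) auto
    qed
    then show ?case unfolding adv_rate_def by (intro sum_norm_le)
  qed
  moreover have "0 \<le> ?M" using B E by (intro sum_nonneg mult_nonneg_nonneg) auto
  ultimately show ?thesis by blast
qed

text \<open>First stage of a bootstrap: the essential bound on the solution controls the integrals
  in the weak equation crudely. The resulting continuity makes the integrands continuous, and then
  the coefficients are continuously differentiable.\<close>

lemma T_coef_Lipschitz:
  assumes k: "k \<noteq> 0"
  obtains M where "\<And>s t. 0 \<le> s \<Longrightarrow> s < t \<Longrightarrow> t \<le> 1 \<Longrightarrow> cmod (T t k - T s k) \<le> M * (t - s)"
proof -
  obtain M1 where M1: "0 \<le> M1" "AE r in lebesgue_on {0..1}. cmod (adv_rate k r) \<le> M1" using adv_rate_bound by blast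
  obtain M2 where M2: "0 \<le> M2" "AE r in lebesgue_on {0..1}. cmod (adv_rate (- k) r) \<le> M2" using adv_rate_bound by blast
  obtain B where B: "0 \<le> B" "AE r in lebesgue_on {0..1}. Hnorm 0 (T r) \<le> B" by (rule Linf_bound) blast
  define Q where "Q = M1 + M2 + \<kappa> * ((norm (kvec k))\<^sup>2 * (B + B))"
  have est: "cmod (cnj (ca a b) * (T t k - T s k) + cnj (cb a b) * (T t (- k) - T s (- k))) \<le> Q * (t - s)"
    if st: "0 \<le> s" "s < t" "t \<le> 1" and c: "cmod (ca a b) \<le> 1" "cmod (cb a b) \<le> 1" for s t a b
  proof -
    have sub: "{s..t} \<subseteq> {0..1}" using st by auto
    have c2: "cmod (x * y) \<le> z" if "cmod x \<le> 1" "cmod y \<le> z" for x y z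
      unfolding norm_mult using mult_mono[OF that] by simp
    have "AE r in lebesgue_on {s..t}. cmod (adv_rate k r) \<le> M1" by (rule AE_lebesgue_on_subset[OF M1(2) sub]) auto
    moreover have "AE r in lebesgue_on {s..t}. cmod (adv_rate (- k) r) \<le> M2" by (rule AE_lebesgue_on_subset[OF M2(2) sub]) auto
    ultimately have "AE r in lebesgue_on {s..t}. cmod (mix a b (\<lambda>k. adv_rate k r) k) \<le> M1 + M2"
    proof eventually_elim
      case (elim r)
      then show ?case using c by (intro norm_triangle_le add_mono c2) auto
    qed
    then have l1: "cmod (LINT r|lebesgue_on {s..t}. mix a b (\<lambda>k. adv_rate k r) k) \<le> (M1 + M2) * (t - s)"
      using st M1 M2 by (intro LINT_norm_le) auto
    have "AE r in lebesgue_on {s..t}. r \<in> {s..t}" by (rule AE_I2) simp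
    moreover have "AE r in lebesgue_on {s..t}. Hnorm 0 (T r) \<le> B" by (rule AE_lebesgue_on_subset[OF B(2) sub]) auto
    ultimately have "AE r in lebesgue_on {s..t}. cmod ((- of_real ((norm (kvec k))\<^sup>2)) * (mix a b (T r) k))
        \<le> (norm (kvec k))\<^sup>2 * (B + B)"
    proof eventually_elim
      case (elim r)
      then have r: "r \<in> {0..1}" using sub by auto
      have "cmod (T r m) \<le> B" for m
        using cmod_coef_le_norm[of "L2_of (T r)" m] elim by (simp add: L2_of_inverse T_L2[OF r] Hnorm_L2_of)
      then have "cmod (mix a b (T r) k) \<le> B + B"
        using c by (intro norm_triangle_le add_mono c2) auto
      then show ?case by (simp add: norm_mult norm_power mult_left_mono)
    qed
    then have l2: "cmod (LINT r|lebesgue_on {s..t}. (- of_real ((norm (kvec k))\<^sup>2)) * (mix a b (T r) k))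
        \<le> (norm (kvec k))\<^sup>2 * (B + B) * (t - s)"
      using st B by (intro LINT_norm_le) auto
    have "cnj (ca a b) * (T t k - T s k) + cnj (cb a b) * (T t (- k) - T s (- k))
       = (LINT r|lebesgue_on {s..t}. mix a b (\<lambda>k. adv_rate k r) k)
       + of_real \<kappa> * (LINT r|lebesgue_on {s..t}. (- of_real ((norm (kvec k))\<^sup>2)) * (mix a b (T r) k))"
    proof -
      have *: "c * (x - x') + d * (y - y') = I1 + I2" if "c * x + d * y = c * x' + d * y' + I1 + I2"
        for c d x x' y y' I1 I2 :: complex using that by (simp add: algebra_simps)
      show ?thesis by (rule *[OF weak_trig[OF k st]])
    qed
    also have "cmod \<dots> \<le> (M1 + M2) * (t - s) + \<kappa> * ((norm (kvec k))\<^sup>2 * (B + B) * (t - s))"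
      using l1 l2 kappa by (intro norm_triangle_le add_mono) (auto simp: norm_mult intro!: mult_left_mono)
    also have "\<dots> = Q * (t - s)" by (simp add: Q_def algebra_simps)
    finally show ?thesis .
  qed
  have "cmod (T t k - T s k) \<le> (2 * Q) * (t - s)" if st: "0 \<le> s" "s < t" "t \<le> 1" for s t
  proof -
    let ?x = "T t k - T s k" and ?y = "T t (- k) - T s (- k)"
    \<comment> \<open>The coefficient at \<open>k\<close> is recovered from the cosine and sine
      tests; conjugate linearity turns cos + i sin into the combination with \<open>- \<i>\<close>.
      The two tests explain the factor 2 in the bound.\<close>
    have "?x = (cnj (ca 1 0) * ?x + cnj (cb 1 0) * ?y) - \<i> * (cnj (ca 0 1) * ?x + cnj (cb 0 1) * ?y)"
      by (simp add: complex_eq_iff)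
    also have "cmod \<dots> \<le> Q * (t - s) + Q * (t - s)"
    proof (intro order_trans[OF norm_triangle_ineq4] add_mono)
      show "cmod (cnj (ca 1 0) * ?x + cnj (cb 1 0) * ?y) \<le> Q * (t - s)"
        by (intro est st) (auto simp: cmod_def power2_eq_square)
      have "cmod (cnj (ca 0 1) * ?x + cnj (cb 0 1) * ?y) \<le> Q * (t - s)"
        by (intro est st) (auto simp: cmod_def power2_eq_square)
      then show "cmod (\<i> * (cnj (ca 0 1) * ?x + cnj (cb 0 1) * ?y)) \<le> Q * (t - s)" by (simp add: norm_mult)
    qed
    finally show ?thesis by (simp add: algebra_simps)
  qed
  then show ?thesis using that by blast
qed

lemma T_coef_continuous: "continuous_on {0..1} (\<lambda>t. T t k)"
proof (cases "k = 0")
  case True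
  then have "continuous_on {0..1} (\<lambda>t. T t k) \<longleftrightarrow> continuous_on {0..1} (\<lambda>t::real. 0 :: complex)"
    by (intro continuous_on_cong) (auto simp: Hsp_0D(1)[OF T_L2])
  then show ?thesis by simp
next
  case False
  obtain M where M: "\<And>s t. 0 \<le> s \<Longrightarrow> s < t \<Longrightarrow> t \<le> 1 \<Longrightarrow> cmod (T t k - T s k) \<le> M * (t - s)"
    using T_coef_Lipschitz[OF False] by blast
  have M': "cmod (T t k - T s k) \<le> M * \<bar>t - s\<bar>" if "s \<in> {0..1}" "t \<in> {0..1}" for s t
    using M[of s t] M[of t s] that by (cases s t rule: linorder_cases) (auto simp: norm_minus_commute)
  have L: "dist (T t k) (T s k) \<le> \<bar>M\<bar> * dist t s" if "s \<in> {0..1}" "t \<in> {0..1}" for s t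
  proof -
    have "M * \<bar>t - s\<bar> \<le> \<bar>M\<bar> * \<bar>t - s\<bar>" by (intro mult_right_mono) auto
    with M'[OF that] show ?thesis unfolding dist_norm real_norm_def by (rule order_trans)
  qed
  have "\<bar>M\<bar>-lipschitz_on {0..1} (\<lambda>t. T t k)" by (intro lipschitz_onI L) auto
  then show ?thesis by (rule lipschitz_on_continuous_on)
qed

text \<open>The truncated norms are continuous in time, so the essential bound holds for each of
  them at every time, and hence for the full norm.\<close>

lemma T_bounded: obtains B where "0 \<le> B" "\<And>r. r \<in> {0..1} \<Longrightarrow> Hnorm 0 (T r) \<le> B"
proof -
  obtain B where B: "0 \<le> B" "AE r in lebesgue_on {0..1}. Hnorm 0 (T r) \<le> B" by (rule Linf_bound) blast
  have "Hnorm 0 (T t) \<le> B" if t: "t \<in> {0..1}" for t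
    unfolding Hnorm_le_iff[OF T_L2[OF t]]
  proof
    fix N
    show "sqrt (\<Sum>k\<in>modes N. sob_term 0 (T t) k) \<le> B"
    proof (rule AE_le_imp_le[of 0 1 "\<lambda>t. sqrt (\<Sum>k\<in>modes N. sob_term 0 (T t) k)"])
      show "continuous_on {0..1} (\<lambda>t. sqrt (\<Sum>k\<in>modes N. sob_term 0 (T t) k))"
        by (intro continuous_intros T_coef_continuous)
      have "AE r in lebesgue_on {0..1}. r \<in> {0..1}" by (rule AE_I2) simp
      with B(2) show "AE r in lebesgue_on {0..1}. sqrt (\<Sum>k\<in>modes N. sob_term 0 (T r) k) \<le> B"
      proof eventually_elim
        case (elim r)
        then show ?case using Hnorm_modes_le[OF T_L2[of r], of N] by linarith
      qed
    qed (use t in auto)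
  qed
  then show ?thesis using that B(1) by blast
qed

lemma adv_rate_continuous: "continuous_on {0..1} (adv_rate k)"
proof -
  obtain B where B: "\<And>r. r \<in> {0..1} \<Longrightarrow> Hnorm 0 (T r) \<le> B" by (rule T_bounded) blast
  have "continuous_on {0..1} (\<lambda>r. pairing (adv (u j) (e_basis k)) (T r))" if "j \<in> J" for j
    unfolding pairing_def
    by (rule weakly_continuous_pairing[OF fourier_square_summable[OF continuous_adv_u[OF that]] T_L2 B T_coef_continuous])
  then show ?thesis unfolding adv_rate_def[abs_def] by (intro continuous_intros eta)
qed

definition coef_rate :: "int ^ 'n \<Rightarrow> real \<Rightarrow> complex" where
  "coef_rate k r = adv_rate k r - of_real (\<kappa> * (norm (kvec k))\<^sup>2) * T r k"

lemma coef_rate_continuous: "continuous_on {0..1} (coef_rate k)"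
  unfolding coef_rate_def[abs_def] by (intro continuous_intros adv_rate_continuous T_coef_continuous)

lemma T_coef_integral:
  assumes k: "k \<noteq> 0" and t: "0 < t" "t \<le> 1"
  shows "T t k = T 0 k + integral {0..t} (coef_rate k)"
proof -
  have sub: "{0..t} \<subseteq> {0..1}" using t by auto
  have int: "integrable (lebesgue_on {0..t}) f" if "continuous_on {0..1} f" for f :: "real \<Rightarrow> complex"
    by (intro continuous_imp_integrable_real continuous_on_subset[OF that sub])
  note ip = int[OF adv_rate_continuous] and iT = int[OF T_coef_continuous]
  let ?I = "\<lambda>f. (LINT r|lebesgue_on {0..t}. f r)"
  define n2 where "n2 = complex_of_real ((norm (kvec k))\<^sup>2)"
  have eq: "mix a b (T t) k = mix a b (T 0) k
     + (cnj (ca a b) * ?I (adv_rate k) + cnj (cb a b) * ?I (adv_rate (- k)))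
     - of_real \<kappa> * n2 * (cnj (ca a b) * ?I (\<lambda>r. T r k) + cnj (cb a b) * ?I (\<lambda>r. T r (- k)))" for a b
  proof -
    have i1: "?I (\<lambda>r. mix a b (\<lambda>k. adv_rate k r) k) = cnj (ca a b) * ?I (adv_rate k) + cnj (cb a b) * ?I (adv_rate (- k))"
      using ip by (subst Bochner_Integration.integral_add) auto
    have i2: "?I (\<lambda>r. (- n2) * (mix a b (T r) k))
        = (- n2) * (cnj (ca a b) * ?I (\<lambda>r. T r k) + cnj (cb a b) * ?I (\<lambda>r. T r (- k)))"
      using iT by (simp only: integral_mult_right_zero) (subst Bochner_Integration.integral_add, auto)
    show ?thesis
      unfolding weak_trig[OF k order_refl t, of a b] n2_def[symmetric] i1 i2 by simp
  qed
  \<comment> \<open>The same cosine and sine combination isolates the coefficient at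
    \<open>k\<close>, now in an identity instead of an estimate.\<close>
  have split: "x = (cnj (ca 1 0) * x + cnj (cb 1 0) * y) - \<i> * (cnj (ca 0 1) * x + cnj (cb 0 1) * y)" for x y
    by (simp add: complex_eq_iff)
  let ?L = "\<lambda>x y a b. cnj (ca a b) * x + cnj (cb a b) * y"
  have L: "?L (T t k) (T t (- k)) a b = ?L (T 0 k + ?I (adv_rate k) - of_real \<kappa> * n2 * ?I (\<lambda>r. T r k))
      (T 0 (- k) + ?I (adv_rate (- k)) - of_real \<kappa> * n2 * ?I (\<lambda>r. T r (- k))) a b" for a b
    unfolding eq[of a b] by (simp add: algebra_simps)
  have "T t k = ?L (T t k) (T t (- k)) 1 0 - \<i> * ?L (T t k) (T t (- k)) 0 1" by (rule split)
  also have "\<dots> = T 0 k + ?I (adv_rate k) - of_real \<kappa> * n2 * ?I (\<lambda>r. T r k)"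
    unfolding L by (rule split[symmetric])
  also have "\<dots> = T 0 k + ?I (coef_rate k)"
  proof -
    have "?I (coef_rate k) = ?I (adv_rate k) - ?I (\<lambda>r. of_real (\<kappa> * (norm (kvec k))\<^sup>2) * T r k)"
      unfolding coef_rate_def using ip iT by (intro Bochner_Integration.integral_diff) auto
    then show ?thesis by (simp add: n2_def)
  qed
  also have "?I (coef_rate k) = integral {0..t} (coef_rate k)"
    by (intro lebesgue_integral_eq_integral int coef_rate_continuous) auto
  finally show ?thesis .
qed

lemma T_coef_derivative:
  assumes k: "k \<noteq> 0" and t: "t \<in> {0..1}"
  shows "((\<lambda>r. T r k) has_vector_derivative coef_rate k t) (at t within {0..1})"
proof -
  have d: "((\<lambda>r. T 0 k + integral {0..r} (coef_rate k)) has_vector_derivative 0 + coef_rate k t) (at t within {0..1})"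
    by (intro has_vector_derivative_add has_vector_derivative_const integral_has_vector_derivative coef_rate_continuous t)
  have "T r k = T 0 k + integral {0..r} (coef_rate k)" if "r \<in> {0..1}" for r
    using T_coef_integral[OF k, of r] that by (cases "r = 0") auto
  from has_vector_derivative_transform[OF t this d] show ?thesis by simp
qed


section \<open>Energies of the truncations and their limit\<close>

definition trunc_energy :: "nat \<Rightarrow> real \<Rightarrow> real" where
  "trunc_energy N t = (\<Sum>k\<in>modes N. (cmod (T t k))\<^sup>2)"

definition energy_rate :: "nat \<Rightarrow> real \<Rightarrow> real" where
  "energy_rate N r = 2 * Re (\<Sum>k\<in>modes N. cnj (T r k) * coef_rate k r)"

lemma trunc_energy_derivative:
  assumes t: "t \<in> {0..1}"
  shows "(trunc_energy N has_vector_derivative energy_rate N t) (at t within {0..1})"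
proof -
  have "((\<lambda>t. T t k \<bullet> T t k) has_vector_derivative 2 * Re (cnj (T t k) * coef_rate k t)) (at t within {0..1})"
    if "k \<in> modes N" for k
  proof -
    have "k \<noteq> 0" using that by (auto simp: modes_def)
    then have "((\<lambda>t. T t k \<bullet> T t k) has_vector_derivative T t k \<bullet> coef_rate k t + coef_rate k t \<bullet> T t k) (at t within {0..1})"
      by (intro bounded_bilinear.has_vector_derivative[OF bounded_bilinear_inner] T_coef_derivative t)
    then show ?thesis by (simp add: inner_complex_def algebra_simps)
  qed
  then have "((\<lambda>t. \<Sum>k\<in>modes N. T t k \<bullet> T t k) has_vector_derivative (\<Sum>k\<in>modes N. 2 * Re (cnj (T t k) * coef_rate k t))) (at t within {0..1})"
    by (intro has_vector_derivative_sum)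
  then show ?thesis
    by (simp add: trunc_energy_def[abs_def] energy_rate_def power2_norm_eq_inner sum_distrib_left)
qed

lemma energy_rate_continuous: "continuous_on {0..1} (energy_rate N)"
  unfolding energy_rate_def[abs_def] by (intro continuous_intros T_coef_continuous coef_rate_continuous)

lemma trunc_energy_integral:
  assumes st: "0 \<le> s" "s \<le> t" "t \<le> 1"
  shows "(LINT r|lebesgue_on {s..t}. energy_rate N r) = trunc_energy N t - trunc_energy N s"
proof -
  have sub: "{s..t} \<subseteq> {0..1}" using st by auto
  have "(energy_rate N has_integral (trunc_energy N t - trunc_energy N s)) {s..t}"
    using st sub by (intro fundamental_theorem_of_calculus has_vector_derivative_within_subset[OF trunc_energy_derivative sub]) auto
  moreover have "(LINT r|lebesgue_on {s..t}. energy_rate N r) = integral {s..t} (energy_rate N)"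
    by (intro lebesgue_integral_eq_integral continuous_imp_integrable_real continuous_on_subset[OF energy_rate_continuous sub]) auto
  ultimately show ?thesis by (simp add: integral_unique)
qed

lemma energy_rate_eq:
  "energy_rate N r = - 2 * \<kappa> * (\<Sum>k\<in>modes N. sob_term 1 (T r) k)
     - 2 * (\<Sum>j\<in>J. \<eta> j r * Re (\<Sum>k\<in>modes N. cnj (T r k) * appl (adv_mat (u j)) (T r) k))"
proof -
  have "cnj (T r k) * coef_rate k r = - (\<Sum>j\<in>J. of_real (\<eta> j r) * (cnj (T r k) * appl (adv_mat (u j)) (T r) k))
      - of_real (\<kappa> * (sob_term 1 (T r) k))" if "k \<in> modes N" for k
  proof -
    have "adv_rate k r = - (\<Sum>j\<in>J. of_real (\<eta> j r) * appl (adv_mat (u j)) (T r) k)"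
      unfolding adv_rate_def sum_negf[symmetric] by (intro sum.cong refl) (simp add: pairing_adv u)
    then have 1: "cnj (T r k) * adv_rate k r = - (\<Sum>j\<in>J. of_real (\<eta> j r) * (cnj (T r k) * appl (adv_mat (u j)) (T r) k))"
      by (simp add: sum_distrib_left mult_ac)
    have "cnj (T r k) * (of_real (\<kappa> * (norm (kvec k))\<^sup>2) * T r k) = of_real (\<kappa> * (norm (kvec k))\<^sup>2) * (T r k * cnj (T r k))"
      by (simp only: mult_ac)
    also have "T r k * cnj (T r k) = of_real ((cmod (T r k))\<^sup>2)" by (simp only: complex_norm_square)
    finally have 2: "cnj (T r k) * (of_real (\<kappa> * (norm (kvec k))\<^sup>2) * T r k) = of_real (\<kappa> * (sob_term 1 (T r) k))"
      by (simp add: powr_numeral mult.assoc)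
    show ?thesis unfolding coef_rate_def right_diff_distrib 1 2 ..
  qed
  then have "(\<Sum>k\<in>modes N. cnj (T r k) * coef_rate k r)
      = (\<Sum>k\<in>modes N. - (\<Sum>j\<in>J. of_real (\<eta> j r) * (cnj (T r k) * appl (adv_mat (u j)) (T r) k))
        - of_real (\<kappa> * (sob_term 1 (T r) k)))"
    by (rule sum.cong[OF refl])
  also have "\<dots> = - (\<Sum>k\<in>modes N. \<Sum>j\<in>J. of_real (\<eta> j r) * (cnj (T r k) * appl (adv_mat (u j)) (T r) k))
      - of_real (\<Sum>k\<in>modes N. \<kappa> * (sob_term 1 (T r) k))"
    by (simp only: sum_subtractf sum_negf of_real_sum)
  also have "(\<Sum>k\<in>modes N. \<Sum>j\<in>J. of_real (\<eta> j r) * (cnj (T r k) * appl (adv_mat (u j)) (T r) k))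
      = (\<Sum>j\<in>J. of_real (\<eta> j r) * (\<Sum>k\<in>modes N. cnj (T r k) * appl (adv_mat (u j)) (T r) k))"
    by (subst sum.swap) (simp only: sum_distrib_left)
  finally have eq: "(\<Sum>k\<in>modes N. cnj (T r k) * coef_rate k r)
      = - (\<Sum>j\<in>J. of_real (\<eta> j r) * (\<Sum>k\<in>modes N. cnj (T r k) * appl (adv_mat (u j)) (T r) k))
        - of_real (\<Sum>k\<in>modes N. \<kappa> * (sob_term 1 (T r) k))" .
  have R: "Re (\<Sum>j\<in>J. of_real (\<eta> j r) * z j) = (\<Sum>j\<in>J. \<eta> j r * Re (z j))" for z :: "'j \<Rightarrow> complex"
    by simp
  show ?thesis unfolding energy_rate_def eq minus_complex.sel uminus_complex.sel R Re_complex_of_real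
    by (simp add: sum_distrib_left sum_negf algebra_simps)
qed

text \<open>The double sum over the truncated modes is its own negative conjugate, so its real part
  vanishes; only the truncation error of \<open>form_error\<close> remains.\<close>

lemma transport_form_le:
  assumes G: "op_bound 1 G D" and D: "hermitian_upto (- 1) D" and f: "f \<in> Hsp 1"
  shows "\<bar>Re (\<Sum>k\<in>modes N. cnj (f k) * appl D f k)\<bar> \<le> G * Hnorm 1 (tail N f) * Hnorm 0 f"
proof -
  define X where "X = (\<Sum>k\<in>modes N. \<Sum>m\<in>modes N. cnj (f k) * (D m k * f m))"
  have "cnj X = (\<Sum>k\<in>modes N. \<Sum>m\<in>modes N. - (cnj (f m) * (D k m * f k)))"
    unfolding X_def cnj_sum
  proof (intro sum.cong refl)
    fix k m
    have h: "D k m = - cnj (D m k)" using hermitian_uptoD[OF D, where m = k and k = m] by simp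
    show "cnj (cnj (f k) * (D m k * f m)) = - (cnj (f m) * (D k m * f k))"
      unfolding h by simp
  qed
  also have "\<dots> = - X" unfolding X_def sum_negf by (subst sum.swap) simp
  finally have "Re X = 0" by (metis cnj.sel(1) equal_neg_zero uminus_complex.sel(1))
  then have "Re (\<Sum>k\<in>modes N. cnj (f k) * appl D f k) = Re ((\<Sum>k\<in>modes N. cnj (f k) * appl D f k) - X)" by simp
  also have "\<bar>\<dots>\<bar> \<le> cmod ((\<Sum>k\<in>modes N. cnj (f k) * appl D f k) - X)" by (rule abs_Re_le_cmod)
  also have "\<dots> \<le> G * Hnorm 1 (tail N f) * Hnorm 0 f"
    unfolding X_def by (intro form_error[OF G D _ f] Hsp_mono[OF _ f]) auto
  finally show ?thesis .
qed

text \<open>The constant is uniform in the time and in \<open>N\<close>, as dominated convergence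
  requires; it combines the bound on the noise path with the operator bounds of the finitely many
  fields.\<close>

lemma transport_term:
  obtains C where "0 \<le> C" "\<And>r N. r \<in> {0..1} \<Longrightarrow> T r \<in> Hsp 1 \<Longrightarrow>
    \<bar>\<Sum>j\<in>J. \<eta> j r * Re (\<Sum>k\<in>modes N. cnj (T r k) * appl (adv_mat (u j)) (T r) k)\<bar> \<le> C * Hnorm 1 (tail N (T r)) * Hnorm 0 (T r)"
proof -
  obtain E where E: "0 \<le> E" "\<And>j r. j \<in> J \<Longrightarrow> r \<in> {0..1} \<Longrightarrow> \<bar>\<eta> j r\<bar> \<le> E" by (rule eta_bound) blast
  have "\<exists>G. op_bound 1 G (adv_mat (u j))" if "j \<in> J" for j
    using bounded_op_adv[OF solenoidal_continuous[OF u[OF that]]] by (simp add: bounded_op_def)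
  then obtain G where G: "\<And>j. j \<in> J \<Longrightarrow> op_bound 1 (G j) (adv_mat (u j))" by metis
  have G0: "0 \<le> G j" if "j \<in> J" for j using G[OF that] by (simp add: op_bound_def)
  show ?thesis
  proof (rule that[of "\<Sum>j\<in>J. E * G j"])
    show "0 \<le> (\<Sum>j\<in>J. E * G j)" using E G0 by (intro sum_nonneg) auto
    fix r N assume r: "r \<in> {0..1}" "T r \<in> Hsp 1"
    have "\<bar>\<eta> j r * Re (\<Sum>k\<in>modes N. cnj (T r k) * appl (adv_mat (u j)) (T r) k)\<bar>
        \<le> E * (G j * Hnorm 1 (tail N (T r)) * Hnorm 0 (T r))" if j: "j \<in> J" for j
      unfolding abs_mult using E(1) E(2)[OF j r(1)]
      by (intro mult_mono transport_form_le G[OF j] adv_mat_antihermitian u j r) auto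
    then have "\<bar>\<Sum>j\<in>J. \<eta> j r * Re (\<Sum>k\<in>modes N. cnj (T r k) * appl (adv_mat (u j)) (T r) k)\<bar>
        \<le> (\<Sum>j\<in>J. E * (G j * Hnorm 1 (tail N (T r)) * Hnorm 0 (T r)))"
      by (intro order_trans[OF sum_abs] sum_mono)
    then show "\<bar>\<Sum>j\<in>J. \<eta> j r * Re (\<Sum>k\<in>modes N. cnj (T r k) * appl (adv_mat (u j)) (T r) k)\<bar>
        \<le> (\<Sum>j\<in>J. E * G j) * Hnorm 1 (tail N (T r)) * Hnorm 0 (T r)"
      unfolding sum_distrib_right mult.assoc .
  qed
qed

theorem energy_equality:
  assumes st: "0 \<le> s" "s \<le> t" "t \<le> 1"
  shows "(Hnorm 0 (T t))\<^sup>2 = (Hnorm 0 (T s))\<^sup>2 - 2 * \<kappa> * (LINT r|lebesgue_on {s..t}. (Hnorm 1 (T r))\<^sup>2)"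
proof -
  have sub: "{s..t} \<subseteq> {0..1}" using st by auto
  obtain C where C: "0 \<le> C" "\<And>r N. r \<in> {0..1} \<Longrightarrow> T r \<in> Hsp 1 \<Longrightarrow>
    \<bar>\<Sum>j\<in>J. \<eta> j r * Re (\<Sum>k\<in>modes N. cnj (T r k) * appl (adv_mat (u j)) (T r) k)\<bar> \<le> C * Hnorm 1 (tail N (T r)) * Hnorm 0 (T r)"
    by (rule transport_term) blast
  have "integrable (lebesgue_on {0..1}) (\<lambda>r. (Hnorm 1 (T r))\<^sup>2)" using T_H1 by (simp add: L2_path_def)
  then have int: "integrable (lebesgue_on {s..t}) (\<lambda>r. (Hnorm 1 (T r))\<^sup>2)" by (rule integrable_subinterval[OF _ sub])
  have "AE r in lebesgue_on {0..1}. T r \<in> Hsp 1" using T_H1 by (simp add: L2_path_def)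
  then have "AE r in lebesgue_on {s..t}. T r \<in> Hsp 1" by (rule AE_lebesgue_on_subset[OF _ sub]) auto
  moreover have "AE r in lebesgue_on {s..t}. r \<in> {0..1}" by (rule AE_I2) (use sub in auto)
  ultimately have H1: "AE r in lebesgue_on {s..t}. r \<in> {0..1} \<and> T r \<in> Hsp 1" by eventually_elim simp
  have "(\<lambda>N. LINT r|lebesgue_on {s..t}. energy_rate N r) \<longlonglongrightarrow> (LINT r|lebesgue_on {s..t}. - 2 * \<kappa> * (Hnorm 1 (T r))\<^sup>2)"
  \<comment> \<open>The diffusion part contributes \<open>2 * \<kappa>\<close>; in the transport
    part both the tail norm and the \<open>L2\<close> norm are bounded by the full
    \<open>H\<^sup>1\<close> norm, contributing \<open>2 * C\<close>. The square of that norm is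
    integrable in time.\<close>
  proof (rule integral_dominated_convergence[of _ _ _ "\<lambda>r. (2 * \<kappa> + 2 * C) * (Hnorm 1 (T r))\<^sup>2"])
    show "(\<lambda>r. - 2 * \<kappa> * (Hnorm 1 (T r))\<^sup>2) \<in> borel_measurable (lebesgue_on {s..t})"
      using borel_measurable_integrable[OF int] by simp
    show "energy_rate N \<in> borel_measurable (lebesgue_on {s..t})" for N
      by (intro borel_measurable_integrable continuous_imp_integrable_real continuous_on_subset[OF energy_rate_continuous sub])
    show "integrable (lebesgue_on {s..t}) (\<lambda>r. (2 * \<kappa> + 2 * C) * (Hnorm 1 (T r))\<^sup>2)" using int by simp
    show "AE r in lebesgue_on {s..t}. (\<lambda>N. energy_rate N r) \<longlonglongrightarrow> - 2 * \<kappa> * (Hnorm 1 (T r))\<^sup>2"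
      using H1
    proof eventually_elim
      case (elim r)
      have "(\<lambda>N. C * Hnorm 1 (tail N (T r)) * Hnorm 0 (T r)) \<longlonglongrightarrow> 0"
        using tendsto_mult[OF tendsto_mult[OF tendsto_const Hnorm_tail_tendsto] tendsto_const, of "T r" 1 C "Hnorm 0 (T r)"] elim by simp
      then have "(\<lambda>N. \<Sum>j\<in>J. \<eta> j r * Re (\<Sum>k\<in>modes N. cnj (T r k) * appl (adv_mat (u j)) (T r) k)) \<longlonglongrightarrow> 0"
        by (rule Lim_null_comparison[rotated]) (use C(2) elim in auto)
      moreover have "(\<lambda>N. \<Sum>k\<in>modes N. sob_term 1 (T r) k) \<longlonglongrightarrow> (Hnorm 1 (T r))\<^sup>2"
        unfolding Hnorm_squared using elim by (intro sum_modes_tendsto Hsp_summable) auto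
      ultimately have "(\<lambda>N. energy_rate N r) \<longlonglongrightarrow> - 2 * \<kappa> * (Hnorm 1 (T r))\<^sup>2 - 2 * 0"
        unfolding energy_rate_eq by (intro tendsto_diff tendsto_mult tendsto_const)
      then show ?case by simp
    qed
    show "AE r in lebesgue_on {s..t}. norm (energy_rate N r) \<le> (2 * \<kappa> + 2 * C) * (Hnorm 1 (T r))\<^sup>2" for N
      using H1
    proof eventually_elim
      case (elim r)
      then have r: "r \<in> {0..1}" "T r \<in> Hsp 1" by auto
      have "\<bar>\<Sum>j\<in>J. \<eta> j r * Re (\<Sum>k\<in>modes N. cnj (T r k) * appl (adv_mat (u j)) (T r) k)\<bar>
          \<le> C * Hnorm 1 (tail N (T r)) * Hnorm 0 (T r)" by (rule C(2)[OF r])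
      also have "\<dots> \<le> C * Hnorm 1 (T r) * Hnorm 1 (T r)"
        using C(1) by (intro mult_mono mult_left_mono Hnorm_tail_le Hnorm_mono r) auto
      finally have 1: "\<bar>\<Sum>j\<in>J. \<eta> j r * Re (\<Sum>k\<in>modes N. cnj (T r k) * appl (adv_mat (u j)) (T r) k)\<bar> \<le> C * (Hnorm 1 (T r))\<^sup>2"
        by (simp add: power2_eq_square mult.assoc)
      have "(\<Sum>k\<in>modes N. sob_term 1 (T r) k) \<le> (Hnorm 1 (T r))\<^sup>2"
        unfolding Hnorm_squared by (intro finite_sum_le_infsum Hsp_summable r modes_subset) auto
      then have 2: "\<bar>- 2 * \<kappa> * (\<Sum>k\<in>modes N. sob_term 1 (T r) k)\<bar> \<le> 2 * \<kappa> * (Hnorm 1 (T r))\<^sup>2"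
        using kappa by (simp add: abs_mult sum_nonneg)
      show ?case unfolding energy_rate_eq real_norm_def distrib_right using 1 2 by linarith
    qed
  qed
  then have "(\<lambda>N. trunc_energy N t - trunc_energy N s) \<longlonglongrightarrow> - 2 * \<kappa> * (LINT r|lebesgue_on {s..t}. (Hnorm 1 (T r))\<^sup>2)"
    unfolding trunc_energy_integral[OF st] by simp
  moreover have "(\<lambda>N. trunc_energy N t' ) \<longlonglongrightarrow> (Hnorm 0 (T t'))\<^sup>2" if "t' \<in> {0..1}" for t'
  proof -
    have s: "(\<lambda>k. (cmod (T t' k))\<^sup>2) summable_on - {0}" by (rule Hsp_0D(3)[OF T_L2[OF that]])
    have "(Hnorm 0 (T t'))\<^sup>2 = (\<Sum>\<^sub>\<infinity>k\<in>- {0}. (cmod (T t' k))\<^sup>2)" by (simp add: Hnorm_0 infsum_nonneg)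
    then show ?thesis unfolding trunc_energy_def using sum_modes_tendsto[OF s] by simp
  qed
  then have "(\<lambda>N. trunc_energy N t - trunc_energy N s) \<longlonglongrightarrow> (Hnorm 0 (T t))\<^sup>2 - (Hnorm 0 (T s))\<^sup>2"
    using st by (intro tendsto_diff) auto
  ultimately have "(Hnorm 0 (T t))\<^sup>2 - (Hnorm 0 (T s))\<^sup>2 = - 2 * \<kappa> * (LINT r|lebesgue_on {s..t}. (Hnorm 1 (T r))\<^sup>2)"
    using LIMSEQ_unique by blast
  then show ?thesis by simp
qed

end

section \<open>A comparison principle for reciprocals\<close>

text \<open>An integrated form of (1/f)' >= A' that differentiates nothing. The increment of
  \<open>1 / f\<close> is at least \<open>f t / f s\<close> times that of \<open>A\<close>; by
  continuity this ratio exceeds any \<open>z < 1\<close> on short intervals, Bolzano's bisection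
  glues them, and \<open>z\<close> tends to 1.\<close>

lemma reciprocal_comparison:
  fixes f A :: "real \<Rightarrow> real"
  assumes ab: "a \<le> b" and f: "continuous_on {a..b} f" and pos: "\<And>t. t \<in> {a..b} \<Longrightarrow> 0 < f t"
    and A: "\<And>s t. a \<le> s \<Longrightarrow> s \<le> t \<Longrightarrow> t \<le> b \<Longrightarrow> A s \<le> A t"
    and ineq: "\<And>s t. a \<le> s \<Longrightarrow> s \<le> t \<Longrightarrow> t \<le> b \<Longrightarrow> (f t)\<^sup>2 * (A t - A s) \<le> f s - f t"
  shows "A b - A a \<le> 1 / f b - 1 / f a"
proof (rule field_le_mult_one_interval)
  fix z :: real assume z: "0 < z" "z < 1"
  have "(a \<le> a \<and> a \<le> b \<and> b \<le> b) \<longrightarrow> z * (A b - A a) \<le> 1 / f b - 1 / f a"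
  proof (rule Bolzano[OF ab, of "\<lambda>s t. (a \<le> s \<and> s \<le> t \<and> t \<le> b) \<longrightarrow> z * (A t - A s) \<le> 1 / f t - 1 / f s"])
    fix s t r assume "(a \<le> s \<and> s \<le> t \<and> t \<le> b) \<longrightarrow> z * (A t - A s) \<le> 1 / f t - 1 / f s"
      "(a \<le> t \<and> t \<le> r \<and> r \<le> b) \<longrightarrow> z * (A r - A t) \<le> 1 / f r - 1 / f t" "s \<le> t" "t \<le> r"
    then show "(a \<le> s \<and> s \<le> r \<and> r \<le> b) \<longrightarrow> z * (A r - A s) \<le> 1 / f r - 1 / f s"
      by (auto simp: algebra_simps)
  next
    fix x assume x: "a \<le> x" "x \<le> b"
    \<comment> \<open>If \<open>f\<close> varies by at most the fraction \<epsilon> around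
      \<open>x\<close>, then \<open>f t / f s\<close> is at least (1 - \<epsilon>) / (1 +
      \<epsilon>); this choice of \<epsilon> makes that at least \<open>z\<close>.\<close>
    define \<epsilon> where "\<epsilon> = (1 - z) / 2"
    have "(1 - z) * (1 + z) \<le> (1 - z) * 2" using z by (intro mult_left_mono) auto
    then have e: "0 < \<epsilon>" "z * (1 + \<epsilon>) \<le> 1 - \<epsilon>"
      using z by (auto simp: \<epsilon>_def field_simps)
    have "0 < \<epsilon> * f x" using e(1) pos[of x] x by simp
    then obtain d where d: "d > 0" "\<And>y. y \<in> {a..b} \<Longrightarrow> dist y x < d \<Longrightarrow> dist (f y) (f x) < \<epsilon> * f x"
      using f x unfolding continuous_on_iff by (metis atLeastAtMost_iff)
    show "\<exists>d>0. \<forall>s t. s \<le> x \<and> x \<le> t \<and> t - s < d \<longrightarrow>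
        (a \<le> s \<and> s \<le> t \<and> t \<le> b \<longrightarrow> z * (A t - A s) \<le> 1 / f t - 1 / f s)"
    proof (intro exI[of _ d] conjI allI impI d(1))
      fix s t assume "s \<le> x \<and> x \<le> t \<and> t - s < d" "a \<le> s \<and> s \<le> t \<and> t \<le> b"
      then have st: "a \<le> s" "s \<le> t" "t \<le> b" "dist s x < d" "dist t x < d" by (auto simp: dist_real_def)
      have ft: "(1 - \<epsilon>) * f x \<le> f t" and fs: "f s \<le> (1 + \<epsilon>) * f x"
        using d(2)[of t] d(2)[of s] st by (auto simp: dist_real_def algebra_simps abs_less_iff)
      have ps: "0 < f s" "0 < f t" "0 < f x" using pos[of s] pos[of t] pos[of x] st x by auto
      have "z * f s \<le> z * ((1 + \<epsilon>) * f x)" using fs z by simp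
      also have "\<dots> = (z * (1 + \<epsilon>)) * f x" by simp
      also have "\<dots> \<le> (1 - \<epsilon>) * f x" using e(2) ps by (intro mult_right_mono) auto
      also have "\<dots> \<le> f t" by (rule ft)
      finally have "z * f s * (f t * (A t - A s)) \<le> f t * (f t * (A t - A s))"
        using A[OF st(1-3)] ps by (intro mult_right_mono) auto
      also have "\<dots> \<le> f s - f t" using ineq[OF st(1-3)] by (simp add: power2_eq_square mult.assoc)
      finally have "z * (A t - A s) * (f s * f t) \<le> f s - f t" by (simp add: mult_ac)
      then have "z * (A t - A s) \<le> (f s - f t) / (f s * f t)" using ps by (simp add: le_divide_eq)
      also have "\<dots> = 1 / f t - 1 / f s" using ps by (simp add: field_simps)
      finally show "z * (A t - A s) \<le> 1 / f t - 1 / f s" .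
    qed
  qed
  then show "z * (A b - A a) \<le> 1 / f b - 1 / f a" using ab by simp
qed

section \<open>The decay profile and auxiliary estimates\<close>

lemma decay_argument_ge_1:
  fixes lam t c :: real
  assumes "0 \<le> lam" "0 \<le> t"
  shows "1 \<le> (c\<^sup>2 * exp (2 * lam * t) + 1) / (c\<^sup>2 + 1)"
proof -
  have "c\<^sup>2 * 1 \<le> c\<^sup>2 * exp (2 * lam * t)" using assms by (intro mult_left_mono) auto
  moreover have "0 < c\<^sup>2 + 1" by (smt (verit) zero_le_power2)
  ultimately show ?thesis by (simp add: le_divide_eq)
qed

lemma decay_denom_ge_1:
  assumes "0 < \<kappa>" "0 < lam" "0 \<le> t"
  shows "1 \<le> decay_denom \<kappa> lam c t"
    "(decay_denom \<kappa> lam c t)\<^sup>2 = 1 + \<kappa> / (2 * lam * c\<^sup>2) * ln ((c\<^sup>2 * exp (2 * lam * t) + 1) / (c\<^sup>2 + 1))"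
proof -
  let ?x = "1 + \<kappa> / (2 * lam * c\<^sup>2) * ln ((c\<^sup>2 * exp (2 * lam * t) + 1) / (c\<^sup>2 + 1))"
  have "0 \<le> ln ((c\<^sup>2 * exp (2 * lam * t) + 1) / (c\<^sup>2 + 1))"
    using decay_argument_ge_1[of lam t c] assms by simp
  then have x: "1 \<le> ?x" using assms by simp
  then show "1 \<le> decay_denom \<kappa> lam c t" unfolding decay_denom_def by (intro ge_one_powr_ge_zero) auto
  show "(decay_denom \<kappa> lam c t)\<^sup>2 = ?x" unfolding decay_denom_def using x by (simp add: powr_half_sqrt)
qed

lemma decay_denom_continuous:
  assumes "0 < \<kappa>" "0 < lam"
  shows "continuous_on {0..1} (decay_denom \<kappa> lam c)"
proof -
  have c: "0 < c\<^sup>2 + 1" by (smt (verit) zero_le_power2)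
  have 1: "0 < (c\<^sup>2 * exp (2 * lam * t) + 1) / (c\<^sup>2 + 1)" if "t \<in> {0..1}" for t
    using decay_argument_ge_1[of lam t c] assms that by auto
  have 2: "1 + \<kappa> / (2 * lam * c\<^sup>2) * ln ((c\<^sup>2 * exp (2 * lam * t) + 1) / (c\<^sup>2 + 1)) \<noteq> 0" if "t \<in> {0..1}" for t
  proof -
    have "1 \<le> (decay_denom \<kappa> lam c t)\<^sup>2" using decay_denom_ge_1(1)[OF assms, of t c] that by (simp add: one_le_power)
    then show ?thesis unfolding decay_denom_ge_1(2)[OF assms(1,2), of t c, OF that[THEN atLeastAtMost_iff[THEN iffD1, THEN conjunct1]]]
      by linarith
  qed
  have "continuous_on {0..1} (\<lambda>t. (c\<^sup>2 * exp (2 * lam * t) + 1) / (c\<^sup>2 + 1))"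
    by (intro continuous_intros) (use c in auto)
  then have L: "continuous_on {0..1} (\<lambda>t. ln ((c\<^sup>2 * exp (2 * lam * t) + 1) / (c\<^sup>2 + 1)))"
    by (rule continuous_on_ln) (use 1 in force)
  show ?thesis
    unfolding decay_denom_def[abs_def]
    by (intro continuous_on_powr continuous_on_add continuous_on_mult continuous_on_const L ballI 2)
qed

lemma Hnorm_triangle:
  assumes f: "f \<in> Hsp 0" and g: "g \<in> Hsp 0" and s: "s \<le> 0"
  shows "Hnorm s f \<le> Hnorm s (\<lambda>k. f k - g k) + Hnorm s g"
proof -
  have d: "(\<lambda>k. f k - g k) \<in> Hsp 0"
    using Hsp_0_add[OF f Hsp_0_scale[OF g, of "- 1"]] by simp
  note fs = Hsp_mono[OF s f] and gs = Hsp_mono[OF s g] and ds = Hsp_mono[OF s d]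
  have L: "sqrt (\<Sum>k\<in>modes N. sob_term s h k)
      = L2_set (\<lambda>k. norm (kvec k) powr s * cmod (h k)) (modes N)" for h :: "'a distr" and N
    unfolding L2_set_def
    by (intro arg_cong[of _ _ sqrt] sum.cong refl) (simp add: power_mult_distrib power2_eq_square[of "_ powr _"] flip: powr_add)
  show ?thesis unfolding Hnorm_le_iff[OF fs] L
  proof
    fix N
    have "L2_set (\<lambda>k. norm (kvec k) powr s * cmod (f k)) (modes N)
        \<le> L2_set (\<lambda>k. norm (kvec k) powr s * cmod (f k - g k) + norm (kvec k) powr s * cmod (g k)) (modes N)"
    proof (rule L2_set_mono)
      fix k
      have "cmod (f k) \<le> cmod (f k - g k) + cmod (g k)" using norm_triangle_ineq[of "f k - g k" "g k"] by simp
      from mult_left_mono[OF this, of "norm (kvec k) powr s"]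
      show "norm (kvec k) powr s * cmod (f k) \<le> norm (kvec k) powr s * cmod (f k - g k) + norm (kvec k) powr s * cmod (g k)"
        by (simp add: distrib_left)
    qed simp
    also have "\<dots> \<le> L2_set (\<lambda>k. norm (kvec k) powr s * cmod (f k - g k)) (modes N) + L2_set (\<lambda>k. norm (kvec k) powr s * cmod (g k)) (modes N)"
      by (rule L2_set_triangle_ineq)
    also have "\<dots> \<le> Hnorm s (\<lambda>k. f k - g k) + Hnorm s g"
      unfolding L[symmetric] by (intro add_mono Hnorm_modes_le fs gs ds)
    finally show "L2_set (\<lambda>k. norm (kvec k) powr s * cmod (f k)) (modes N) \<le> Hnorm s (\<lambda>k. f k - g k) + Hnorm s g" .
  qed
qed

lemma le_on_rationals_imp_le:
  fixes h :: "real \<Rightarrow> real"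
  assumes h: "continuous_on {0..1} h" and le: "\<And>q. q \<in> \<rat> \<inter> {0<..<1} \<Longrightarrow> h q \<le> a" and t: "t \<in> {0..1}"
  shows "h t \<le> a"
proof -
  have "closure ({0<..<1} \<inter> \<rat>) = closure {0<..<1 :: real}"
    by (rule closure_open_Int_superset) (auto simp: Rats_closure_real)
  then have c: "closure (\<rat> \<inter> {0<..<1}) = {0..1 :: real}" by (simp add: Int_commute)
  show ?thesis using continuous_le_on_closure[of "\<rat> \<inter> {0<..<1}" h t a] h le t unfolding c by blast
qed

text \<open>With continuous coefficients the norm itself is only lower semicontinuous in time, so
  the passage from rational to all times is made for each finite section.\<close>

lemma Hnorm_le_on_rationals_imp_le:
  fixes f :: "real \<Rightarrow> 'n::finite distr"
  assumes f: "\<And>t. t \<in> {0..1} \<Longrightarrow> f t \<in> Hsp s" and c: "\<And>k. continuous_on {0..1} (\<lambda>t. f t k)"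
    and b: "continuous_on {0..1} b" and le: "\<And>q. q \<in> \<rat> \<inter> {0<..<1} \<Longrightarrow> Hnorm s (f q) \<le> b q"
    and t: "t \<in> {0..1}"
  shows "Hnorm s (f t) \<le> b t"
  unfolding Hnorm_le_iff[OF f[OF t]]
proof
  fix N
  let ?h = "\<lambda>t. sqrt (\<Sum>k\<in>modes N. sob_term s (f t) k)"
  have "?h t - b t \<le> 0"
  proof (rule le_on_rationals_imp_le[OF _ _ t])
    show "continuous_on {0..1} (\<lambda>t. ?h t - b t)" by (intro continuous_intros c b)
    fix q :: real assume q: "q \<in> \<rat> \<inter> {0<..<1}"
    then have "f q \<in> Hsp s" by (intro f) auto
    from Hnorm_modes_le[OF this, of N] le[OF q] show "?h q - b q \<le> 0" by linarith
  qed
  then show "?h t \<le> b t" by simp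
qed

context transport
begin

lemma L2_norm_nonincreasing:
  assumes "0 \<le> s" "s \<le> t" "t \<le> 1"
  shows "Hnorm 0 (T t) \<le> Hnorm 0 (T s)"
proof -
  have "0 \<le> (LINT r|lebesgue_on {s..t}. (Hnorm 1 (T r))\<^sup>2)" by (intro Bochner_Integration.integral_nonneg) auto
  then have "0 \<le> 2 * \<kappa> * (LINT r|lebesgue_on {s..t}. (Hnorm 1 (T r))\<^sup>2)" using kappa by simp
  then have "(Hnorm 0 (T t))\<^sup>2 \<le> (Hnorm 0 (T s))\<^sup>2" using energy_equality[OF assms] by linarith
  then show ?thesis by (rule power2_le_imp_le) simp
qed

lemma L2_norm_continuous: "continuous_on {0..1} (\<lambda>t. (Hnorm 0 (T t))\<^sup>2)"
proof -
  have "integrable (lebesgue_on {0..1}) (\<lambda>r. (Hnorm 1 (T r))\<^sup>2)" using T_H1 by (simp add: L2_path_def)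
  then have "continuous_on {0..1} (\<lambda>t. (Hnorm 0 (T 0))\<^sup>2 - 2 * \<kappa> * (LINT r|lebesgue_on {0..t}. (Hnorm 1 (T r))\<^sup>2))"
    by (intro continuous_intros indefinite_integral_continuous_real)
  then show ?thesis
    by (rule continuous_on_cong[THEN iffD2, rotated -1]) (auto intro!: energy_equality)
qed

text \<open>The factor 2 in the smallness hypothesis leaves room for squaring a sum of two terms; it
  cancels against the 2 of the energy equality.\<close>

theorem decay_of_small_negative_norm:
  assumes lam: "0 < lam" and c: "0 < c" and M: "0 < M" "Hnorm 0 (T 0) \<le> M"
    and small: "\<And>r. r \<in> {0..1} \<Longrightarrow> (Hnorm (- 1) (T r))\<^sup>2 \<le> 2 * M\<^sup>2 * (c\<^sup>2 + exp (- 2 * lam * r))"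
    and t: "t \<in> {0..1}"
  shows "Hnorm 0 (T t) \<le> M / decay_denom \<kappa> lam c t"
proof -
  define f where "f t = (Hnorm 0 (T t))\<^sup>2" for t
  \<comment> \<open>An antiderivative of \<open>a\<close> below: multiplying numerator and
    denominator of \<open>a\<close> by \<open>exp (2 * lam * t)\<close> turns it into a logarithmic
    derivative, with the prefactor of \<open>decay_denom\<close> divided by
    \<open>M\<^sup>2\<close>.\<close>
  define A where "A t = \<kappa> / (2 * lam * c\<^sup>2) / M\<^sup>2 * ln (c\<^sup>2 * exp (2 * lam * t) + 1)" for t
  define a where "a t = \<kappa> / (M\<^sup>2 * (c\<^sup>2 + exp (- 2 * lam * t)))" for t
  have cpos: "0 < c\<^sup>2 * exp x + 1" "0 < c\<^sup>2 + exp x" for x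
    using zero_le_power2[of c] by (auto intro: add_nonneg_pos)
  have a_pos: "0 < a t" for t using kappa M cpos by (simp add: a_def)
  have A': "(A has_vector_derivative a r) (at r within X)" for r X
  proof -
    have "(A has_real_derivative \<kappa> / (2 * lam * c\<^sup>2) / M\<^sup>2 * ((c\<^sup>2 * (exp (2 * lam * r) * (2 * lam))) / (c\<^sup>2 * exp (2 * lam * r) + 1))) (at r within X)"
    proof -
      have "((\<lambda>t. c\<^sup>2 * exp (2 * lam * t) + 1) has_real_derivative c\<^sup>2 * (exp (2 * lam * r) * (2 * lam))) (at r within X)"
        by (auto intro!: derivative_eq_intros)
      from DERIV_cmult[OF DERIV_chain2[OF DERIV_ln_divide[OF cpos(1)] this], of "\<kappa> / (2 * lam * c\<^sup>2) / M\<^sup>2"]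
      show ?thesis by (simp add: A_def[abs_def])
    qed
    also have "\<kappa> / (2 * lam * c\<^sup>2) / M\<^sup>2 * ((c\<^sup>2 * (exp (2 * lam * r) * (2 * lam))) / (c\<^sup>2 * exp (2 * lam * r) + 1)) = a r"
    proof -
      have "c\<^sup>2 * exp (2 * lam * r) + 1 = exp (2 * lam * r) * (c\<^sup>2 + exp (- 2 * lam * r))"
        by (simp add: distrib_left flip: exp_add)
      note E = this
      have key: "\<kappa> / (2 * lam * c\<^sup>2) / M\<^sup>2 * ((c\<^sup>2 * (x * (2 * lam))) / (x * y)) = \<kappa> / (M\<^sup>2 * y)"
        if "x \<noteq> 0" "y \<noteq> 0" for x y using that c lam M by simp
      show ?thesis unfolding E a_def by (rule key) (use cpos(2)[of "- 2 * lam * r"] in auto)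
    qed
    finally show ?thesis by (simp add: has_real_derivative_iff_has_vector_derivative)
  qed
  have a_cont: "continuous_on X a" for X
    unfolding a_def using cpos(2) M by (intro continuous_intros ballI) (auto simp: less_imp_neq[symmetric])
  have A_int: "(LINT r|lebesgue_on {s..t}. a r) = A t - A s" if "s \<le> t" for s t
  proof -
    have "(LINT r|lebesgue_on {s..t}. a r) = integral {s..t} a"
      by (intro lebesgue_integral_eq_integral continuous_imp_integrable_real a_cont) auto
    then show ?thesis using fundamental_theorem_of_calculus[OF that A'] by (simp add: integral_unique)
  qed
  have A_mono: "A s \<le> A t" if "s \<le> t" for s t
  proof -
    have "0 \<le> (LINT r|lebesgue_on {s..t}. a r)" using a_pos by (intro Bochner_Integration.integral_nonneg less_imp_le)
    then show ?thesis using A_int[OF that] by simp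
  qed
  have f_mono: "f t \<le> f s" if "0 \<le> s" "s \<le> t" "t \<le> 1" for s t
    unfolding f_def using L2_norm_nonincreasing[OF that] by (intro power_mono) auto
  have f_nonneg: "0 \<le> f t" for t by (simp add: f_def)
  have ineq: "(f t)\<^sup>2 * (A t - A s) \<le> f s - f t" if st: "0 \<le> s" "s \<le> t" "t \<le> 1" for s t
  proof -
    have sub: "{s..t} \<subseteq> {0..1}" using st by auto
    have "integrable (lebesgue_on {0..1}) (\<lambda>r. (Hnorm 1 (T r))\<^sup>2)" using T_H1 by (simp add: L2_path_def)
    then have int: "integrable (lebesgue_on {s..t}) (\<lambda>r. (Hnorm 1 (T r))\<^sup>2)" by (rule integrable_subinterval[OF _ sub])
    have "AE r in lebesgue_on {0..1}. T r \<in> Hsp 1" using T_H1 by (simp add: L2_path_def)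
    then have "AE r in lebesgue_on {s..t}. T r \<in> Hsp 1" by (rule AE_lebesgue_on_subset[OF _ sub]) auto
    moreover have "AE r in lebesgue_on {s..t}. r \<in> {s..t}" by (rule AE_I2) auto
    \<comment> \<open>The energy at the final time is a lower bound for the energy throughout the
      interval, so interpolation can be used with the constant \<open>f t\<close> in place of
      \<open>f r\<close>.\<close>
    ultimately have AE: "AE r in lebesgue_on {s..t}. (f t)\<^sup>2 * a r \<le> 2 * \<kappa> * (Hnorm 1 (T r))\<^sup>2"
    proof eventually_elim
      case (elim r)
      have "f t \<le> f r" using elim st by (intro f_mono) auto
      also have "\<dots> \<le> Hnorm 1 (T r) * Hnorm (- 1) (T r)" unfolding f_def by (rule Hnorm_interpolation[OF elim(1)])
      finally have "(f t)\<^sup>2 \<le> (Hnorm 1 (T r) * Hnorm (- 1) (T r))\<^sup>2" using f_nonneg by (rule power_mono)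
      also have "\<dots> \<le> (Hnorm 1 (T r))\<^sup>2 * (2 * M\<^sup>2 * (c\<^sup>2 + exp (- 2 * lam * r)))"
        unfolding power_mult_distrib using elim sub by (intro mult_left_mono small) auto
      finally have "(f t)\<^sup>2 * a r \<le> (Hnorm 1 (T r))\<^sup>2 * (2 * M\<^sup>2 * (c\<^sup>2 + exp (- 2 * lam * r))) * a r"
        using a_pos[of r] by (intro mult_right_mono) auto
      also have "\<dots> = 2 * \<kappa> * (Hnorm 1 (T r))\<^sup>2"
        using M cpos(2)[of "- 2 * lam * r"] by (simp add: a_def)
      finally show ?case .
    qed
    have "(f t)\<^sup>2 * (A t - A s) = (LINT r|lebesgue_on {s..t}. (f t)\<^sup>2 * a r)"
      using A_int[OF st(2)] by simp
    also have "\<dots> \<le> (LINT r|lebesgue_on {s..t}. 2 * \<kappa> * (Hnorm 1 (T r))\<^sup>2)"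
    proof (rule integral_mono_AE[OF _ _ AE])
      show "integrable (lebesgue_on {s..t}) (\<lambda>r. (f t)\<^sup>2 * a r)"
        by (intro continuous_imp_integrable_real continuous_intros a_cont)
      show "integrable (lebesgue_on {s..t}) (\<lambda>r. 2 * \<kappa> * (Hnorm 1 (T r))\<^sup>2)" using int by simp
    qed
    also have "\<dots> = f s - f t" using energy_equality[OF st] by (simp add: f_def)
    finally show ?thesis .
  qed
  let ?d = "decay_denom \<kappa> lam c t"
  have t': "0 \<le> t" "t \<le> 1" using t by auto
  have d: "1 \<le> ?d" by (rule decay_denom_ge_1(1)[OF kappa lam t'(1)])
  have "f t \<le> (M / ?d)\<^sup>2"
  \<comment> \<open>If the energy is positive at \<open>t\<close>, then by monotonicity it is
    positive on all of \<open>{0..t}\<close> and reciprocals may be taken; otherwise the bound is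
    trivial.\<close>
  proof (cases "f t = 0")
    case False
    then have pos: "0 < f r" if "r \<in> {0..t}" for r
      using f_mono[of r t] f_nonneg[of t] that t' by auto
    have "A t - A 0 \<le> 1 / f t - 1 / f 0"
      using t' by (intro reciprocal_comparison pos A_mono ineq continuous_on_subset[OF L2_norm_continuous[folded f_def]]) auto
    moreover have "1 / M\<^sup>2 \<le> 1 / f 0"
    proof -
      have "f 0 \<le> M\<^sup>2" unfolding f_def by (rule power_mono[OF M(2)]) simp
      then show ?thesis using pos[of 0] t' M by (simp add: divide_simps)
    qed
    moreover have "A t - A 0 = ((?d)\<^sup>2 - 1) / M\<^sup>2"
    proof -
      have "A t - A 0 = \<kappa> / (2 * lam * c\<^sup>2) / M\<^sup>2 * (ln (c\<^sup>2 * exp (2 * lam * t) + 1) - ln (c\<^sup>2 + 1))"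
        by (simp add: A_def right_diff_distrib)
      also have "ln (c\<^sup>2 * exp (2 * lam * t) + 1) - ln (c\<^sup>2 + 1) = ln ((c\<^sup>2 * exp (2 * lam * t) + 1) / (c\<^sup>2 + 1))"
        using cpos(1)[of "2 * lam * t"] cpos(1)[of 0] by (simp add: ln_div)
      finally show ?thesis unfolding decay_denom_ge_1(2)[OF kappa lam t'(1)] by simp
    qed
    ultimately have "(?d)\<^sup>2 / M\<^sup>2 \<le> 1 / f t" by (simp add: diff_divide_distrib)
    then show ?thesis using pos[of t] t' d M by (simp add: power_divide divide_simps mult.commute)
  qed simp
  then have "(Hnorm 0 (T t))\<^sup>2 \<le> (M / ?d)\<^sup>2" by (simp add: f_def)
  then show ?thesis by (rule power2_le_imp_le) (use d M in auto)
qed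

end

section \<open>Measurability\<close>

lemma prob_space_noise_space:
  assumes "usual_conditions Mm Fm" "usual_conditions Mp Fp"
  shows "prob_space (noise_space Mm Mp)"
proof -
  interpret m: prob_space Mm using assms by (simp add: usual_conditions_def)
  interpret p: prob_space Mp using assms by (simp add: usual_conditions_def)
  interpret mp: pair_prob_space Mm Mp ..
  show ?thesis
    by (rule prob_spaceI) (simp add: noise_space_def mp.P.emeasure_space_1 space_completion)
qed

text \<open>Needed to read adaptedness as measurability with respect to the completed product
  space.\<close>

lemma augmented_filtration_subalgebra:
  assumes m: "usual_conditions Mm Fm" and p: "usual_conditions Mp Fp" and t: "0 \<le> t"
  shows "space (augmented_filtration Mm Fm Mp Fp t) = space (noise_space Mm Mp)"
    "sets (augmented_filtration Mm Fm Mp Fp t) \<subseteq> sets (noise_space Mm Mp)"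
proof -
  have sub_m: "sets (Fm s) \<subseteq> sets Mm" if "0 \<le> s" for s
  proof -
    have "\<forall>t\<ge>0. subalgebra Mm (Fm t)" using m unfolding usual_conditions_def by (elim conjE)
    then show ?thesis using that unfolding subalgebra_def by blast
  qed
  have sub_p: "space (Fp t) = space Mp" "sets (Fp t) \<subseteq> sets Mp"
  proof -
    have "\<forall>t\<ge>0. subalgebra Mp (Fp t)" using p unfolding usual_conditions_def by (elim conjE)
    then show "space (Fp t) = space Mp" "sets (Fp t) \<subseteq> sets Mp" using t unfolding subalgebra_def by blast+
  qed
  have "(\<Union>t\<in>{0..}. sets (Fm t)) \<subseteq> sets Mm" using sub_m by auto
  then have Finf: "space (F_infinity Mm Fm) = space Mm" "sets (F_infinity Mm Fm) \<subseteq> sets Mm"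
    using sets.sigma_sets_subset[of _ Mm] sets.space_closed[of Mm]
    by (auto simp: F_infinity_def sets_measure_of_conv space_measure_of_conv)
  have "sets (F_infinity Mm Fm \<Otimes>\<^sub>M Fp t) \<subseteq> sets (Mm \<Otimes>\<^sub>M Mp)"
    unfolding sets_pair_measure Finf(1) sub_p(1)
    using Finf(2) sub_p(2) by (intro sigma_sets_mono') auto
  also have "\<dots> \<subseteq> sets (noise_space Mm Mp)" by (auto simp: noise_space_def)
  finally have gen: "sets (F_infinity Mm Fm \<Otimes>\<^sub>M Fp t) \<union> null_sets (noise_space Mm Mp) \<subseteq> sets (noise_space Mm Mp)"
    by auto
  then have "sets (F_infinity Mm Fm \<Otimes>\<^sub>M Fp t) \<union> null_sets (noise_space Mm Mp) \<subseteq> Pow (space (noise_space Mm Mp))"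
    using sets.space_closed by blast
  then show "space (augmented_filtration Mm Fm Mp Fp t) = space (noise_space Mm Mp)"
    "sets (augmented_filtration Mm Fm Mp Fp t) \<subseteq> sets (noise_space Mm Mp)"
    using sets.sigma_sets_subset[OF gen] by (simp_all add: augmented_filtration_def space_measure_of)
qed

lemma Hnorm_measurable:
  assumes f: "\<And>\<omega>. \<omega> \<in> space M \<Longrightarrow> f \<omega> \<in> Hsp s" and m: "\<And>k. (\<lambda>\<omega>. f \<omega> k) \<in> borel_measurable M"
  shows "(\<lambda>\<omega>. Hnorm s (f \<omega>)) \<in> borel_measurable M"
proof (rule borel_measurable_LIMSEQ_real)
  show "(\<lambda>N. sqrt (\<Sum>k\<in>modes N. sob_term s (f \<omega>) k)) \<longlonglongrightarrow> Hnorm s (f \<omega>)"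
    if "\<omega> \<in> space M" for \<omega> using f[OF that] by (rule Hnorm_modes_tendsto)
  show "(\<lambda>\<omega>. sqrt (\<Sum>k\<in>modes N. sob_term s (f \<omega>) k)) \<in> borel_measurable M" for N
    using m by measurable
qed

text \<open>The derivative of order 0 is the path itself, so the first summand already dominates its
  supremum. With a countable \<open>D\<close> the left side becomes a measurable stand-in for the
  Hoelder norm.\<close>

lemma SUP_le_holder_norm:
  assumes "D \<subseteq> {0..1}"
  shows "(SUP q\<in>D. ennreal (Hnorm s (f q))) \<le> holder_norm \<theta> s f"
  unfolding holder_norm_def Let_def
proof (rule INF_greatest)
  fix G assume G: "G \<in> holder_derivs (nat (\<lceil>\<theta>\<rceil> - 1)) s f"
  have "(SUP q\<in>D. ennreal (Hnorm s (f q))) \<le> (SUP t\<in>{0..1}. ennreal (Hnorm s (G 0 t)))"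
  proof (rule SUP_least)
    fix q assume q: "q \<in> D"
    then have "f q = G 0 q" using G assms by (auto simp: holder_derivs_def)
    then show "ennreal (Hnorm s (f q)) \<le> (SUP t\<in>{0..1}. ennreal (Hnorm s (G 0 t)))"
      using q assms by (intro SUP_upper2[of q]) auto
  qed
  also have "\<dots> \<le> (\<Sum>i\<le>nat (\<lceil>\<theta>\<rceil> - 1). SUP t\<in>{0..1}. ennreal (Hnorm s (G i t)))"
    by (rule member_le_sum[of 0 _ "\<lambda>i. SUP t\<in>{0..1}. ennreal (Hnorm s (G i t))"]) auto
  also have "\<dots> \<le> \<dots> + (SUP (r, t)\<in>{(r, t). 0 \<le> r \<and> r < t \<and> t \<le> 1}.
      ennreal (Hnorm s (\<lambda>k. G (nat (\<lceil>\<theta>\<rceil> - 1)) t k - G (nat (\<lceil>\<theta>\<rceil> - 1)) r k) / (t - r) powr (\<theta> - real (nat (\<lceil>\<theta>\<rceil> - 1)))))"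
    by simp
  finally show "(SUP q\<in>D. ennreal (Hnorm s (f q))) \<le> (\<Sum>i\<le>nat (\<lceil>\<theta>\<rceil> - 1). SUP t\<in>{0..1}. ennreal (Hnorm s (G i t)))
      + (SUP (r, t)\<in>{(r, t). 0 \<le> r \<and> r < t \<and> t \<le> 1}.
      ennreal (Hnorm s (\<lambda>k. G (nat (\<lceil>\<theta>\<rceil> - 1)) t k - G (nat (\<lceil>\<theta>\<rceil> - 1)) r k) / (t - r) powr (\<theta> - real (nat (\<lceil>\<theta>\<rceil> - 1)))))" .
qed

section \<open>The main theorem\<close>

theorem theorem1p2:
  fixes Mm :: "'a measure" and Fm :: "real \<Rightarrow> 'a measure" and Wm :: "'j \<Rightarrow> real \<Rightarrow> 'a \<Rightarrow> real"
    and Mp :: "'b measure" and Fp :: "real \<Rightarrow> 'b measure" and Wp :: "'j \<Rightarrow> real \<Rightarrow> 'b \<Rightarrow> real"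
    and J :: "'j set" and u :: "'j \<Rightarrow> real ^ 'n \<Rightarrow> real ^ 'n"
    and \<eta> :: "real \<Rightarrow> 'j \<Rightarrow> real \<Rightarrow> 'a \<times> 'b \<Rightarrow> real"
    and T0 :: "'n::finite distr" and T :: "real \<Rightarrow> real \<Rightarrow> 'a \<times> 'b \<Rightarrow> 'n distr"
    and S :: "real \<Rightarrow> 'n distr \<Rightarrow> 'n distr"
    and p1 p2 :: "real \<Rightarrow> real \<Rightarrow> real \<Rightarrow> real"
    and \<kappa> \<gamma> \<theta> varkappa varsigma C \<alpha> \<epsilon> \<mu> c lam :: real
  defines "P \<equiv> noise_space Mm Mp"
    and "F \<equiv> augmented_filtration Mm Fm Mp Fp"
  assumes dim: "CARD('n) \<ge> 3"
    and kappa: "0 < \<kappa>" "\<kappa> \<le> 1"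
    and gamma: "0 < \<gamma>" "\<gamma> < (real CARD('n) - 2) / 6"
    and noise_minus: "usual_conditions Mm Fm" "iid_brownian_motions Mm Fm J Wm"
    and noise_plus: "usual_conditions Mp Fp" "iid_brownian_motions Mp Fp J Wp"
    and J: "finite J"
    and u: "\<And>j. j \<in> J \<Longrightarrow> smooth (u j) \<and> periodic (u j) \<and> (\<forall>x. divergence (u j) x = 0)"
    and eta: "\<And>a j. a > 1 \<Longrightarrow> j \<in> J \<Longrightarrow> ou_process P (two_sided (Wm j) (Wp j)) a (\<eta> a j)"
    and eps: "\<epsilon> = eps_param J u"
    and mu: "\<mu> = mu_param \<gamma> J u" "1 < \<mu>"
    and T0: "T0 \<in> Hsp 0"
    and T: "\<And>a. a > 1 \<Longrightarrow> solution P F \<kappa> (velocity J u (\<eta> a)) T0 (T a)"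
    and S: "semigroup_generated_by (Hsp 2) (A_op \<kappa> J u) S"
    and exponents: "0 < \<theta>" "0 < varkappa" "0 < varsigma" "0 < C"
    and p: "0 < p1 \<gamma> \<theta> varkappa" "0 < p2 \<gamma> \<theta> varkappa"
    and estimate: "\<And>a. sufficiently_large (p1 \<gamma> \<theta> varkappa) (p2 \<gamma> \<theta> varkappa) \<mu> a \<Longrightarrow>
      (\<integral>\<^sup>+ \<omega>. holder_norm \<theta> (- 1) (\<lambda>t k. T a t \<omega> k - S t T0 k) \<partial>P)
        \<le> ennreal (C * Hnorm 0 T0 * (\<epsilon> + \<mu> powr (2 + \<gamma>) / a powr varkappa) powr varsigma)"
    and alpha: "sufficiently_large (p1 \<gamma> \<theta> varkappa) (p2 \<gamma> \<theta> varkappa) \<mu> \<alpha>"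
    and c: "c = C powr (1 / 2) * (\<epsilon> + \<mu> powr (2 + \<gamma>) / \<alpha> powr varkappa) powr (varsigma / 2)"
    and lambda: "principal_eigenvalue (Hsp 2) (\<lambda>f k. - A_op \<kappa> J u f k) lam" "0 < lam"
  shows "{\<omega> \<in> space P. \<forall>t\<in>{0..1}. Hnorm 0 (T \<alpha> t \<omega>) \<le> Hnorm 0 T0 / decay_denom \<kappa> lam c t} \<in> sets P
    \<and> measure P {\<omega> \<in> space P. \<forall>t\<in>{0..1}. Hnorm 0 (T \<alpha> t \<omega>) \<le> Hnorm 0 T0 / decay_denom \<kappa> lam c t} \<ge> 1 - c
    \<and> (\<forall>t\<in>{0..1}. integrable P (\<lambda>\<omega>. Hnorm 0 (T \<alpha> t \<omega>)) \<and>
        (LINT \<omega>|P. Hnorm 0 (T \<alpha> t \<omega>)) \<le> c * Hnorm 0 T0 + Hnorm 0 T0 / decay_denom \<kappa> lam c t)"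
proof -
  define X where "X = T \<alpha>"
  define M where "M = Hnorm 0 T0"
  \<comment> \<open>A countable dense set of times, used for every measurability question
    below.\<close>
  define D where "D = \<rat> \<inter> {0<..<1 :: real}"
  have D01: "D \<subseteq> {0..1}" by (auto simp: D_def)
  have D_countable: "countable D" unfolding D_def by (intro countable_Int1 countable_rat)
  have a1: "\<alpha> > 1" using alpha by (simp add: sufficiently_large_def)
  interpret P: prob_space P unfolding P_def by (rule prob_space_noise_space[OF noise_minus(1) noise_plus(1)])
  interpret PC: complete_measure P unfolding P_def noise_space_def by (rule completion.complete_measure_axioms)
  interpret DF: diffusion \<kappa> J u
    using kappa(1) J u by unfold_locales (auto intro: smooth_imp_solenoidal)
  have sol: "solution P F \<kappa> (velocity J u (\<eta> \<alpha>)) T0 X" unfolding X_def by (rule T[OF a1])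
  have X_L2: "X t \<omega> \<in> Hsp 0" if "t \<in> {0..1}" "\<omega> \<in> space P" for t \<omega>
    using sol that unfolding solution_def by blast
  have X_meas: "(\<lambda>\<omega>. X t \<omega> k) \<in> borel_measurable P" if t: "t \<in> {0..1}" for t k
  proof -
    have "(\<lambda>\<omega>. X t \<omega> k) \<in> borel_measurable (F t)" using sol t unfolding solution_def by blast
    moreover have "space (F t) = space P" "sets (F t) \<subseteq> sets P"
      using augmented_filtration_subalgebra[OF noise_minus(1) noise_plus(1), of t] t by (auto simp: F_def P_def)
    ultimately show ?thesis by (auto simp: measurable_def)
  qed
  have S_L2: "S t T0 \<in> Hsp 0" if "t \<in> {0..1}" for t using DF.S_Hsp[OF S _ T0] that by auto
  have norm_meas: "(\<lambda>\<omega>. Hnorm 0 (X t \<omega>)) \<in> borel_measurable P" if "t \<in> {0..1}" for t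
    using that by (intro Hnorm_measurable X_L2 X_meas)
  \<comment> \<open>The realisations to which the pathwise analysis applies; they form a set of full
    measure.\<close>
  define good where "good \<omega> \<longleftrightarrow> transport \<kappa> J u (\<lambda>j t. \<eta> \<alpha> j t \<omega>) (\<lambda>r. velocity J u (\<eta> \<alpha>) r \<omega>) (\<lambda>t. X t \<omega>) \<and> X 0 \<omega> = T0" for \<omega>
  have good: "AE \<omega> in P. good \<omega>"
  proof -
    have "AE \<omega> in P. \<forall>j\<in>J. continuous_on {0..1} (\<lambda>t. \<eta> \<alpha> j t \<omega>)"
      using eta[OF a1] J by (intro AE_finite_allI) (auto simp: ou_process_def)
    moreover have "AE \<omega> in P.
        Linf_path 0 (\<lambda>t. X t \<omega>) \<and> L2_path 1 (\<lambda>t. X t \<omega>) \<and> X 0 \<omega> = T0 \<and>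
        (\<forall>\<phi>\<in>test_functions. \<forall>s\<in>{0..1}. \<forall>t\<in>{0..1}. s < t \<longrightarrow>
           pairing (\<lambda>x. of_real (\<phi> x)) (X t \<omega>) = pairing (\<lambda>x. of_real (\<phi> x)) (X s \<omega>)
             + (LINT r|lebesgue_on {s..t}. pairing (\<lambda>x. of_real (adv (velocity J u (\<eta> \<alpha>) r \<omega>) \<phi> x)) (X r \<omega>))
             + of_real \<kappa> * (LINT r|lebesgue_on {s..t}. pairing (\<lambda>x. of_real (laplacian \<phi> x)) (X r \<omega>)))"
      using sol unfolding solution_def by (elim conjE)
    moreover have "AE \<omega> in P. \<omega> \<in> space P" by (rule AE_space)
    ultimately show ?thesis
    proof eventually_elim
      case (elim \<omega>)
      show ?case unfolding good_def
      proof (intro conjI transport.intro transport_axioms.intro)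
        show "diffusion \<kappa> J u" by (rule DF.diffusion_axioms)
        show "velocity J u (\<eta> \<alpha>) r \<omega> x = (\<Sum>j\<in>J. \<eta> \<alpha> j r \<omega> *\<^sub>R u j x)" for r x by (simp add: velocity_def)
        show "continuous_on {0..1} (\<lambda>t. \<eta> \<alpha> j t \<omega>)" if "j \<in> J" for j using elim that by blast
        show "X t \<omega> \<in> Hsp 0" if "t \<in> {0..1}" for t using that elim by (intro X_L2)
        show "Linf_path 0 (\<lambda>t. X t \<omega>)" "L2_path 1 (\<lambda>t. X t \<omega>)" "X 0 \<omega> = T0" using elim by blast+
        fix \<phi> :: "real ^ 'n \<Rightarrow> real" and s t :: real assume "\<phi> \<in> test_functions" "0 \<le> s" "s < t" "t \<le> 1"
        then have "\<phi> \<in> test_functions" "s \<in> {0..1}" "t \<in> {0..1}" "s < t" by auto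
        then show "pairing (\<lambda>x. of_real (\<phi> x)) (X t \<omega>) = pairing (\<lambda>x. of_real (\<phi> x)) (X s \<omega>)
             + (LINT r|lebesgue_on {s..t}. pairing (\<lambda>x. of_real (adv (velocity J u (\<eta> \<alpha>) r \<omega>) \<phi> x)) (X r \<omega>))
             + of_real \<kappa> * (LINT r|lebesgue_on {s..t}. pairing (\<lambda>x. of_real (laplacian \<phi> x)) (X r \<omega>))"
          using elim by blast
      qed
    qed
  qed
  have mono: "Hnorm 0 (X t \<omega>) \<le> M" if "good \<omega>" "t \<in> {0..1}" for \<omega> t
    using transport.L2_norm_nonincreasing[of \<kappa> J u _ _ "\<lambda>t. X t \<omega>" 0 t] that by (auto simp: good_def M_def)
  have X_cont: "continuous_on {0..1} (\<lambda>t. X t \<omega> k)" if "good \<omega>" for \<omega> k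
    using transport.T_coef_continuous that by (auto simp: good_def)
  let ?d = "decay_denom \<kappa> lam c"
  have d1: "1 \<le> ?d t" if "t \<in> {0..1}" for t using decay_denom_ge_1(1)[OF kappa(1) lambda(2)] that by auto
  have M0: "0 \<le> M" by (simp add: M_def)
  have c0: "0 \<le> c" by (simp add: c)
  \<comment> \<open>With this value of the square the assumed estimate reads
    \<open>c\<^sup>2 * M\<close>, so exceeding the level \<open>c * M\<close> has probability at
    most \<open>c\<close>.\<close>
  have c2: "c\<^sup>2 = C * (\<epsilon> + \<mu> powr (2 + \<gamma>) / \<alpha> powr varkappa) powr varsigma"
    using exponents(4) by (simp add: c power_mult_distrib power2_eq_square[of "_ powr _"] flip: powr_add)
  define Y where "Y \<omega> = (SUP q\<in>D. ennreal (Hnorm (- 1) (\<lambda>k. X q \<omega> k - S q T0 k)))" for \<omega>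
  have diff_L2: "(\<lambda>k. X t \<omega> k - S t T0 k) \<in> Hsp 0" if "t \<in> {0..1}" "\<omega> \<in> space P" for t \<omega>
    using Hsp_0_add[OF X_L2[OF that] Hsp_0_scale[OF S_L2[OF that(1)], of "- 1"]] by simp
  have diff_Hm1: "(\<lambda>k. X t \<omega> k - S t T0 k) \<in> Hsp (- 1)" if "t \<in> {0..1}" "\<omega> \<in> space P" for t \<omega>
    using Hsp_mono[OF _ diff_L2[OF that]] by simp
  have Y_meas: "Y \<in> borel_measurable P"
    unfolding Y_def
  proof (intro borel_measurable_SUP D_countable measurable_compose[OF _ measurable_ennreal] Hnorm_measurable)
    fix q \<omega> assume "q \<in> D" "\<omega> \<in> space P"
    then show "(\<lambda>k. X q \<omega> k - S q T0 k) \<in> Hsp (- 1)" using D01 by (intro diff_Hm1) auto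
  next
    fix q k assume "q \<in> D"
    then have "(\<lambda>\<omega>. X q \<omega> k) \<in> borel_measurable P" using D01 by (intro X_meas) auto
    then show "(\<lambda>\<omega>. X q \<omega> k - S q T0 k) \<in> borel_measurable P" by simp
  qed
  \<comment> \<open>The Hoelder norm is not shown to be measurable in \<omega>; monotonicity of the
    nonnegative integral holds without it, and only \<open>Y\<close> enters Markov's
    inequality.\<close>
  have "(\<integral>\<^sup>+ \<omega>. Y \<omega> \<partial>P) \<le> (\<integral>\<^sup>+ \<omega>. holder_norm \<theta> (- 1) (\<lambda>t k. X t \<omega> k - S t T0 k) \<partial>P)"
    unfolding Y_def by (intro nn_integral_mono SUP_le_holder_norm D01)
  also have "\<dots> \<le> ennreal (c\<^sup>2 * M)"
    using estimate[OF alpha] unfolding c2 by (simp add: X_def M_def mult_ac)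
  finally have Y_int: "(\<integral>\<^sup>+ \<omega>. Y \<omega> \<partial>P) \<le> ennreal (c\<^sup>2 * M)" .
  have "\<exists>bad\<in>sets P. measure P bad \<le> c \<and> (AE \<omega> in P. \<omega> \<notin> bad \<longrightarrow> (\<forall>t\<in>{0..1}. Hnorm 0 (X t \<omega>) \<le> M / ?d t))"
  \<comment> \<open>Markov's inequality divides by \<open>c * M\<close>, so the degenerate case is
    treated separately, with an empty exceptional set.\<close>
  proof (cases "0 < c \<and> 0 < M")
    case True
    define bad where "bad = {\<omega> \<in> space P. ennreal (c * M) \<le> Y \<omega>}"
    have bad: "bad \<in> sets P" unfolding bad_def using Y_meas by measurable
    have "ennreal (c * M) * emeasure P bad = (\<integral>\<^sup>+ \<omega>. ennreal (c * M) * indicator bad \<omega> \<partial>P)"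
      using bad by (simp add: nn_integral_cmult_indicator)
    also have "\<dots> \<le> (\<integral>\<^sup>+ \<omega>. Y \<omega> \<partial>P)"
      by (intro nn_integral_mono) (auto simp: bad_def split: split_indicator)
    also have "\<dots> \<le> ennreal (c\<^sup>2 * M)" by (rule Y_int)
    finally have "ennreal (c * M * measure P bad) \<le> ennreal (c\<^sup>2 * M)"
      using True by (simp add: P.emeasure_eq_measure ennreal_mult)
    then have "c * M * measure P bad \<le> c\<^sup>2 * M" using True by (simp add: ennreal_le_iff)
    then have "(c * M) * measure P bad \<le> (c * M) * c" by (simp add: power2_eq_square mult_ac)
    then have m: "measure P bad \<le> c" using True by (simp add: mult_le_cancel_left_pos)
    have "AE \<omega> in P. \<omega> \<in> space P" by (rule AE_space)
    with good have "AE \<omega> in P. \<omega> \<notin> bad \<longrightarrow> (\<forall>t\<in>{0..1}. Hnorm 0 (X t \<omega>) \<le> M / ?d t)"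
    proof eventually_elim
      case (elim \<omega>)
      show ?case
      proof (intro impI ballI)
        fix t :: real assume nb: "\<omega> \<notin> bad" and t: "t \<in> {0..1}"
        have Ylt: "Y \<omega> < ennreal (c * M)" using nb elim by (simp add: bad_def not_le)
        have q: "Hnorm (- 1) (\<lambda>k. X q \<omega> k - S q T0 k) \<le> c * M" if "q \<in> D" for q
        proof -
          have "ennreal (Hnorm (- 1) (\<lambda>k. X q \<omega> k - S q T0 k)) \<le> Y \<omega>"
            unfolding Y_def using that by (intro SUP_upper)
          then have "ennreal (Hnorm (- 1) (\<lambda>k. X q \<omega> k - S q T0 k)) \<le> ennreal (c * M)" using Ylt by simp
          then show ?thesis using True by (simp add: ennreal_le_iff)
        qed
        have all: "Hnorm (- 1) (\<lambda>k. X r \<omega> k - S r T0 k) \<le> c * M" if r: "r \<in> {0..1}" for r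
        proof (rule Hnorm_le_on_rationals_imp_le[of "\<lambda>r k. X r \<omega> k - S r T0 k" "- 1" "\<lambda>_. c * M"])
          show "(\<lambda>k. X r \<omega> k - S r T0 k) \<in> Hsp (- 1)" if "r \<in> {0..1}" for r using that elim by (intro diff_Hm1)
          show "continuous_on {0..1} (\<lambda>r. X r \<omega> k - S r T0 k)" for k
            using DF.semigroup_coef_continuous[OF S T0, of k]
            by (intro continuous_on_diff X_cont elim) (auto intro: continuous_on_subset)
          show "Hnorm (- 1) (\<lambda>k. X r \<omega> k - S r T0 k) \<le> c * M" if "r \<in> \<rat> \<inter> {0<..<1}" for r
            using q that by (simp add: D_def)
        qed (use r in auto)
        show "Hnorm 0 (X t \<omega>) \<le> M / ?d t"
        proof (rule transport.decay_of_small_negative_norm[of \<kappa> J u "\<lambda>j t. \<eta> \<alpha> j t \<omega>" "\<lambda>r. velocity J u (\<eta> \<alpha>) r \<omega>" "\<lambda>t. X t \<omega>"])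
          show "transport \<kappa> J u (\<lambda>j t. \<eta> \<alpha> j t \<omega>) (\<lambda>r. velocity J u (\<eta> \<alpha>) r \<omega>) (\<lambda>t. X t \<omega>)"
            "Hnorm 0 (X 0 \<omega>) \<le> M" using elim by (auto simp: good_def M_def)
          show "(Hnorm (- 1) (X r \<omega>))\<^sup>2 \<le> 2 * M\<^sup>2 * (c\<^sup>2 + exp (- 2 * lam * r))" if r: "r \<in> {0..1}" for r
          proof -
            have "Hnorm (- 1) (X r \<omega>) \<le> Hnorm (- 1) (\<lambda>k. X r \<omega> k - S r T0 k) + Hnorm (- 1) (S r T0)"
              by (rule Hnorm_triangle[OF X_L2[OF r elim(2)] S_L2[OF r]]) simp
            also have "\<dots> \<le> c * M + exp (- lam * r) * M"
            proof (rule add_mono[OF all[OF r]])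
              have "Hnorm (- 1) (S r T0) \<le> Hnorm 0 (S r T0)" by (rule Hnorm_mono[OF _ S_L2[OF r]]) simp
              also have "\<dots> \<le> exp (- lam * r) * M"
                unfolding M_def using r by (intro DF.semigroup_decay[OF S lambda(1) T0]) auto
              finally show "Hnorm (- 1) (S r T0) \<le> exp (- lam * r) * M" .
            qed
            finally have "(Hnorm (- 1) (X r \<omega>))\<^sup>2 \<le> (c * M + exp (- lam * r) * M)\<^sup>2" by (rule power_mono) simp
            \<comment> \<open>This is the origin of the factor 2 in the smallness hypothesis of
              \<open>decay_of_small_negative_norm\<close>.\<close>
            also have "\<dots> \<le> 2 * (c * M)\<^sup>2 + 2 * (exp (- lam * r) * M)\<^sup>2"
              using sum_squares_bound[of "c * M" "exp (- lam * r) * M"] by (simp add: power2_sum)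
            also have "\<dots> = 2 * M\<^sup>2 * (c\<^sup>2 + (exp (- lam * r))\<^sup>2)" by (simp add: power_mult_distrib algebra_simps)
            also have "(exp (- lam * r))\<^sup>2 = exp (- 2 * lam * r)" by (simp flip: exp_double)
            finally show ?thesis .
          qed
        qed (use True lambda(2) t in auto)
      qed
    qed
    then show ?thesis using bad m by blast
  next
    case False
    have "AE \<omega> in P. \<omega> \<notin> {} \<longrightarrow> (\<forall>t\<in>{0..1}. Hnorm 0 (X t \<omega>) \<le> M / ?d t)"
      using good
    proof eventually_elim
      case (elim \<omega>)
      show ?case
      proof (intro impI ballI)
        fix t :: real assume t: "t \<in> {0..1}"
        have "M = 0 \<or> c = 0" using False M0 c0 by linarith
        \<comment> \<open>Division by zero yields 0, so for \<open>c = 0\<close> the logarithmic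
          term disappears and the claim reduces to monotonicity of the norm.\<close>
        moreover have "?d t = 1" if "c = 0" using that by (simp add: decay_denom_def)
        ultimately show "Hnorm 0 (X t \<omega>) \<le> M / ?d t" using mono[OF elim t] by auto
      qed
    qed
    then show ?thesis using c0 by (intro bexI[of _ "{}"]) auto
  qed
  then obtain bad where bad: "bad \<in> sets P" "measure P bad \<le> c"
    and AE_bound: "AE \<omega> in P. \<omega> \<notin> bad \<longrightarrow> (\<forall>t\<in>{0..1}. Hnorm 0 (X t \<omega>) \<le> M / ?d t)" by blast
  let ?E = "{\<omega> \<in> space P. \<forall>t\<in>{0..1}. Hnorm 0 (X t \<omega>) \<le> M / ?d t}"
  let ?E' = "{\<omega> \<in> space P. \<forall>q\<in>D. Hnorm 0 (X q \<omega>) \<le> M / ?d q}"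
  \<comment> \<open>The event involves uncountably many times. On good realisations it agrees with
    its version \<open>?E'\<close> over the countable set \<open>D\<close>, and completeness of the
    measure absorbs the remaining null set.\<close>
  have E: "?E \<in> sets P"
  proof (rule PC.in_sets_AE)
    show "?E' \<in> sets P"
    proof (rule sets.sets_Collect_countable_All'[OF _ D_countable])
      fix q assume "q \<in> D"
      then have "(\<lambda>\<omega>. Hnorm 0 (X q \<omega>)) \<in> borel_measurable P" using D01 by (intro norm_meas) auto
      then show "{\<omega> \<in> space P. Hnorm 0 (X q \<omega>) \<le> M / ?d q} \<in> sets P" by measurable
    qed
    have "AE \<omega> in P. \<omega> \<in> space P" by (rule AE_space)
    with good show "AE \<omega> in P. \<omega> \<in> ?E' \<longleftrightarrow> \<omega> \<in> ?E"
    proof eventually_elim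
      case (elim \<omega>)
      have "Hnorm 0 (X t \<omega>) \<le> M / ?d t" if "\<forall>q\<in>D. Hnorm 0 (X q \<omega>) \<le> M / ?d q" "t \<in> {0..1}" for t
      proof (rule Hnorm_le_on_rationals_imp_le[of "\<lambda>t. X t \<omega>" 0 "\<lambda>t. M / ?d t"])
        show "continuous_on {0..1} (\<lambda>t. M / ?d t)"
          using d1 by (intro continuous_intros decay_denom_continuous kappa lambda(2)) force
      qed (use that elim X_cont X_L2 in \<open>auto simp: D_def\<close>)
      then show ?case using elim D01 by auto
    qed
  qed auto
  have "1 - c \<le> measure P (space P - bad)" using bad by (simp add: P.prob_compl)
  also have "\<dots> \<le> measure P ?E"
  proof (rule P.finite_measure_mono_AE[OF _ E])
    show "AE \<omega> in P. \<omega> \<in> space P - bad \<longrightarrow> \<omega> \<in> ?E"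
      using AE_bound by eventually_elim auto
  qed
  finally have prob: "1 - c \<le> measure P ?E" .
  have expectation: "integrable P (\<lambda>\<omega>. Hnorm 0 (X t \<omega>)) \<and> (LINT \<omega>|P. Hnorm 0 (X t \<omega>)) \<le> c * M + M / ?d t"
    if t: "t \<in> {0..1}" for t
  proof
    show int: "integrable P (\<lambda>\<omega>. Hnorm 0 (X t \<omega>))"
    proof (rule P.integrable_const_bound[OF _ norm_meas[OF t]])
      show "AE \<omega> in P. norm (Hnorm 0 (X t \<omega>)) \<le> M" using good by eventually_elim (use mono t in auto)
    qed
    have ib: "integrable P (indicat_real bad)"
      using bad by (intro integrable_real_indicator) (auto simp: P.emeasure_eq_measure)
    \<comment> \<open>Off the bad event the decay bound holds; on it the norm is still at most
      \<open>M\<close>, which costs \<open>M\<close> times a probability of at most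
      \<open>c\<close>.\<close>
    have "(LINT \<omega>|P. Hnorm 0 (X t \<omega>)) \<le> (LINT \<omega>|P. M / ?d t + M * indicator bad \<omega>)"
    proof (rule integral_mono_AE[OF int])
      show "integrable P (\<lambda>\<omega>. M / ?d t + M * indicator bad \<omega>)"
        by (intro Bochner_Integration.integrable_add P.integrable_const integrable_mult_right ib)
      show "AE \<omega> in P. Hnorm 0 (X t \<omega>) \<le> M / ?d t + M * indicator bad \<omega>"
        using good AE_bound
      proof eventually_elim
        case (elim \<omega>)
        have "0 \<le> M / ?d t" using M0 d1[OF t] by simp
        then show ?case using elim mono[OF elim(1) t] t by (cases "\<omega> \<in> bad") auto
      qed
    qed
    also have "\<dots> = M / ?d t + M * measure P bad"
      using bad ib by (subst Bochner_Integration.integral_add) (auto simp: P.prob_space)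
    also have "\<dots> \<le> M / ?d t + M * c" using bad M0 by (intro add_left_mono mult_left_mono)
    finally show "(LINT \<omega>|P. Hnorm 0 (X t \<omega>)) \<le> c * M + M / ?d t" by (simp add: mult.commute)
  qed
  show ?thesis using E prob expectation unfolding X_def M_def by blast
qed

end
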